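(* There exists a universal constant $c_\Box>0$ such that the following holds. Let $\{\Omega_k\}_{k\in\mathbb N}$ be any sequence of nonempty, bounded, open, convex subsets of $\mathbb R^3$ with $\operatorname{diam}(\Omega_k)=1$ for every $k\in\mathbb N$ and such that, up to rigid motions (i.e. after replacing each $\Omega_k$ by its image under a suitable rigid motion of $\mathbb R^3$), $$\overline{\Omega_k}\to K=\omega\times\{0\}\qquad\text{in the Hausdorff sense as }k\to\infty,$$ where $\omega\subset\mathbb R^2$ is a bounded convex set with nonempty interior. Then $$\liminf_{k\to\infty}J_{\mathrm{Per}}(\Omega_k)\ge c_\Box,\qquad\text{where }J_{\mathrm{Per}}(\Omega):=\mathrm{Per}(\Omega)\,\lambda_1^{\mathrm{Max}}(\Omega).$$
   Context: $\mathrm{Per}(\Omega)$ is the De Giorgi perimeter of $\Omega$. Hausdorff convergence means convergence for the Hausdorff distance. First Maxwell eigenvalue. For $\Omega\subset\mathbb R^3$ nonempty, bounded, open and convex, let $\mathbf H(\operatorname{curl};\Omega)$ be the space of $\mathbf u\in L^2(\Omega)^3$ with distributional $\operatorname{curl}\mathbf u\in L^2(\Omega)^3$, and let $\mathbf H_0(\operatorname{curl};\Omega)$ be the closure of $C_c^\infty(\Omega)^3$ in $\mathbf H(\operatorname{curl};\Omega)$ (equivalently, the fields with zero tangential trace $\mathbf u\times\mathbf n=0$ on $\partial\Omega$). Set $\mathcal S(\Omega):=\{\mathbf E\in\mathbf H_0(\operatorname{curl};\Omega):\operatorname{div}\mathbf E=0\text{ in }\Omega\}$ and $$\lambda_1^{\mathrm{Max}}(\Omega):=\min_{\mathbf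 E\in\mathcal S(\Omega)\setminus\{0\}}\frac{\int_\Omega|\operatorname{curl}\mathbf E|^2\,dx}{\int_\Omega|\mathbf E|^2\,dx}.$$ *)

theory Defs
  imports "HOL-Analysis.Analysis"
begin

section \<open>Smooth functions with compact support\<close>

definition pd :: "'n \<Rightarrow> (real^'n \<Rightarrow> 'b) \<Rightarrow> real^'n \<Rightarrow> 'b::real_normed_vector" where
  "pd i f x = frechet_derivative f (at x) (axis i 1)"

text \<open>Differentiability is part of the recursion step because \<open>frechet_derivative\<close> is a choice
  operator without meaning where the derivative does not exist.\<close>

primrec Ck :: "nat \<Rightarrow> (real^'n \<Rightarrow> 'b::real_normed_vector) \<Rightarrow> bool" where
  "Ck 0 f \<longleftrightarrow> continuous_on UNIV f"
| "Ck (Suc k) f \<longleftrightarrow> (\<forall>x. f differentiable (at x)) \<and> (\<forall>i. Ck k (pd i f))"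

definition compact_support_in :: "(real^'n) set \<Rightarrow> (real^'n \<Rightarrow> 'b::zero) \<Rightarrow> bool" where
  "compact_support_in \<Omega> f \<longleftrightarrow> compact (closure {x. f x \<noteq> 0}) \<and> closure {x. f x \<noteq> 0} \<subseteq> \<Omega>"

text \<open>\<open>C\<^sub>c\<^sup>\<infinity>(\<Omega>)\<close>, with each function extended by zero to the whole space.\<close>

definition test_functions :: "(real^'n) set \<Rightarrow> (real^'n \<Rightarrow> 'b::real_normed_vector) set" where
  "test_functions \<Omega> = {\<phi>. (\<forall>k. Ck k \<phi>) \<and> compact_support_in \<Omega> \<phi>}"

definition grad :: "(real^'n \<Rightarrow> real) \<Rightarrow> real^'n \<Rightarrow> real^'n" where
  "grad \<psi> x = (\<chi> i. pd i \<psi> x)"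

definition divergence :: "(real^'n \<Rightarrow> real^'n) \<Rightarrow> real^'n \<Rightarrow> real" where
  "divergence \<phi> x = (\<Sum>i\<in>UNIV. pd i \<phi> x $ i)"

definition curl :: "(real^3 \<Rightarrow> real^3) \<Rightarrow> real^3 \<Rightarrow> real^3" where
  "curl \<phi> x = vector [pd 2 \<phi> x $ 3 - pd 3 \<phi> x $ 2,
                      pd 3 \<phi> x $ 1 - pd 1 \<phi> x $ 3,
                      pd 1 \<phi> x $ 2 - pd 2 \<phi> x $ 1]"

section \<open>De Giorgi perimeter\<close>

definition Per :: "(real^'n) set \<Rightarrow> ereal" where
  "Per \<Omega> = (SUP \<phi> \<in> {\<phi> :: real^'n \<Rightarrow> real^'n.
              Ck 1 \<phi> \<and> compact_support_in UNIV \<phi> \<and> (\<forall>x. norm (\<phi> x) \<le> 1)}.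
            ereal (LINT x|lebesgue_on \<Omega>. divergence \<phi> x))"

section \<open>First Maxwell eigenvalue\<close>

text \<open>Square integrable fields are represented by functions rather than by their classes modulo
  equality almost everywhere; their values outside \<open>\<Omega>\<close> are irrelevant.\<close>

definition L2_fields :: "(real^'n) set \<Rightarrow> (real^'n \<Rightarrow> real^'n) set" where
  "L2_fields \<Omega> = {u \<in> borel_measurable (lebesgue_on \<Omega>).
                    integrable (lebesgue_on \<Omega>) (\<lambda>x. (norm (u x))\<^sup>2)}"

definition is_weak_curl :: "(real^3) set \<Rightarrow> (real^3 \<Rightarrow> real^3) \<Rightarrow> (real^3 \<Rightarrow> real^3) \<Rightarrow> bool" where
  "is_weak_curl \<Omega> u w \<longleftrightarrow>
     (\<forall>\<phi> \<in> test_functions \<Omega>.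
        (LINT x|lebesgue_on \<Omega>. u x \<bullet> curl \<phi> x) = (LINT x|lebesgue_on \<Omega>. w x \<bullet> \<phi> x))"

definition H_curl :: "(real^3) set \<Rightarrow> (real^3 \<Rightarrow> real^3) set" where
  "H_curl \<Omega> = {u \<in> L2_fields \<Omega>. \<exists>w \<in> L2_fields \<Omega>. is_weak_curl \<Omega> u w}"

text \<open>For \<open>u \<in> H_curl \<Omega>\<close> with \<open>\<Omega>\<close> open, the field selected here is unique up to equality
  almost everywhere on \<open>\<Omega>\<close>, and it is only used under integrals.\<close>

definition weak_curl :: "(real^3) set \<Rightarrow> (real^3 \<Rightarrow> real^3) \<Rightarrow> real^3 \<Rightarrow> real^3" where
  "weak_curl \<Omega> u = (SOME w. w \<in> L2_fields \<Omega> \<and> is_weak_curl \<Omega> u w)"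

text \<open>The closure of the test fields for the squared graph norm
  \<open>\<parallel>u\<parallel>\<^sup>2 + \<parallel>curl u\<parallel>\<^sup>2\<close>.\<close>

definition H0_curl :: "(real^3) set \<Rightarrow> (real^3 \<Rightarrow> real^3) set" where
  "H0_curl \<Omega> = {u \<in> H_curl \<Omega>. \<forall>\<epsilon>>0. \<exists>\<phi> \<in> test_functions \<Omega>.
       (LINT x|lebesgue_on \<Omega>. (norm (u x - \<phi> x))\<^sup>2)
     + (LINT x|lebesgue_on \<Omega>. (norm (weak_curl \<Omega> u x - curl \<phi> x))\<^sup>2) < \<epsilon>}"

definition weakly_div_free :: "(real^'n) set \<Rightarrow> (real^'n \<Rightarrow> real^'n) \<Rightarrow> bool" where
  "weakly_div_free \<Omega> E \<longleftrightarrow>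
     (\<forall>\<psi> \<in> test_functions \<Omega>. (LINT x|lebesgue_on \<Omega>. E x \<bullet> grad \<psi> x) = 0)"

definition maxwell_space :: "(real^3) set \<Rightarrow> (real^3 \<Rightarrow> real^3) set" where
  "maxwell_space \<Omega> = {E \<in> H0_curl \<Omega>. weakly_div_free \<Omega> E}"

text \<open>The minimum of the Rayleigh quotient, written as an infimum; nonzero fields are those not
  vanishing almost everywhere on \<open>\<Omega>\<close>.\<close>

definition lambda1_Max :: "(real^3) set \<Rightarrow> ereal" where
  "lambda1_Max \<Omega> = (INF E \<in> {E \<in> maxwell_space \<Omega>. \<not> (AE x in lebesgue_on \<Omega>. E x = 0)}.
      ereal ((LINT x|lebesgue_on \<Omega>. (norm (weak_curl \<Omega> E x))\<^sup>2)
           / (LINT x|lebesgue_on \<Omega>. (norm (E x))\<^sup>2)))"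

definition J_Per :: "(real^3) set \<Rightarrow> ereal" where
  "J_Per \<Omega> = Per \<Omega> * lambda1_Max \<Omega>"

section \<open>Hausdorff convergence up to rigid motions\<close>

text \<open>Meaningful for nonempty bounded sets.\<close>

definition hausdorff_dist :: "'a::metric_space set \<Rightarrow> 'a set \<Rightarrow> real" where
  "hausdorff_dist A B = max (SUP x\<in>A. infdist x B) (SUP y\<in>B. infdist y A)"

text \<open>Orientation-reversing isometries are included. For limits in the plane \<open>x\<^sub>3 = 0\<close> this makes
  no difference: composing with the reflection in that plane changes the orientation and leaves
  the distance to the limit unchanged.\<close>

definition rigid_motion :: "('a::euclidean_space \<Rightarrow> 'a) \<Rightarrow> bool" where
  "rigid_motion T \<longleftrightarrow> (\<exists>a f. orthogonal_transformation f \<and> T = (\<lambda>x. a + f x))"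

definition flat :: "(real^2) set \<Rightarrow> (real^3) set" where
  "flat \<omega> = (\<lambda>y. vector [y$1, y$2, 0]) ` \<omega>"

end

theory Submission
  imports Defs
begin

text \<open>The bound holds for every convex body of diameter 1, with a constant that does not depend on its
  shape. Let \<open>u\<^sub>1\<close> point along a diameter and let \<open>\<beta>\<close> be the largest distance of a point of \<open>\<Omega>\<close> to that
  diameter, attained in direction \<open>u\<^sub>2\<close>. A planar section of \<open>\<Omega>\<close> has area of order \<open>\<beta>\<close>, so the
  perimeter is at least of order \<open>\<beta>\<close>, and it suffices that \<open>\<lambda>\<^sub>1\<close> is at least of order \<open>1 / \<beta>\<^sup>2\<close>.

  Since a divergence free \<open>E\<close> is orthogonal to gradients of functions with compact support, this
  eigenvalue bound reduces to finding, for every test field \<open>\<phi>\<close>, a compactly supported \<open>\<psi>\<close> with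
  \<open>\<parallel>\<phi> - \<nabla>\<psi>\<parallel> \<le> C \<beta> \<parallel>curl \<phi>\<parallel>\<close>. Integrating \<open>\<phi>\<^sub>3\<close> upwards along \<open>u\<^sub>3\<close> gives such a potential, except that
  above \<open>\<Omega>\<close> it equals the total \<open>\<Phi>\<close> of the column. Subtracting \<open>\<eta> \<Phi>\<close>, where \<open>\<eta>\<close> runs from 0 to 1
  between the lower boundary \<open>B\<close> and the upper boundary \<open>T\<close> of \<open>\<Omega>\<close>, restores compact support and
  costs weighted integrals of \<open>\<Phi>\<^sup>2 / (T - B)\<close>. As \<open>T - B\<close> is concave, Hardy's inequality on lines bounds
  them by \<open>(\<partial>\<^sub>j \<Phi>)\<^sup>2 / (T - B)\<close>, and \<open>\<partial>\<^sub>j \<Phi>\<close> is the integral of a component of the curl over the column.\<close>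

section \<open>Smooth functions and mollification\<close>

text \<open>The obstacle is that \<Omega> has length 1 along \<open>u1\<close>, while every loss has
  to be of order \<beta>. The error of the gradient along a horizontal direction involves the slopes
  of \<open>T\<close> and \<open>B\<close> in that direction, and the Hardy inequality weighted with
  slopes has a constant that depends on the height only, so the long direction does no harm. The
  error along \<open>u3\<close> needs a Hardy inequality without slopes, whose constant is a width;
  any horizontal direction may serve there, and the short one, \<open>u2\<close>, is taken. Two
  regularizations are forced: the boundary of \<Omega> may have corners, so \<open>T\<close> and
  \<open>B\<close> are smooth graphs whose slab lies in \<Omega> and contains the support of the
  test field; and the potential is only C1, so it is mollified before it is tested against
  \<open>E\<close>. For widths \<delta> the three errors give 148 = 66 + 66 + 16, and two splittings
  of squared norms turn this into the eigenvalue bound \<open>1 / (592 * \<delta>\<^sup>2)\<close>.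
  With \<delta> = 2 \<beta> and a perimeter of at least \<beta> / 32, the product is at least 1 /
  (75776 \<beta>), and \<beta> is at most 1.\<close>

lemma has_derivative_pd:
  fixes f :: "real^'n \<Rightarrow> 'b::real_normed_vector"
  assumes "f differentiable (at x)"
  shows "(f has_derivative (\<lambda>h. \<Sum>i\<in>UNIV. h $ i *\<^sub>R pd i f x)) (at x)"
proof -
  let ?D = "frechet_derivative f (at x)"
  have D: "(f has_derivative ?D) (at x)"
    using assms frechet_derivative_works by blast
  then interpret bounded_linear ?D by (rule has_derivative_bounded_linear)
  have "?D h = (\<Sum>i\<in>UNIV. h $ i *\<^sub>R pd i f x)" for h
  proof -
    have "h = (\<Sum>i\<in>UNIV. h $ i *\<^sub>R axis i 1)"
      using basis_expansion[of h] by (simp add: scalar_mult_eq_scaleR)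
    then have "?D h = ?D (\<Sum>i\<in>UNIV. h $ i *\<^sub>R axis i 1)" by simp
    then show ?thesis by (simp add: sum scaleR pd_def)
  qed
  then show ?thesis using D by presburger
qed

lemma pd_eq: "(f has_derivative D) (at x) \<Longrightarrow> pd i f x = D (axis i 1)"
  unfolding pd_def using frechet_derivative_at by metis

lemma pd_GDERIV: "GDERIV f x :> g \<Longrightarrow> pd i f x = g $ i"
  unfolding gderiv_def by (drule pd_eq[where i = i]) (simp add: inner_axis')

lemma GDERIV_shift:
  assumes "GDERIV f (x + v) :> D"
  shows "GDERIV (\<lambda>x. f (x + v)) x :> D"
proof -
  have "((\<lambda>x. x + v) has_derivative (\<lambda>h. h)) (at x)"
    by (auto intro!: derivative_eq_intros)
  from has_derivative_compose[OF this assms[unfolded gderiv_def]] show ?thesis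
    unfolding gderiv_def .
qed

lemma grad_GDERIV: "GDERIV f x :> g \<Longrightarrow> grad f x = g"
  by (simp add: grad_def vec_eq_iff pd_GDERIV)

lemma Ck_Suc_imp: "Ck (Suc k) f \<Longrightarrow> Ck k f"
proof (induction k arbitrary: f)
  case 0
  then show ?case
    using differentiable_imp_continuous_within by (auto simp: continuous_on_eq_continuous_at)
next
  case (Suc k)
  then show ?case by (metis Ck.simps(2))
qed

lemma Ck_differentiable: "Ck (Suc k) f \<Longrightarrow> f differentiable (at x)"
  by simp

lemma Ck_continuous: "Ck k f \<Longrightarrow> continuous_on A f"
proof (induction k arbitrary: f)
  case 0
  then show ?case using continuous_on_subset by force
next
  case (Suc k)
  then show ?case using Ck_Suc_imp by blast
qed

text \<open>Smoothness is read off from any formula for the derivative, without meeting the choice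
  operator inside \<open>pd\<close>.\<close>

lemma Ck_SucI:
  assumes "\<And>x. (f has_derivative D x) (at x)" "\<And>i. Ck k (\<lambda>x. D x (axis i 1))"
  shows "Ck (Suc k) f"
proof -
  have "pd i f = (\<lambda>x. D x (axis i 1))" for i
    using assms(1) pd_eq by blast
  moreover have "f differentiable (at x)" for x using assms(1) by (rule differentiableI)
  ultimately show ?thesis using assms(2) by simp
qed

lemma GDERIV_Ck:
  fixes f :: "real^'n \<Rightarrow> real"
  assumes "Ck (Suc k) f"
  shows "GDERIV f x :> (\<chi> i. pd i f x)"
  using has_derivative_pd[OF Ck_differentiable[OF assms, of x]]
  by (simp add: gderiv_def inner_vec_def)

lemma Ck_const: "Ck k (\<lambda>x. c)"
proof (induction k arbitrary: c)
  case (Suc k)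
  then show ?case by (intro Ck_SucI[of _ "\<lambda>x h. 0"]) (auto intro!: derivative_eq_intros)
qed simp

lemma Ck_add: "Ck k f \<Longrightarrow> Ck k g \<Longrightarrow> Ck k (\<lambda>x. f x + g x)"
proof (induction k arbitrary: f g)
  case 0
  then show ?case by (auto intro: continuous_intros)
next
  case (Suc k)
  have "((\<lambda>x. f x + g x) has_derivative (\<lambda>h. frechet_derivative f (at x) h + frechet_derivative g (at x) h)) (at x)" for x
    using Suc.prems frechet_derivative_works by (intro has_derivative_add) auto
  then show ?case
    by (rule Ck_SucI) (use Suc in \<open>auto simp: pd_def[symmetric]\<close>)
qed

lemma Ck_mult:
  fixes f g :: "real^'n \<Rightarrow> real"
  shows "Ck k f \<Longrightarrow> Ck k g \<Longrightarrow> Ck k (\<lambda>x. f x * g x)"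
proof (induction k arbitrary: f g)
  case 0
  then show ?case by (auto intro: continuous_intros)
next
  case (Suc k)
  have "((\<lambda>x. f x * g x) has_derivative (\<lambda>h. f x * frechet_derivative g (at x) h + frechet_derivative f (at x) h * g x)) (at x)" for x
    using Suc.prems frechet_derivative_works by (intro has_derivative_mult) auto
  then show ?case
  proof (rule Ck_SucI)
    show "Ck k (\<lambda>x. f x * frechet_derivative g (at x) (axis i 1) + frechet_derivative f (at x) (axis i 1) * g x)" for i
      using Suc.prems Ck_Suc_imp[OF Suc.prems(1)] Ck_Suc_imp[OF Suc.prems(2)]
      unfolding pd_def[symmetric] by (intro Ck_add Suc.IH) auto
  qed
qed

lemma Ck_sum:
  fixes f :: "'i \<Rightarrow> real^'n \<Rightarrow> real"
  shows "finite I \<Longrightarrow> (\<And>i. i \<in> I \<Longrightarrow> Ck k (f i)) \<Longrightarrow> Ck k (\<lambda>x. \<Sum>i\<in>I. f i x)"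
  by (induction I rule: finite_induct) (auto intro!: Ck_add Ck_const)

lemma Ck_nth: "Ck k (\<lambda>x::real^'n. x $ i)"
proof (cases k)
  case (Suc m)
  have "((\<lambda>x::real^'n. x $ i) has_derivative (\<lambda>h. h $ i)) (at x)" for x
    by (rule bounded_linear.has_derivative[OF bounded_linear_vec_nth has_derivative_ident])
  then show ?thesis unfolding Suc by (rule Ck_SucI) (rule Ck_const)
qed (auto intro: continuous_intros)

text \<open>The derivative of \<open>t\<^sup>-\<^sup>n exp (- 1 / t)\<close> is a combination of the two next functions of this
  family, which makes smoothness at \<open>0\<close> an induction.\<close>

definition flat_exp :: "nat \<Rightarrow> real \<Rightarrow> real" where
  "flat_exp n t = (if t > 0 then inverse t ^ n * exp (- inverse t) else 0)"

lemma DERIV_flat_exp: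
  "(flat_exp n has_real_derivative (- real n * flat_exp (Suc n) t + flat_exp (Suc (Suc n)) t)) (at t)"
proof -
  consider "t < 0" | "t = 0" | "t > 0" by linarith
  then show ?thesis
  proof cases
    case 1
    have "((\<lambda>t. 0) has_real_derivative (- real n * flat_exp (Suc n) t + flat_exp (Suc (Suc n)) t)) (at t)"
      using 1 by (simp add: flat_exp_def)
    then show ?thesis
      by (rule has_field_derivative_transform_within_open[where S = "{..<0}"])
        (use 1 in \<open>auto simp: flat_exp_def\<close>)
  next
    case 2
    have lim: "((\<lambda>h. flat_exp n h / h) \<longlongrightarrow> 0) (at 0)"
    proof (rule filterlim_split_at_real)
      show "((\<lambda>h. flat_exp n h / h) \<longlongrightarrow> 0) (at_left 0)"
      proof (rule tendsto_eventually)
        show "\<forall>\<^sub>F h in at_left 0. flat_exp n h / h = 0"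
          unfolding eventually_at_filter by (auto simp: flat_exp_def)
      qed
      \<comment> \<open>With the reciprocal of \<open>h\<close> as variable, the difference quotient
        is a power divided by an exponential at infinity.\<close>
      have "((\<lambda>h::real. inverse h ^ Suc n / exp (inverse h)) \<longlongrightarrow> 0) (at_right 0)"
        by (rule filterlim_compose[OF tendsto_power_div_exp_0 filterlim_inverse_at_top_right])
      then show "((\<lambda>h. flat_exp n h / h) \<longlongrightarrow> 0) (at_right 0)"
      proof (rule Lim_transform_eventually)
        show "\<forall>\<^sub>F h in at_right 0. inverse h ^ Suc n / exp (inverse h) = flat_exp n h / h"
          unfolding eventually_at_filter by (auto simp: flat_exp_def exp_minus field_simps)
      qed
    qed
    then show ?thesis using 2 by (simp add: DERIV_def flat_exp_def)
  next
    case 3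
    have "((\<lambda>t. inverse t ^ n * exp (- inverse t)) has_real_derivative
        (- real n * flat_exp (Suc n) t + flat_exp (Suc (Suc n)) t)) (at t)"
    proof -
      have "((\<lambda>t. inverse t ^ n) has_real_derivative - real n * inverse t ^ Suc n) (at t)"
        using DERIV_power[OF DERIV_inverse[of t], of n] 3
        by (cases n) (auto simp: mult_ac ring_distribs)
      moreover have "((\<lambda>t. exp (- inverse t)) has_real_derivative inverse t ^ 2 * exp (- inverse t)) (at t)"
        using 3 by (auto intro!: derivative_eq_intros simp: power2_eq_square)
      ultimately have "((\<lambda>t. inverse t ^ n * exp (- inverse t)) has_real_derivative
          - real n * inverse t ^ Suc n * exp (- inverse t) + inverse t ^ 2 * exp (- inverse t) * inverse t ^ n) (at t)"
        by (rule DERIV_mult)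
      then show ?thesis
        by (rule DERIV_cong) (use 3 in \<open>simp add: flat_exp_def power2_eq_square mult_ac\<close>)
    qed
    then show ?thesis
      by (rule has_field_derivative_transform_within_open[where S = "{0<..}"])
        (use 3 in \<open>auto simp: flat_exp_def\<close>)
  qed
qed

text \<open>By the chain rule a partial derivative is a sum of members of the same family with
  larger \<open>n\<close>, multiplied by the smooth \<open>pd i f\<close>. Hence the induction on
  \<open>k\<close> keeps \<open>n\<close> arbitrary.\<close>

lemma Ck_flat_exp:
  fixes f :: "real^'n \<Rightarrow> real"
  assumes "\<And>k. Ck k f"
  shows "Ck k (\<lambda>x. flat_exp n (f x))"
proof (induction k arbitrary: n)
  case 0
  have "continuous_on UNIV (flat_exp n)"
    using DERIV_isCont[OF DERIV_flat_exp] by (simp add: continuous_at_imp_continuous_on)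
  from continuous_on_compose2[OF this, of UNIV f] show ?case
    using assms[of 0] by simp
next
  case (Suc k)
  have "((\<lambda>x. flat_exp n (f x)) has_derivative (\<lambda>h. (- real n * flat_exp (Suc n) (f x) + flat_exp (Suc (Suc n)) (f x))
      * frechet_derivative f (at x) h)) (at x)" for x
  proof -
    have "(f has_derivative frechet_derivative f (at x)) (at x)"
      using assms[of 1] frechet_derivative_works by auto
    from has_derivative_compose[OF this DERIV_flat_exp[of n "f x", unfolded has_field_derivative_def]]
    show ?thesis .
  qed
  then show ?case
  proof (rule Ck_SucI)
    show "Ck k (\<lambda>x. (- real n * flat_exp (Suc n) (f x) + flat_exp (Suc (Suc n)) (f x)) *
        frechet_derivative f (at x) (axis i 1))" for i
      using assms[of "Suc k"] unfolding pd_def[symmetric]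
      by (intro Ck_mult Ck_add Ck_const Suc) auto
  qed
qed

section \<open>Differentiation under the integral sign and approximation by convolution\<close>

text \<open>The Leibniz rule gives the derivative as an integral of linear functionals; as
  \<open>blinfun_inner_left\<close> is linear and bounded, it comes from the integrated gradient
  vector.\<close>

lemma GDERIV_integral:
  fixes f :: "'a::euclidean_space \<Rightarrow> 'b::euclidean_space \<Rightarrow> real"
  assumes f: "\<And>x t. GDERIV (\<lambda>x. f x t) x :> g x t" "\<And>x. continuous_on UNIV (f x)"
    and g: "continuous_on UNIV (\<lambda>(x, t). g x t)"
  shows "GDERIV (\<lambda>x. integral (cbox a b) (f x)) x :> integral (cbox a b) (g x)"
    and "continuous_on A (\<lambda>x. integral (cbox a b) (g x))"
proof -
  have gi: "g x integrable_on cbox a b" for x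
  proof (rule integrable_continuous)
    have "continuous_on (cbox a b) (\<lambda>t. case (x, t) of (x, t) \<Rightarrow> g x t)"
      by (rule continuous_on_compose2[OF g]) (auto intro!: continuous_intros)
    then show "continuous_on (cbox a b) (g x)" by simp
  qed
  have "((\<lambda>x. integral (cbox a b) (f x)) has_derivative
      integral (cbox a b) (\<lambda>t. blinfun_inner_left (g x t))) (at x within UNIV)"
  proof (rule leibniz_rule)
    show "((\<lambda>x. f x t) has_derivative blinfun_inner_left (g x t)) (at x within UNIV)" for x t
      using f(1)[of t x] by (simp add: gderiv_def)
    show "f x integrable_on cbox a b" for x
      using f(2) by (intro integrable_continuous) (rule continuous_on_subset, auto)
    have "continuous_on (UNIV \<times> cbox a b) (\<lambda>p. g (fst p) (snd p))"
      using g by (auto simp: split_beta intro: continuous_on_subset)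
    then show "continuous_on (UNIV \<times> cbox a b) (\<lambda>(x, t). blinfun_inner_left (g x t))"
      unfolding split_beta by (rule bounded_linear.continuous_on[OF bounded_linear_blinfun_inner_left])
  qed auto
  moreover have "integral (cbox a b) (\<lambda>t. blinfun_inner_left (g x t)) = blinfun_inner_left (integral (cbox a b) (g x))"
    using integral_linear[OF gi bounded_linear_blinfun_inner_left] by (simp add: comp_def)
  ultimately show "GDERIV (\<lambda>x. integral (cbox a b) (f x)) x :> integral (cbox a b) (g x)"
    by (simp add: gderiv_def blinfun_inner_left.rep_eq[abs_def])
  show "continuous_on A (\<lambda>x. integral (cbox a b) (g x))"
    by (rule integral_continuous_on_param) (rule continuous_on_subset[OF g], simp)
qed

text \<open>All derivatives fall on the kernel, so continuity of \<psi> is enough. Each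
  differentiation replaces \<rho> by the smooth function \<open>pd j \<rho>\<close>, which is why
  the induction keeps \<rho> arbitrary.\<close>

lemma Ck_convolution:
  fixes \<psi> \<rho> :: "real^'n \<Rightarrow> real"
  assumes \<psi>: "continuous_on UNIV \<psi>" and \<rho>: "\<And>k. Ck k \<rho>"
  shows "Ck k (\<lambda>x. integral (cbox a b) (\<lambda>y. \<psi> y * \<rho> (x - y)))"
  using \<rho>
proof (induction k arbitrary: \<rho>)
  case 0
  have c: "continuous_on UNIV \<rho>" using 0[of 0] by simp
  have "continuous_on (UNIV \<times> cbox a b) (\<lambda>(x, y). \<psi> y * \<rho> (x - y))"
    unfolding split_beta
    by (intro continuous_intros continuous_on_compose2[OF \<psi>] continuous_on_compose2[OF c]) auto
  then show ?case by (simp add: integral_continuous_on_param)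
next
  case (Suc k)
  have c: "continuous_on UNIV \<rho>" using Suc.prems[of 0] by simp
  have pc: "Ck k (pd i \<rho>)" for k i using Suc.prems[of "Suc k"] by simp
  have cp: "continuous_on UNIV (\<lambda>x. \<chi> i. pd i \<rho> x)"
    using pc[of 0] by (intro continuous_on_vec_lambda) simp
  let ?g = "\<lambda>x y. \<psi> y *\<^sub>R (\<chi> i. pd i \<rho> (x - y))"
  have gc: "continuous_on UNIV (\<lambda>(x, y). ?g x y)"
    unfolding split_beta
    by (intro continuous_intros continuous_on_compose2[OF \<psi>] continuous_on_compose2[OF cp]) auto
  have "GDERIV (\<lambda>x. \<psi> y * \<rho> (x - y)) x :> ?g x y" for x y
  proof -
    have "GDERIV (\<lambda>x. \<rho> (x - y)) x :> (\<chi> i. pd i \<rho> (x - y))"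
      using GDERIV_shift[of \<rho> x "- y"] GDERIV_Ck[OF Suc.prems[of "Suc 0"], of "x - y"] by simp
    then show ?thesis
      unfolding gderiv_def by (auto intro!: derivative_eq_intros)
  qed
  note G = GDERIV_integral(1)[OF this _ gc, where a = a and b = b]
  have G': "GDERIV (\<lambda>x. integral (cbox a b) (\<lambda>y. \<psi> y * \<rho> (x - y))) x :> integral (cbox a b) (?g x)" for x
    by (rule G) (intro continuous_intros \<psi> continuous_on_compose2[OF c], auto)
  have i: "?g x integrable_on cbox a b" for x
    by (intro integrable_continuous continuous_intros continuous_on_subset[OF \<psi>]
        continuous_on_compose2[OF cp]) auto
  show ?case
  proof (rule Ck_SucI)
    show "((\<lambda>x. integral (cbox a b) (\<lambda>y. \<psi> y * \<rho> (x - y))) has_derivative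
       (\<lambda>h. h \<bullet> integral (cbox a b) (?g x))) (at x)" for x
      using G' by (simp add: gderiv_def)
    have "axis j 1 \<bullet> integral (cbox a b) (?g x) = integral (cbox a b) (\<lambda>y. \<psi> y * pd j \<rho> (x - y))" for j x
      using integral_linear[OF i bounded_linear_inner_right[of "axis j 1"], of x]
      by (simp add: comp_def inner_axis')
    then show "Ck k (\<lambda>x. axis j 1 \<bullet> integral (cbox a b) (?g x))" for j
      using Suc.IH[OF pc] by simp
  qed
qed

text \<open>Smoothness is visible when the kernel carries the variable \<open>x\<close>, closeness
  of gradients when \<psi> carries it. The substitution z = x - y links the two forms; the supports
  allow each integral to run over a fixed box.\<close>

lemma convolution_swap:
  fixes \<psi> \<rho> :: "'a::euclidean_space \<Rightarrow> real"
  assumes \<psi>: "continuous_on UNIV \<psi>" "\<And>x. x \<notin> cbox (-a) a \<Longrightarrow> \<psi> x = 0"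
    and \<rho>: "continuous_on UNIV \<rho>" "\<And>x. x \<notin> cbox (-b) b \<Longrightarrow> \<rho> x = 0"
  shows "integral (cbox (-a) a) (\<lambda>y. \<psi> y * \<rho> (x - y)) = integral (cbox (-b) b) (\<lambda>z. \<psi> (x - z) * \<rho> z)"
proof -
  let ?f = "\<lambda>y. \<psi> y * \<rho> (x - y)"
  have "(?f has_integral integral (cbox (-a) a) ?f) (cbox (-a) a)"
    by (intro integrable_integral integrable_continuous continuous_intros
        continuous_on_subset[OF \<psi>(1)] continuous_on_compose2[OF \<rho>(1)]) auto
  from has_integral_affinity[OF this, of "-1" x]
  have "((\<lambda>z. \<psi> (x - z) * \<rho> z) has_integral integral (cbox (-a) a) ?f) ((\<lambda>z. x - z) ` cbox (-a) a)"
    by (simp add: algebra_simps)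
  then have A: "((\<lambda>z. \<psi> (x - z) * \<rho> z) has_integral integral (cbox (-a) a) ?f) UNIV"
  proof (rule has_integral_on_superset)
    show "\<psi> (x - z) * \<rho> z = 0" if "z \<notin> (\<lambda>z. x - z) ` cbox (-a) a" for z
    proof -
      have "z = x - (x - z)" by simp
      then have "x - z \<notin> cbox (-a) a" using that by (metis image_eqI)
      then show ?thesis by (simp add: \<psi>(2))
    qed
  qed simp
  have "((\<lambda>z. \<psi> (x - z) * \<rho> z) has_integral integral (cbox (-b) b) (\<lambda>z. \<psi> (x - z) * \<rho> z)) (cbox (-b) b)"
    by (intro integrable_integral integrable_continuous continuous_intros
        continuous_on_subset[OF \<rho>(1)] continuous_on_compose2[OF \<psi>(1)]) auto
  then have "((\<lambda>z. \<psi> (x - z) * \<rho> z) has_integral integral (cbox (-b) b) (\<lambda>z. \<psi> (x - z) * \<rho> z)) UNIV"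
    by (rule has_integral_on_superset) (auto simp: \<rho>(2))
  from has_integral_unique[OF A this] show ?thesis .
qed

text \<open>The kernel is the usual bump exp(-1 / (\<epsilon>^2 - |x|^2)), divided by its
  integral.\<close>

lemma mollifier:
  assumes "\<epsilon> > 0"
  obtains \<rho> :: "real^'n \<Rightarrow> real" and b where "\<And>k. Ck k \<rho>" "\<And>x. \<rho> x \<ge> 0"
    "\<And>x. norm x \<ge> \<epsilon> \<Longrightarrow> \<rho> x = 0" "cball 0 \<epsilon> \<subseteq> cbox (-b) b" "integral (cbox (-b) b) \<rho> = 1"
proof -
  \<comment> \<open>The squared norm is spelled out as a polynomial in the coordinates, so that the
    closure rules for \<open>Ck\<close> apply.\<close>
  define q where "q x = \<epsilon>\<^sup>2 + (\<Sum>i\<in>UNIV. - 1 * (x $ i * x $ i))" for x :: "real^'n"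
  have q: "q x = \<epsilon>\<^sup>2 - (norm x)\<^sup>2" for x
    by (simp add: q_def power2_norm_eq_inner inner_vec_def sum_negf)
  have "Ck k (\<lambda>x::real^'n. \<Sum>i\<in>I. - 1 * (x $ i * x $ i))" if "finite I" for k and I :: "'n set"
    using that by (intro Ck_sum Ck_mult Ck_const Ck_nth)
  then have qC: "Ck k q" for k
    unfolding q_def[abs_def] by (intro Ck_add Ck_const) auto
  define \<beta> where "\<beta> x = flat_exp 0 (q x)" for x
  have \<beta>C: "Ck k \<beta>" for k unfolding \<beta>_def[abs_def] by (rule Ck_flat_exp[OF qC])
  have \<beta>0: "\<beta> x \<ge> 0" for x by (simp add: \<beta>_def flat_exp_def)
  have \<beta>z: "\<beta> x = 0" if "norm x \<ge> \<epsilon>" for x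
  proof -
    have "\<epsilon>\<^sup>2 \<le> (norm x)\<^sup>2" using that assms by (intro power_mono) auto
    then show ?thesis by (simp add: \<beta>_def flat_exp_def q)
  qed
  have \<beta>p: "\<beta> 0 > 0" using assms by (simp add: \<beta>_def flat_exp_def q)
  obtain b where b: "cball 0 \<epsilon> \<subseteq> box (-b) (b :: real^'n)"
    using bounded_subset_box_symmetric[OF bounded_cball] by blast
  then have bc: "cball 0 \<epsilon> \<subseteq> cbox (-b) b" using box_subset_cbox by blast
  define c where "c = integral (cbox (-b) b) \<beta>"
  have i: "\<beta> integrable_on cbox (-b) b"
    by (intro integrable_continuous Ck_continuous[OF \<beta>C])
  have "c \<ge> 0" unfolding c_def using \<beta>0 by (simp add: integral_nonneg i)
  moreover have "c \<noteq> 0"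
  proof
    assume "c = 0"
    then have "(\<beta> has_integral 0) (cbox (-b) b)" using i by (metis c_def integrable_integral)
    moreover have "0 \<in> box (-b) b" using b assms by auto
    ultimately have "\<beta> 0 = 0"
      using has_integral_0_cbox_imp_0[of "-b" b \<beta> 0] Ck_continuous[OF \<beta>C] \<beta>0 box_subset_cbox by blast
    then show False using \<beta>p by simp
  qed
  ultimately have c: "c > 0" by simp
  show ?thesis
  proof (rule that[of "\<lambda>x. inverse c * \<beta> x" b])
    show "Ck k (\<lambda>x. inverse c * \<beta> x)" for k by (intro Ck_mult Ck_const \<beta>C)
    show "integral (cbox (-b) b) (\<lambda>x. inverse c * \<beta> x) = 1"
      using c by (simp add: c_def[symmetric])
  qed (use \<beta>0 \<beta>z c bc in auto)
qed

lemma GDERIV_zero_outside: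
  assumes "\<And>x. GDERIV f x :> g x" "\<And>x. x \<notin> S \<Longrightarrow> f x = 0" "closed S" "x \<notin> S"
  shows "g x = 0"
proof -
  have "(f has_derivative (\<lambda>h. 0)) (at x)"
    by (rule has_derivative_transform_within_open[where f = "\<lambda>_. 0" and s = "- S"])
      (use assms in auto)
  then have "(\<lambda>h. h \<bullet> g x) = (\<lambda>h. 0)"
    using assms(1)[of x] has_derivative_unique unfolding gderiv_def by blast
  then show ?thesis by (metis inner_eq_zero_iff)
qed

text \<open>The approximant is the convolution of \<psi> with a mollifier of radius \<epsilon>. A
  radius below \<open>r\<close> keeps the support inside \<Omega>; one below \<open>d\<close> makes
  the averaged gradient differ from \<open>G\<close> by at most \<eta>, because the kernel has
  integral 1.\<close>

lemma C1_approx_by_test_function: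
  fixes \<psi> :: "real^'n \<Rightarrow> real"
  assumes \<psi>: "\<And>x. GDERIV \<psi> x :> G x" and G: "continuous_on UNIV G"
    and S: "compact S" "S \<subseteq> \<Omega>" "open \<Omega>" and supp: "\<And>x. x \<notin> S \<Longrightarrow> \<psi> x = 0" and "\<eta> > 0"
  obtains \<psi>' where "\<psi>' \<in> test_functions \<Omega>" "\<And>x. norm (grad \<psi>' x - G x) \<le> \<eta>" "continuous_on UNIV (grad \<psi>')"
proof -
  have \<psi>c: "continuous_on UNIV \<psi>"
    using \<psi> unfolding gderiv_def by (meson continuous_at_imp_continuous_on has_derivative_continuous)
  have Gz: "G x = 0" if "x \<notin> S" for x
    using GDERIV_zero_outside[OF \<psi> supp _ that] S compact_imp_closed by blast
  obtain r where r: "r > 0" "(\<Union>x\<in>S. cball x r) \<subseteq> \<Omega>"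
    using compact_subset_open_imp_cball_epsilon_subset[OF S(1,3,2)] by blast
  \<comment> \<open>\<open>G\<close> vanishes off \<open>S\<close>, so only pairs with one point in
    \<open>S\<close> matter, and since \<epsilon> is at most 1 both of their points lie in this
    compact neighbourhood.\<close>
  define S1 where "S1 = (\<Union>x\<in>S. cball x 1)"
  have "uniformly_continuous_on S1 G"
    unfolding S1_def by (intro compact_uniformly_continuous continuous_on_subset[OF G] compact_minkowski_sum_cball S) auto
  then obtain d where d: "d > 0" "\<And>x y. x \<in> S1 \<Longrightarrow> y \<in> S1 \<Longrightarrow> dist y x < d \<Longrightarrow> dist (G y) (G x) < \<eta>"
    using \<open>\<eta> > 0\<close> unfolding uniformly_continuous_on_def by metis
  define \<epsilon> where "\<epsilon> = min (min r 1) d"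
  have \<epsilon>: "\<epsilon> > 0" "\<epsilon> \<le> r" "\<epsilon> \<le> 1" "\<epsilon> \<le> d" using r d by (auto simp: \<epsilon>_def)
  have close: "norm (G (x - z) - G x) \<le> \<eta>" if "norm z < \<epsilon>" for x z
  proof (cases "x \<in> S \<or> x - z \<in> S")
    case True
    then have "x \<in> S1 \<and> x - z \<in> S1"
    proof
      assume "x \<in> S"
      then show ?thesis unfolding S1_def using that \<epsilon> by (auto intro!: bexI[of _ x] simp: dist_norm)
    next
      assume "x - z \<in> S"
      then show ?thesis unfolding S1_def using that \<epsilon>
        by (auto intro!: bexI[of _ "x - z"] simp: dist_norm norm_minus_commute)
    qed
    then show ?thesis using d(2)[of x "x - z"] that \<epsilon> by (simp add: dist_norm)
  next
    case False
    then show ?thesis using Gz \<open>\<eta> > 0\<close> by simp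
  qed
  obtain \<rho> :: "real^'n \<Rightarrow> real" and b where \<rho>: "\<And>k. Ck k \<rho>" "\<And>x. \<rho> x \<ge> 0" "\<And>x. norm x \<ge> \<epsilon> \<Longrightarrow> \<rho> x = 0"
    "cball 0 \<epsilon> \<subseteq> cbox (-b) b" "integral (cbox (-b) b) \<rho> = 1"
    using mollifier[OF \<epsilon>(1), where 'n='n] by metis
  have \<rho>c: "continuous_on A \<rho>" for A by (rule Ck_continuous[OF \<rho>(1)])
  obtain a where a: "S \<subseteq> cbox (-a) a"
    using bounded_subset_cbox_symmetric[OF compact_imp_bounded[OF S(1)]] by blast
  define \<psi>' where "\<psi>' x = integral (cbox (-a) a) (\<lambda>y. \<psi> y * \<rho> (x - y))" for x
  have alt: "\<psi>' x = integral (cbox (-b) b) (\<lambda>z. \<psi> (x - z) * \<rho> z)" for x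
    unfolding \<psi>'_def
  proof (rule convolution_swap[OF \<psi>c _ \<rho>c])
    show "\<psi> x = 0" if "x \<notin> cbox (- a) a" for x using that a supp by auto
    show "\<rho> x = 0" if "x \<notin> cbox (- b) b" for x using that \<rho>(4) by (intro \<rho>(3)) force
  qed
  let ?g = "\<lambda>x z. \<rho> z *\<^sub>R G (x - z)"
  have gc: "continuous_on UNIV (\<lambda>(x, z). ?g x z)"
    unfolding split_beta
    by (intro continuous_intros continuous_on_compose2[OF \<rho>c] continuous_on_compose2[OF G]) auto
  have "GDERIV (\<lambda>x. \<psi> (x - z) * \<rho> z) x :> ?g x z" for x z
  proof -
    have "GDERIV (\<lambda>x. \<psi> (x - z)) x :> G (x - z)"
      using GDERIV_shift[of \<psi> x "- z"] \<psi>[of "x - z"] by simp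
    then show ?thesis unfolding gderiv_def by (auto intro!: derivative_eq_intros)
  qed
  note gi = GDERIV_integral[OF this _ gc, where a = "-b" and b = b]
  have \<psi>'g: "GDERIV \<psi>' x :> integral (cbox (-b) b) (?g x)" for x
    unfolding alt[abs_def] by (rule gi) (intro continuous_intros continuous_on_compose2[OF \<psi>c] \<rho>c, auto)
  show ?thesis
  proof (rule that)
    have "x \<in> (\<Union>y\<in>S. cball y \<epsilon>)" if "\<psi>' x \<noteq> 0" for x
    proof -
      have "\<exists>z. \<psi> (x - z) * \<rho> z \<noteq> 0"
      proof (rule ccontr)
        assume "\<not> ?thesis"
        then have "(\<lambda>z. \<psi> (x - z) * \<rho> z) = (\<lambda>z. 0)" by auto
        then show False using that by (simp add: alt)
      qed
      then obtain z where "\<psi> (x - z) \<noteq> 0" "\<rho> z \<noteq> 0" by auto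
      then have "x - z \<in> S" "norm z < \<epsilon>" using supp \<rho>(3) by (auto simp: not_le[symmetric])
      then show ?thesis by (auto intro!: bexI[of _ "x - z"] simp: dist_norm norm_minus_commute)
    qed
    moreover have "closed (\<Union>y\<in>S. cball y \<epsilon>)" "compact (\<Union>y\<in>S. cball y \<epsilon>)"
      using compact_minkowski_sum_cball[OF S(1)] compact_imp_closed by auto
    ultimately have cl: "closure {x. \<psi>' x \<noteq> 0} \<subseteq> (\<Union>y\<in>S. cball y \<epsilon>)"
      by (intro closure_minimal) auto
    have sub: "(\<Union>y\<in>S. cball y \<epsilon>) \<subseteq> \<Omega>" using r(2) \<epsilon>(2) by force
    have "compact (closure {x. \<psi>' x \<noteq> 0})"
      using compact_Int_closed[OF \<open>compact (\<Union>y\<in>S. cball y \<epsilon>)\<close> closed_closure] cl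
      by (metis Int_absorb1)
    then show "\<psi>' \<in> test_functions \<Omega>"
      using cl sub Ck_convolution[OF \<psi>c \<rho>(1), of _ "-a" a]
      unfolding test_functions_def compact_support_in_def \<psi>'_def[abs_def, symmetric] by auto
    have ge: "grad \<psi>' = (\<lambda>x. integral (cbox (-b) b) (?g x))"
      using grad_GDERIV[OF \<psi>'g] by auto
    show "continuous_on UNIV (grad \<psi>')"
      unfolding ge by (rule gi) (intro continuous_intros continuous_on_compose2[OF \<psi>c] \<rho>c, auto)
    show "norm (grad \<psi>' x - G x) \<le> \<eta>" for x
    proof -
      have i1: "?g x integrable_on cbox (-b) b"
        by (intro integrable_continuous continuous_intros \<rho>c continuous_on_compose2[OF G]) auto
      have i2: "(\<lambda>z. \<rho> z *\<^sub>R G x) integrable_on cbox (-b) b"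
        by (intro integrable_continuous continuous_intros \<rho>c)
      have "((\<lambda>z. \<rho> z *\<^sub>R G x) has_integral (1 *\<^sub>R G x)) (cbox (-b) b)"
        using \<rho>(5) by (intro has_integral_scaleR_left)
          (metis integrable_integral integrable_continuous \<rho>c)
      then have "grad \<psi>' x - G x = integral (cbox (-b) b) (\<lambda>z. ?g x z - \<rho> z *\<^sub>R G x)"
        unfolding ge using i1 i2 by (simp add: Henstock_Kurzweil_Integration.integral_diff integral_unique)
      also have "norm \<dots> \<le> integral (cbox (-b) b) (\<lambda>z. \<eta> * \<rho> z)"
      proof (rule Henstock_Kurzweil_Integration.integral_norm_bound_integral)
        show "(\<lambda>z. ?g x z - \<rho> z *\<^sub>R G x) integrable_on cbox (-b) b"
          using i1 i2 by (rule integrable_diff)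
        show "(\<lambda>z. \<eta> * \<rho> z) integrable_on cbox (-b) b"
          by (intro integrable_continuous continuous_intros \<rho>c)
        show "norm (?g x z - \<rho> z *\<^sub>R G x) \<le> \<eta> * \<rho> z" for z
        proof (cases "norm z < \<epsilon>")
          case True
          have "norm (?g x z - \<rho> z *\<^sub>R G x) = \<rho> z * norm (G (x - z) - G x)"
            using \<rho>(2)[of z] by (simp add: scaleR_diff_right[symmetric])
          also have "\<dots> \<le> \<rho> z * \<eta>" using close[OF True] \<rho>(2) by (intro mult_left_mono)
          finally show ?thesis by (simp add: mult.commute)
        qed (use \<rho>(3)[of z] in auto)
      qed
      also have "\<dots> = \<eta>" using \<rho>(5) by simp
      finally show ?thesis .
    qed
  qed
qed

section \<open>Smooth graphs inside a convex domain\<close>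

text \<open>A quadratic spline from 0 to 1: it is 2 s^2 on [0, 1/2] and 1 - 2 (1 - s)^2 on [1/2, 1].
  It is C1 with slope at most 2, and this slope bound enters the later constants as the factor
  4.\<close>

definition step :: "real \<Rightarrow> real" where
  "step s = 2 * (max 0 s)\<^sup>2 - 4 * (max 0 (s - 1/2))\<^sup>2 + 2 * (max 0 (s - 1))\<^sup>2"

definition step' :: "real \<Rightarrow> real" where
  "step' s = 4 * max 0 s - 8 * max 0 (s - 1/2) + 4 * max 0 (s - 1)"

lemma DERIV_max_square: "((\<lambda>s. (max 0 (s - a))\<^sup>2) has_real_derivative 2 * max 0 (s - a)) (at s)" for a s :: real
proof (cases "s = a")
  case True
  have "((\<lambda>h. (max 0 (s + h - a))\<^sup>2 / h) \<longlongrightarrow> 0) (at 0)"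
  proof (rule Lim_null_comparison)
    have "\<bar>(max 0 h)\<^sup>2 / h\<bar> \<le> \<bar>h\<bar>" for h :: real
      by (cases "h \<ge> 0") (auto simp: power2_eq_square)
    then show "\<forall>\<^sub>F h in at 0. norm ((max 0 (s + h - a))\<^sup>2 / h) \<le> \<bar>h\<bar>"
      using True by simp
    show "((\<lambda>h::real. \<bar>h\<bar>) \<longlongrightarrow> 0) (at 0)" by (auto intro: tendsto_eq_intros)
  qed
  then show ?thesis using True by (simp add: DERIV_def)
next
  case False
  show ?thesis
  proof (cases "s < a")
    case True
    have "((\<lambda>s. 0) has_real_derivative 2 * max 0 (s - a)) (at s)" using True by simp
    then show ?thesis
      by (rule has_field_derivative_transform_within_open[where S = "{..<a}"]) (use True in auto)
  next
    case f: False
    have "((\<lambda>s. (s - a)\<^sup>2) has_real_derivative 2 * max 0 (s - a)) (at s)"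
      using f by (auto intro!: derivative_eq_intros)
    then show ?thesis
      by (rule has_field_derivative_transform_within_open[where S = "{a<..}"]) (use f False in auto)
  qed
qed

lemma DERIV_step: "(step has_real_derivative step' s) (at s)"
proof -
  note D = DERIV_max_square[of 0, simplified] DERIV_max_square[of "1/2"] DERIV_max_square[of 1]
  have "((\<lambda>s. 2 * (max 0 s)\<^sup>2 - 4 * (max 0 (s - 1/2))\<^sup>2 + 2 * (max 0 (s - 1))\<^sup>2) has_real_derivative
      2 * (2 * max 0 s) - 4 * (2 * max 0 (s - 1/2)) + 2 * (2 * max 0 (s - 1))) (at s)"
    by (intro DERIV_add DERIV_diff DERIV_cmult D)
  then show ?thesis by (simp add: step_def[abs_def] step'_def)
qed

lemma continuous_step': "continuous_on S step'"
  unfolding step'_def by (intro continuous_intros)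

lemma continuous_step: "continuous_on S step"
  unfolding step_def by (intro continuous_intros)

lemma step_le_0: "s \<le> 0 \<Longrightarrow> step s = 0"
  by (simp add: step_def)

lemma step_ge_1: "s \<ge> 1 \<Longrightarrow> step s = 1"
  by (simp add: step_def power2_eq_square algebra_simps)

lemma step'_outside: "s \<le> 0 \<or> s \<ge> 1 \<Longrightarrow> step' s = 0"
  by (auto simp: step'_def)

lemma step'_bounds: "0 \<le> step' s" "step' s \<le> 2"
  by (auto simp: step'_def max_def)

lemma step_bounds: "0 \<le> step s" "step s \<le> 1"
proof -
  have mono: "step a \<le> step b" if "a \<le> b" for a b
    by (rule DERIV_nonneg_imp_nondecreasing[OF that]) (use DERIV_step step'_bounds in blast)
  show "0 \<le> step s" using mono[of "min s 0" s] by (simp add: step_le_0)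
  show "step s \<le> 1" using mono[of s "max s 1"] by (simp add: step_ge_1)
qed

text \<open>A pair \<open>(a, b)\<close> stands for the affine function \<open>x \<mapsto> a + b \<bullet> x\<close>. The graphs bounding the domain have
  to be differentiable, so the minimum of finitely many such functions is replaced by this smooth
  concave function below it.\<close>

definition softmin :: "real \<Rightarrow> (real \<times> 'a::real_inner) set \<Rightarrow> 'a \<Rightarrow> real" where
  "softmin N S x = - ln (\<Sum>s\<in>S. exp (- N * (fst s + snd s \<bullet> x))) / N"

text \<open>A convex combination of the slopes with Gibbs weights. In particular it is orthogonal to
  every vector to which all slopes are orthogonal.\<close>

definition softmin_grad :: "real \<Rightarrow> (real \<times> 'a::real_inner) set \<Rightarrow> 'a \<Rightarrow> 'a" where
  "softmin_grad N S x = (\<Sum>s\<in>S. (exp (- N * (fst s + snd s \<bullet> x))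
     / (\<Sum>s\<in>S. exp (- N * (fst s + snd s \<bullet> x)))) *\<^sub>R snd s)"

context
  fixes N :: real and S :: "(real \<times> 'a::real_inner) set"
  assumes N: "N > 0" and S: "finite S" "S \<noteq> {}"
begin

lemma softmin_weight_pos: "(\<Sum>s\<in>S. exp (- N * (fst s + snd s \<bullet> x))) > 0"
  using S by (intro sum_pos) auto

lemma GDERIV_softmin: "GDERIV (softmin N S) x :> softmin_grad N S x"
proof -
  define Z where "Z x = (\<Sum>s\<in>S. exp (- N * (fst s + snd s \<bullet> x)))" for x
  have Z: "Z x > 0" using softmin_weight_pos by (simp add: Z_def)
  have "(Z has_derivative (\<lambda>h. \<Sum>s\<in>S. exp (- N * (fst s + snd s \<bullet> x)) * (- N * (snd s \<bullet> h)))) (at x)"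
    unfolding Z_def by (auto intro!: derivative_eq_intros simp: ac_simps)
  from has_derivative_ln[OF Z this]
  have D: "((\<lambda>x. (- 1 / N) * ln (Z x)) has_derivative (\<lambda>h. (- 1 / N) *
      ((\<Sum>s\<in>S. exp (- N * (fst s + snd s \<bullet> x)) * (- N * (snd s \<bullet> h))) * inverse (Z x)))) (at x)"
    by (rule has_derivative_mult_right)
  have "(- 1 / N) * ((\<Sum>s\<in>S. exp (- N * (fst s + snd s \<bullet> x)) * (- N * (snd s \<bullet> h))) * inverse (Z x))
      = h \<bullet> softmin_grad N S x" for h
    unfolding softmin_grad_def Z_def[symmetric] inner_sum_right sum_distrib_left sum_distrib_right
    using N Z by (intro sum.cong refl) (simp add: inner_commute field_simps)
  with D have "((\<lambda>x. - ln (Z x) / N) has_derivative (\<lambda>h. h \<bullet> softmin_grad N S x)) (at x)"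
    by simp
  then show ?thesis unfolding gderiv_def softmin_def Z_def .
qed

lemma continuous_softmin_grad: "continuous_on A (softmin_grad N S)"
  unfolding softmin_grad_def
  using softmin_weight_pos by (intro continuous_intros) (auto simp: less_imp_neq[THEN not_sym])

lemma softmin_le: "s \<in> S \<Longrightarrow> softmin N S x \<le> fst s + snd s \<bullet> x"
proof -
  assume s: "s \<in> S"
  have "exp (- N * (fst s + snd s \<bullet> x)) \<le> (\<Sum>s\<in>S. exp (- N * (fst s + snd s \<bullet> x)))"
    using s S by (intro member_le_sum) auto
  then have "- N * (fst s + snd s \<bullet> x) \<le> ln (\<Sum>s\<in>S. exp (- N * (fst s + snd s \<bullet> x)))"
    using softmin_weight_pos[of x] by (simp add: ln_ge_iff)
  then show ?thesis using N by (simp add: softmin_def field_simps)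
qed

text \<open>The sum has \<open>card S\<close> terms, each at most exp(- N c); this is the whole loss
  of the smoothing, and it tends to 0 for large \<open>N\<close>.\<close>

lemma softmin_ge:
  assumes "\<And>s. s \<in> S \<Longrightarrow> c \<le> fst s + snd s \<bullet> x"
  shows "c - ln (card S) / N \<le> softmin N S x"
proof -
  have "(\<Sum>s\<in>S. exp (- N * (fst s + snd s \<bullet> x))) \<le> (\<Sum>s\<in>S. exp (- N * c))"
    using assms N by (intro sum_mono) auto
  also have "\<dots> = exp (ln (card S) - N * c)"
    using S by (simp add: exp_diff exp_minus divide_inverse card_gt_0_iff)
  finally have "ln (\<Sum>s\<in>S. exp (- N * (fst s + snd s \<bullet> x))) \<le> ln (card S) - N * c"
    using softmin_weight_pos[of x] by (metis ln_le_cancel_iff exp_gt_zero ln_exp)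
  then have "(N * c - ln (card S)) / N \<le> - ln (\<Sum>s\<in>S. exp (- N * (fst s + snd s \<bullet> x))) / N"
    using N by (intro divide_right_mono) auto
  then show ?thesis using N by (simp add: softmin_def diff_divide_distrib)
qed

text \<open>This is Jensen's inequality for the exponential under the Gibbs weights at
  \<open>x\<close>. The number \<open>g\<close> is the mean of the directional slopes, so in the
  tangent line taken at - N g the linear terms cancel in the weighted sum.\<close>

lemma softmin_concave: "softmin N S y \<le> softmin N S x + softmin_grad N S x \<bullet> (y - x)"
proof -
  define e where "e s z = exp (- N * (fst s + snd s \<bullet> z))" for s and z :: 'a
  define Z where "Z z = (\<Sum>s\<in>S. e s z)" for z
  have Z: "Z z > 0" for z using softmin_weight_pos by (simp add: Z_def e_def)
  define g where "g = softmin_grad N S x \<bullet> (y - x)"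
  have g: "g * Z x = (\<Sum>s\<in>S. e s x * (snd s \<bullet> (y - x)))"
    using Z[of x] unfolding g_def softmin_grad_def e_def[symmetric] Z_def[symmetric]
    by (simp add: inner_sum_left sum_distrib_right)
  have "exp (- N * g) * Z x = (\<Sum>s\<in>S. exp (- N * g) * e s x)"
    by (simp add: Z_def sum_distrib_left)
  also have "\<dots> = (\<Sum>s\<in>S. exp (- N * g) * e s x * (1 - N * (snd s \<bullet> (y - x) - g)))"
  proof -
    have "(\<Sum>s\<in>S. exp (- N * g) * e s x * (1 - N * (snd s \<bullet> (y - x) - g)))
        = (\<Sum>s\<in>S. exp (- N * g) * e s x) - N * exp (- N * g) * ((\<Sum>s\<in>S. e s x * (snd s \<bullet> (y - x))) - g * Z x)"
      by (simp add: Z_def algebra_simps sum_subtractf sum.distrib sum_distrib_left)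
    then show ?thesis using g by simp
  qed
  also have "\<dots> \<le> (\<Sum>s\<in>S. exp (- N * g) * e s x * exp (- N * (snd s \<bullet> (y - x) - g)))"
  proof (intro sum_mono mult_left_mono)
    show "1 - N * (snd s \<bullet> (y - x) - g) \<le> exp (- N * (snd s \<bullet> (y - x) - g))" for s :: "real \<times> 'a"
      using exp_ge_add_one_self[of "- N * (snd s \<bullet> (y - x) - g)"] by simp
  qed (auto simp: e_def)
  also have "\<dots> = Z y"
    unfolding Z_def e_def
    by (intro sum.cong refl) (simp add: exp_add[symmetric] algebra_simps)
  finally have "ln (exp (- N * g) * Z x) \<le> ln (Z y)" using Z by simp
  then have "- N * g + ln (Z x) \<le> ln (Z y)" using Z[of x] by (simp add: ln_mult)
  then have "(- ln (Z y)) / N \<le> (N * g - ln (Z x)) / N" using N by (intro divide_right_mono) auto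
  then show ?thesis
    using N unfolding softmin_def g_def[symmetric] e_def[symmetric] Z_def[symmetric]
    by (simp add: field_simps)
qed

end

lemma concave_graph_above:
  fixes v :: "'a::euclidean_space"
  assumes S: "finite S" "S \<noteq> {}" and K: "compact K"
    and above: "\<And>s x. s \<in> S \<Longrightarrow> x \<in> K \<Longrightarrow> v \<bullet> x < fst s + snd s \<bullet> x"
    and orth: "\<And>s. s \<in> S \<Longrightarrow> snd s \<bullet> v = 0"
  obtains T DT where "\<And>x. GDERIV T x :> DT x" "\<And>A. continuous_on A DT"
    "\<And>x y. T y \<le> T x + DT x \<bullet> (y - x)" "\<And>x. DT x \<bullet> v = 0"
    "\<And>s x. s \<in> S \<Longrightarrow> T x \<le> fst s + snd s \<bullet> x" "\<And>x. x \<in> K \<Longrightarrow> v \<bullet> x < T x"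
proof -
  have "\<exists>e>0. \<forall>x\<in>K. v \<bullet> x + e \<le> fst s + snd s \<bullet> x" if "s \<in> S" for s
  proof (cases "K = {}")
    case False
    have "continuous_on K (\<lambda>x. fst s + snd s \<bullet> x - v \<bullet> x)" by (intro continuous_intros)
    from continuous_attains_inf[OF K False this]
    obtain z where z: "z \<in> K" "\<And>x. x \<in> K \<Longrightarrow> fst s + snd s \<bullet> z - v \<bullet> z \<le> fst s + snd s \<bullet> x - v \<bullet> x" by auto
    show ?thesis
      by (rule exI[of _ "fst s + snd s \<bullet> z - v \<bullet> z"]) (use z above[OF that z(1)] in force)
  qed (auto intro: exI[of _ 1])
  then obtain e where e: "\<And>s. s \<in> S \<Longrightarrow> e s > 0"
      "\<And>s x. s \<in> S \<Longrightarrow> x \<in> K \<Longrightarrow> v \<bullet> x + e s \<le> fst s + snd s \<bullet> x" by metis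
  define \<epsilon> where "\<epsilon> = Min (e ` S)"
  have \<epsilon>: "\<epsilon> > 0" "\<And>s. s \<in> S \<Longrightarrow> \<epsilon> \<le> e s" using S e by (auto simp: \<epsilon>_def)
  \<comment> \<open>With this choice the smoothing loss stays strictly below the common gap
    \<epsilon>; the summand 1 keeps \<open>N\<close> positive when \<open>S\<close> is a
    singleton.\<close>
  define N where "N = (ln (card S) + 1) / \<epsilon>"
  have c: "ln (card S) \<ge> 0" using S by (simp add: Suc_leI card_gt_0_iff)
  then have N: "N > 0" using \<epsilon> by (simp add: N_def)
  show ?thesis
  proof (rule that[of "softmin N S" "softmin_grad N S"])
    fix x assume x: "x \<in> K"
    have "v \<bullet> x + \<epsilon> - ln (card S) / N \<le> softmin N S x"
      using e(2)[OF _ x] \<epsilon>(2) by (intro softmin_ge[OF N S]) force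
    moreover have "ln (card S) / N < \<epsilon>"
      using \<epsilon> c by (simp add: N_def divide_simps)
    ultimately show "v \<bullet> x < softmin N S x" by linarith
  next
    show "softmin_grad N S x \<bullet> v = 0" for x
      using orth by (simp add: softmin_grad_def inner_sum_left)
  qed (use GDERIV_softmin[OF N S] continuous_softmin_grad[OF N S] softmin_concave[OF N S] softmin_le[OF N S] in auto)
qed

section \<open>Enclosing a compact convex set by smooth graphs\<close>

text \<open>Each frontier point is cut off from \<open>K\<close> by a hyperplane that also cuts off
  its neighbours, and the frontier is compact. No hyperplane may be parallel to \<open>v\<close>,
  since each half-space is later solved for the coordinate along \<open>v\<close>.\<close>

lemma finite_separating_halfspaces:
  fixes v :: "'a::euclidean_space"
  assumes K: "compact K" "convex K" "K \<noteq> {}" "K \<subseteq> \<Omega>"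
    and \<Omega>: "open \<Omega>" "bounded \<Omega>" and v: "v \<noteq> 0"
  obtains F where "finite F" "\<And>p x. p \<in> F \<Longrightarrow> x \<in> K \<Longrightarrow> snd p < fst p \<bullet> x"
    "\<And>p. p \<in> F \<Longrightarrow> fst p \<bullet> v \<noteq> 0" "\<And>x. (\<And>p. p \<in> F \<Longrightarrow> snd p \<le> fst p \<bullet> x) \<Longrightarrow> x \<in> \<Omega>"
proof -
  have sep: "\<exists>p. fst p \<bullet> y < snd p \<and> fst p \<bullet> v \<noteq> 0 \<and> (\<forall>x\<in>K. snd p < fst p \<bullet> x)" if "y \<in> frontier \<Omega>" for y
  proof -
    have "y \<notin> K" using that K \<Omega> by (auto simp: frontier_def interior_open)
    then obtain a b where ab: "a \<bullet> y < b" "\<And>x. x \<in> K \<Longrightarrow> b < a \<bullet> x"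
      using separating_hyperplane_closed_point[OF K(2) compact_imp_closed[OF K(1)]] by blast
    have "bounded (insert y K)" using K compact_imp_bounded by auto
    then obtain R where R: "\<And>x. x \<in> insert y K \<Longrightarrow> norm x \<le> R" by (auto simp: bounded_iff)
    have "R \<ge> 0" using R[of y] norm_ge_zero[of y] by (simp del: norm_ge_zero)
    define g where "g = b - a \<bullet> y"
    have g: "g > 0" using ab by (simp add: g_def)
    \<comment> \<open>A tilt by \<open>t\<close> changes inner products with points of
      \<open>insert y K\<close> by at most a quarter of the gap \<open>g\<close>, so separation
      survives at the level b - g/2.\<close>
    define t where "t = g / (4 * (norm v * R + 1))"
    have vR: "norm v * R \<ge> 0" using \<open>R \<ge> 0\<close> by simp
    then have t: "t > 0" using g by (simp add: t_def)
    have small: "\<bar>t * (v \<bullet> x)\<bar> \<le> g / 4" if "x \<in> insert y K" for x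
    proof -
      have "\<bar>v \<bullet> x\<bar> \<le> norm v * norm x" by (rule Cauchy_Schwarz_ineq2)
      also have "\<dots> \<le> norm v * R" using R[OF that] by (intro mult_left_mono) auto
      finally have "t * \<bar>v \<bullet> x\<bar> \<le> t * (norm v * R + 1)" using t by (intro mult_left_mono) auto
      also have "\<dots> = g / 4" using vR by (simp add: t_def field_simps)
      finally show ?thesis using t by (simp add: abs_mult)
    qed
    have ex: "\<exists>a'. (a' = a \<or> a' = a + t *\<^sub>R v) \<and> a' \<bullet> v \<noteq> 0"
      using v t by (cases "a \<bullet> v = 0") (auto simp: inner_add_left)
    then obtain a' where a': "a' = a \<or> a' = a + t *\<^sub>R v" "a' \<bullet> v \<noteq> 0" by blast
    have near: "\<bar>a' \<bullet> x - a \<bullet> x\<bar> \<le> g / 4" if "x \<in> insert y K" for x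
      using a'(1) small[OF that] g by (auto simp: inner_add_left)
    have "a' \<bullet> y < b - g/2"
    proof -
      have "\<bar>a' \<bullet> y - a \<bullet> y\<bar> \<le> g / 4" by (rule near) simp
      moreover have "g = b - a \<bullet> y" by (rule g_def)
      ultimately show ?thesis using g by linarith
    qed
    moreover have "b - g/2 < a' \<bullet> x" if "x \<in> K" for x
    proof -
      have "\<bar>a' \<bullet> x - a \<bullet> x\<bar> \<le> g / 4" using that by (intro near) simp
      then show ?thesis using ab(2)[OF that] g by linarith
    qed
    ultimately show ?thesis using a'(2) by (intro exI[of _ "(a', b - g/2)"]) auto
  qed
  define P where "P = {p. fst p \<bullet> v \<noteq> 0 \<and> (\<forall>x\<in>K. snd p < fst p \<bullet> x)}"
  have cf: "compact (frontier \<Omega>)" using \<Omega> by (intro compact_frontier_bounded) auto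
  have "frontier \<Omega> \<subseteq> (\<Union>p\<in>P. {y. fst p \<bullet> y < snd p})" using sep by (force simp: P_def)
  moreover have "\<And>p. p \<in> P \<Longrightarrow> open {y. fst p \<bullet> y < snd p}" by (rule open_halfspace_lt)
  ultimately obtain F where F: "F \<subseteq> P" "finite F" "frontier \<Omega> \<subseteq> (\<Union>p\<in>F. {y. fst p \<bullet> y < snd p})"
    using compactE_image[OF cf, of P "\<lambda>p. {y. fst p \<bullet> y < snd p}"] by blast
  show ?thesis
  proof (rule that[OF F(2)])
    fix x assume x: "\<And>p. p \<in> F \<Longrightarrow> snd p \<le> fst p \<bullet> x"
    obtain k where k: "k \<in> K" using K by auto
    show "x \<in> \<Omega>"
    proof (rule ccontr)
      \<comment> \<open>The segment from a point of \<open>K\<close> to \<open>x\<close> would meet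
        the frontier, hence leave one of the half-spaces, although both of its ends lie in
        it.\<close>
      assume "x \<notin> \<Omega>"
      then have "closed_segment k x \<inter> frontier \<Omega> \<noteq> {}"
        using k K by (intro connected_Int_frontier) auto
      then obtain z where z: "z \<in> closed_segment k x" "z \<in> frontier \<Omega>" by auto
      then obtain p where p: "p \<in> F" "fst p \<bullet> z < snd p" using F by auto
      have "k \<in> {y. snd p \<le> fst p \<bullet> y}" "x \<in> {y. snd p \<le> fst p \<bullet> y}"
        using x p(1) F(1) k by (force simp: P_def)+
      moreover have "convex {y. snd p \<le> fst p \<bullet> y}"
        by (rule convex_halfspace_ge)
      ultimately have "closed_segment k x \<subseteq> {y. snd p \<le> fst p \<bullet> y}" by (simp add: closed_segment_subset)
      then show False using z p by auto
    qed
  qed (use F in \<open>auto simp: P_def\<close>)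
qed

text \<open>A half-space whose normal has a negative product with \<open>v\<close> bounds the height
  from above by an affine function, one with a positive product bounds it from below. The second
  kind is the first kind for - v, so one construction is applied to \<open>v\<close> and to - v, and
  \<open>B\<close> is the negative of the second graph.\<close>

lemma smooth_slab_between:
  fixes v :: "'a::euclidean_space"
  assumes K: "compact K" "convex K" "K \<noteq> {}" "K \<subseteq> \<Omega>"
    and \<Omega>: "open \<Omega>" "bounded \<Omega>" and v: "v \<bullet> v = 1"
  obtains T DT B DB where "\<And>x. GDERIV T x :> DT x" "\<And>A. continuous_on A DT"
    "\<And>x y. T y \<le> T x + DT x \<bullet> (y - x)" "\<And>x. DT x \<bullet> v = 0"
    "\<And>x. GDERIV B x :> DB x" "\<And>A. continuous_on A DB"
    "\<And>x y. B y \<ge> B x + DB x \<bullet> (y - x)" "\<And>x. DB x \<bullet> v = 0"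
    "\<And>x. x \<in> K \<Longrightarrow> B x < x \<bullet> v \<and> x \<bullet> v < T x"
    "\<And>x. B x \<le> x \<bullet> v \<Longrightarrow> x \<bullet> v \<le> T x \<Longrightarrow> x \<in> \<Omega>"
proof -
  have "v \<noteq> 0" using v by auto
  from finite_separating_halfspaces[OF K \<Omega> this] obtain F where F: "finite F"
    "\<And>p x. p \<in> F \<Longrightarrow> x \<in> K \<Longrightarrow> snd p < fst p \<bullet> x"
    "\<And>p. p \<in> F \<Longrightarrow> fst p \<bullet> v \<noteq> 0" "\<And>x. (\<And>p. p \<in> F \<Longrightarrow> snd p \<le> fst p \<bullet> x) \<Longrightarrow> x \<in> \<Omega>"
    by blast
  obtain R where R: "\<And>x. x \<in> K \<Longrightarrow> norm x \<le> R" using K compact_imp_bounded by (force simp: bounded_iff)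
  \<comment> \<open>The inequality of the half-space \<open>p\<close>, solved for the coordinate
    along \<open>w\<close>; the slope is made orthogonal to \<open>w\<close>.\<close>
  define aff where "aff w p = (- snd p / (- (fst p \<bullet> w)),
      (fst p - (fst p \<bullet> w) *\<^sub>R w) /\<^sub>R (- (fst p \<bullet> w)))" for w and p :: "'a \<times> real"
  \<comment> \<open>The constant function R + 1 lies above \<open>K\<close> and keeps the family
    nonempty when no half-space bounds the height from this side.\<close>
  define S where "S w = insert (R + 1, 0) (aff w ` {p\<in>F. fst p \<bullet> w < 0})" for w
  have aff: "fst (aff w p) + snd (aff w p) \<bullet> x - w \<bullet> x = (fst p \<bullet> x - snd p) / (- (fst p \<bullet> w))"
    if "fst p \<bullet> w < 0" for w p x
    using that by (simp add: aff_def inner_diff_left field_simps)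
  have main: "\<exists>T DT. (\<forall>x. GDERIV T x :> DT x) \<and> (\<forall>A. continuous_on A DT) \<and>
    (\<forall>x y. T y \<le> T x + DT x \<bullet> (y - x)) \<and> (\<forall>x. DT x \<bullet> w = 0) \<and>
    (\<forall>x p. p \<in> F \<longrightarrow> fst p \<bullet> w < 0 \<longrightarrow> w \<bullet> x \<le> T x \<longrightarrow> snd p \<le> fst p \<bullet> x) \<and> (\<forall>x\<in>K. w \<bullet> x < T x)"
    if w: "w \<bullet> w = 1" for w
  proof -
    have "w \<bullet> x < fst s + snd s \<bullet> x" if sS: "s \<in> S w" and xK: "x \<in> K" for s x
    proof (cases "s = (R + 1, 0)")
      case True
      have "\<bar>w \<bullet> x\<bar> \<le> norm w * norm x" by (rule Cauchy_Schwarz_ineq2)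
      also have "\<dots> \<le> R" using R[OF xK] w by (simp add: norm_eq_sqrt_inner)
      finally show ?thesis using True by simp
    next
      case False
      then obtain p where p: "p \<in> F" "fst p \<bullet> w < 0" "s = aff w p"
        using sS unfolding S_def by blast
      have "(fst p \<bullet> x - snd p) / (- (fst p \<bullet> w)) > 0"
        using F(2)[OF p(1) xK] p by (intro divide_pos_pos) auto
      then show ?thesis using aff[OF p(2), of x] p(3) by simp
    qed
    moreover have "snd s \<bullet> w = 0" if "s \<in> S w" for s
      using that w by (auto simp: S_def aff_def inner_diff_left)
    moreover have "finite (S w)" "S w \<noteq> {}" using F(1) by (auto simp: S_def)
    ultimately obtain T DT where T: "\<And>x. GDERIV T x :> DT x" "\<And>A. continuous_on A DT"
      "\<And>x y. T y \<le> T x + DT x \<bullet> (y - x)" "\<And>x. DT x \<bullet> w = 0"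
      "\<And>s x. s \<in> S w \<Longrightarrow> T x \<le> fst s + snd s \<bullet> x" "\<And>x. x \<in> K \<Longrightarrow> w \<bullet> x < T x"
      using concave_graph_above[of "S w" K w] K(1) by blast
    have "snd p \<le> fst p \<bullet> x" if "p \<in> F" "fst p \<bullet> w < 0" "w \<bullet> x \<le> T x" for x p
    proof -
      have "w \<bullet> x \<le> fst (aff w p) + snd (aff w p) \<bullet> x"
        using T(5)[of "aff w p" x] that by (auto simp: S_def)
      then have "(fst p \<bullet> x - snd p) / (- (fst p \<bullet> w)) \<ge> 0" using aff[OF that(2), of x] by simp
      then show ?thesis using that(2) by (auto simp: zero_le_divide_iff divide_le_0_iff)
    qed
    with T show ?thesis by blast
  qed
  from main[OF v] obtain T DT where T: "\<And>x. GDERIV T x :> DT x" "\<And>A. continuous_on A DT"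
    "\<And>x y. T y \<le> T x + DT x \<bullet> (y - x)" "\<And>x. DT x \<bullet> v = 0"
    "\<And>x p. p \<in> F \<Longrightarrow> fst p \<bullet> v < 0 \<Longrightarrow> v \<bullet> x \<le> T x \<Longrightarrow> snd p \<le> fst p \<bullet> x" "\<And>x. x \<in> K \<Longrightarrow> v \<bullet> x < T x"
    by metis
  have "(-v) \<bullet> (-v) = 1" using v by simp
  from main[OF this] obtain C DC where C: "\<And>x. GDERIV C x :> DC x" "\<And>A. continuous_on A DC"
    "\<And>x y. C y \<le> C x + DC x \<bullet> (y - x)" "\<And>x. DC x \<bullet> (-v) = 0"
    "\<And>x p. p \<in> F \<Longrightarrow> fst p \<bullet> (-v) < 0 \<Longrightarrow> (-v) \<bullet> x \<le> C x \<Longrightarrow> snd p \<le> fst p \<bullet> x" "\<And>x. x \<in> K \<Longrightarrow> (-v) \<bullet> x < C x"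
    by metis
  show ?thesis
  proof (rule that[of T DT "\<lambda>x. - C x" "\<lambda>x. - DC x"])
    show "GDERIV (\<lambda>x. - C x) x :> - DC x" for x by (rule GDERIV_minus[OF C(1)])
    show "- C x + - DC x \<bullet> (y - x) \<le> - C y" for x y using C(3)[of y x] by simp
    show "- C x < x \<bullet> v \<and> x \<bullet> v < T x" if "x \<in> K" for x
      using T(6)[OF that] C(6)[OF that] by (simp add: inner_commute)
    show "x \<in> \<Omega>" if "- C x \<le> x \<bullet> v" "x \<bullet> v \<le> T x" for x
    proof (rule F(4))
      fix p assume p: "p \<in> F"
      show "snd p \<le> fst p \<bullet> x"
        using F(3)[OF p] T(5)[OF p] C(5)[OF p] that
        by (cases "fst p \<bullet> v < 0") (auto simp: inner_commute)
    qed
  qed (use T C in \<open>auto intro!: continuous_intros\<close>)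
qed

section \<open>Hardy inequalities with concave weights\<close>

text \<open>As \<open>h\<close> decreases, the derivative of \<open>\<Phi>\<^sup>2 / ((q - x) h)\<close> is at least
  \<open>\<Phi>\<^sup>2 / ((q - x)\<^sup>2 h) + 2 \<Phi> \<Phi>' / ((q - x) h)\<close>; the mixed term is absorbed by completing the square.\<close>

lemma hardy_decreasing_weight:
  fixes \<Phi> \<Phi>' h h' D :: "real \<Rightarrow> real"
  assumes "m \<le> b" "b < q" "C \<ge> 0"
    and \<Phi>: "\<And>x. (\<Phi> has_real_derivative \<Phi>' x) (at x)" "continuous_on UNIV \<Phi>'" "\<Phi> b = 0"
    and h: "\<And>x. (h has_real_derivative h' x) (at x)" "continuous_on UNIV h'"
    and hpos: "\<And>x. x \<in> {m..b} \<Longrightarrow> h x > 0"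
    and hdec: "\<And>x. x \<in> {m..b} \<Longrightarrow> h' x \<le> 0"
    and D: "continuous_on UNIV D" "\<And>x. x \<in> {m..b} \<Longrightarrow> D x * (q - x)\<^sup>2 \<le> C"
  shows "integral {m..b} (\<lambda>x. (\<Phi> x)\<^sup>2 * D x / h x) \<le> 4 * C * integral {m..b} (\<lambda>x. (\<Phi>' x)\<^sup>2 / h x)"
proof -
  have c\<Phi>: "continuous_on S \<Phi>" for S
    using \<Phi>(1) by (meson DERIV_continuous continuous_at_imp_continuous_on)
  have ch: "continuous_on S h" for S
    using h(1) by (meson DERIV_continuous continuous_at_imp_continuous_on)
  have c\<Phi>': "continuous_on S \<Phi>'" and cD: "continuous_on S D" for S
    using \<Phi>(2) D(1) continuous_on_subset by blast+
  define F where "F x = (\<Phi> x)\<^sup>2 / ((q - x) * h x)" for x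
  define F' where "F' x = 2 * \<Phi> x * \<Phi>' x / ((q - x) * h x) + (\<Phi> x)\<^sup>2 / ((q - x)\<^sup>2 * h x)
      - (\<Phi> x)\<^sup>2 * h' x / ((q - x) * (h x)\<^sup>2)" for x
  have dF: "(F has_real_derivative F' x) (at x)" if "x \<in> {m..b}" for x
  proof -
    have "h x > 0" "q - x > 0" using hpos[OF that] that assms by auto
    have alg: "(2 * f * g * (d * k) - f\<^sup>2 * (d * k' - k)) / (d * k)\<^sup>2
        = 2 * f * g / (d * k) + f\<^sup>2 / (d\<^sup>2 * k) - f\<^sup>2 * k' / (d * k\<^sup>2)"
      if "d > 0" "k > 0" for d f g k k' :: real
      using that by (simp add: field_simps power2_eq_square)
    have "(F has_real_derivative (2 * \<Phi> x * \<Phi>' x * ((q - x) * h x)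
        - (\<Phi> x)\<^sup>2 * ((q - x) * h' x - h x)) / ((q - x) * h x)\<^sup>2) (at x)"
      unfolding F_def using \<open>h x > 0\<close> \<open>q - x > 0\<close>
      by (auto intro!: derivative_eq_intros \<Phi>(1) h(1) simp: power2_eq_square algebra_simps)
    then show ?thesis
      unfolding F'_def alg[OF \<open>q - x > 0\<close> \<open>h x > 0\<close>] .
  qed
  have "(F has_vector_derivative F' x) (at x within {m..b})" if "x \<in> {m..b}" for x
    using dF[OF that] by (simp add: has_field_derivative_at_within
        has_real_derivative_iff_has_vector_derivative[symmetric])
  then have F'i: "(F' has_integral (F b - F m)) {m..b}"
    using \<open>m \<le> b\<close> by (intro fundamental_theorem_of_calculus)
  have nz: "\<forall>x\<in>{m..b}. h x \<noteq> 0" using hpos by force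
  have i1: "(\<lambda>x. (\<Phi> x)\<^sup>2 * D x / h x) integrable_on {m..b}"
    using nz by (intro integrable_continuous_real continuous_intros c\<Phi> ch cD) auto
  have i2: "(\<lambda>x. (\<Phi>' x)\<^sup>2 / h x) integrable_on {m..b}"
    using nz by (intro integrable_continuous_real continuous_intros c\<Phi>' ch) auto
  have "integral {m..b} (\<lambda>x. (\<Phi> x)\<^sup>2 * D x / h x)
      \<le> integral {m..b} (\<lambda>x. 2 * C * F' x + 4 * C * ((\<Phi>' x)\<^sup>2 / h x))"
  proof (rule integral_le[OF i1])
    show "(\<lambda>x. 2 * C * F' x + 4 * C * ((\<Phi>' x)\<^sup>2 / h x)) integrable_on {m..b}"
      using F'i i2 by (intro integrable_add integrable_on_mult_right) auto
    fix x assume x: "x \<in> {m..b}"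
    have hx: "h x > 0" and d: "q - x > 0" and h'x: "h' x \<le> 0"
      using hpos[OF x] hdec[OF x] x assms by auto
    define u where "u = \<Phi> x / (q - x)"
    have e: "F' x = (2 * u * \<Phi>' x + u\<^sup>2) / h x - (\<Phi> x)\<^sup>2 * h' x / ((q - x) * (h x)\<^sup>2)"
      unfolding F'_def u_def by (simp add: add_divide_distrib power_divide mult.commute)
    have "(\<Phi> x)\<^sup>2 * h' x / ((q - x) * (h x)\<^sup>2) \<le> 0"
      using hx d h'x by (intro divide_nonpos_nonneg mult_nonneg_nonpos) auto
    moreover have "u\<^sup>2 \<le> 2 * (2 * u * \<Phi>' x + u\<^sup>2) + 4 * (\<Phi>' x)\<^sup>2"
      using zero_le_power2[of "u + 2 * \<Phi>' x"] by (simp add: power2_eq_square algebra_simps)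
    then have "u\<^sup>2 / h x \<le> (2 * (2 * u * \<Phi>' x + u\<^sup>2) + 4 * (\<Phi>' x)\<^sup>2) / h x"
      using hx by (intro divide_right_mono) auto
    then have "u\<^sup>2 / h x \<le> 2 * ((2 * u * \<Phi>' x + u\<^sup>2) / h x) + 4 * ((\<Phi>' x)\<^sup>2 / h x)"
      by (simp add: add_divide_distrib)
    ultimately have "u\<^sup>2 / h x \<le> 2 * F' x + 4 * ((\<Phi>' x)\<^sup>2 / h x)"
      unfolding e by argo
    then have A: "C * (u\<^sup>2 / h x) \<le> C * (2 * F' x + 4 * ((\<Phi>' x)\<^sup>2 / h x))"
      using \<open>C \<ge> 0\<close> by (rule mult_left_mono)
    have "(\<Phi> x)\<^sup>2 * D x / h x = (D x * (q - x)\<^sup>2) * (u\<^sup>2 / h x)"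
      using d by (simp add: u_def power_divide)
    also have "\<dots> \<le> C * (u\<^sup>2 / h x)"
      using D(2)[OF x] hx by (intro mult_right_mono) auto
    finally show "(\<Phi> x)\<^sup>2 * D x / h x \<le> 2 * C * F' x + 4 * C * ((\<Phi>' x)\<^sup>2 / h x)"
      using A by (simp add: algebra_simps)
  qed
  also have "\<dots> = 2 * C * (F b - F m) + 4 * C * integral {m..b} (\<lambda>x. (\<Phi>' x)\<^sup>2 / h x)"
    by (intro integral_unique has_integral_add has_integral_mult_right F'i integrable_integral[OF i2])
  \<comment> \<open>\<open>F\<close> vanishes at \<open>b\<close> and is nonnegative at
    \<open>m\<close>. The boundary term thus has the good sign whatever value \<Phi> takes at
    \<open>m\<close>, which allows the splitting at an interior point below.\<close>
  also have "F b - F m \<le> 0"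
    using hpos[of m] assms(1,2) by (simp add: F_def \<Phi>(3))
  then have "2 * C * (F b - F m) \<le> 0" using \<open>C \<ge> 0\<close> by (simp add: mult_nonneg_nonpos)
  finally show ?thesis by linarith
qed

text \<open>The interval is split where \<open>h\<close> is largest: to the right \<open>h\<close>
  decreases and distances are measured to \<open>q\<close>; the left part is its mirror image, with
  distances to \<open>p\<close>.\<close>

lemma hardy_concave_weight:
  fixes \<Phi> \<Phi>' h h' D :: "real \<Rightarrow> real"
  assumes pq: "p < a" "a \<le> b" "b < q" "C \<ge> 0"
    and \<Phi>: "\<And>x. (\<Phi> has_real_derivative \<Phi>' x) (at x)" "continuous_on UNIV \<Phi>'" "\<Phi> a = 0" "\<Phi> b = 0"
    and h: "\<And>x. (h has_real_derivative h' x) (at x)" "continuous_on UNIV h'"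
    and hpos: "\<And>x. x \<in> {a..b} \<Longrightarrow> h x > 0"
    and conc: "\<And>x y. h y \<le> h x + h' x * (y - x)"
    and D: "continuous_on UNIV D"
    and Dr: "\<And>x. x \<in> {a..b} \<Longrightarrow> h' x \<le> 0 \<Longrightarrow> D x * (q - x)\<^sup>2 \<le> C"
    and Dl: "\<And>x. x \<in> {a..b} \<Longrightarrow> h' x \<ge> 0 \<Longrightarrow> D x * (x - p)\<^sup>2 \<le> C"
  shows "integral {a..b} (\<lambda>x. (\<Phi> x)\<^sup>2 * D x / h x) \<le> 4 * C * integral {a..b} (\<lambda>x. (\<Phi>' x)\<^sup>2 / h x)"
proof -
  have c\<Phi>: "continuous_on S \<Phi>" for S
    using \<Phi>(1) by (meson DERIV_continuous continuous_at_imp_continuous_on)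
  have ch: "continuous_on S h" for S
    using h(1) by (meson DERIV_continuous continuous_at_imp_continuous_on)
  have c\<Phi>': "continuous_on S \<Phi>'" and cD: "continuous_on S D" for S
    using \<Phi>(2) D(1) continuous_on_subset by blast+
  obtain m where m: "m \<in> {a..b}" and mmax: "\<And>x. x \<in> {a..b} \<Longrightarrow> h x \<le> h m"
    using continuous_attains_sup[of "{a..b}" h] ch pq by auto
  \<comment> \<open>The maximum may sit at an end of the interval, so at \<open>m\<close> itself the
    derivative is known only to be nonpositive when there is room to the right, and nonnegative when
    there is room to the left.\<close>
  have right: "h' x \<le> 0" if "x \<in> {m..b}" "m < b" for x
  proof (cases "x = m")
    case False
    have "h' x * (x - m) \<le> 0" using conc[of m x] mmax[of x] m that by (auto simp: algebra_simps)
    then show ?thesis using False that by (auto simp: mult_le_0_iff)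
  next
    case True
    show ?thesis
    proof (rule ccontr)
      assume "\<not> h' x \<le> 0"
      then obtain e where e: "e > 0" "\<And>k. 0 < k \<Longrightarrow> k < e \<Longrightarrow> h x < h (x + k)"
        using DERIV_pos_inc_right[OF h(1)[of x]] by auto
      define k where "k = min (e/2) (b - m)"
      have "k > 0" "k < e" "m + k \<in> {a..b}" using e that m by (auto simp: k_def)
      then show False using e(2)[of k] mmax[of "m+k"] True by auto
    qed
  qed
  have left: "h' x \<ge> 0" if "x \<in> {a..m}" "a < m" for x
  proof (cases "x = m")
    case False
    have "h' x * (x - m) \<le> 0" using conc[of m x] mmax[of x] m that by (auto simp: algebra_simps)
    then show ?thesis using False that by (auto simp: mult_le_0_iff)
  next
    case True
    show ?thesis
    proof (rule ccontr)
      assume "\<not> h' x \<ge> 0"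
      then obtain e where e: "e > 0" "\<And>k. 0 < k \<Longrightarrow> k < e \<Longrightarrow> h x < h (x - k)"
        using DERIV_neg_dec_left[OF h(1)[of x]] by auto
      define k where "k = min (e/2) (m - a)"
      have "k > 0" "k < e" "m - k \<in> {a..b}" using e that m by (auto simp: k_def)
      then show False using e(2)[of k] mmax[of "m-k"] True by auto
    qed
  qed
  have R: "integral {m..b} (\<lambda>x. (\<Phi> x)\<^sup>2 * D x / h x) \<le> 4 * C * integral {m..b} (\<lambda>x. (\<Phi>' x)\<^sup>2 / h x)"
  proof (cases "m < b")
    case True
    show ?thesis
      by (rule hardy_decreasing_weight[where q = q and h' = h'])
        (use True pq m \<Phi> h hpos D Dr right in auto)
  qed (use m in auto)
  have L: "integral {a..m} (\<lambda>x. (\<Phi> x)\<^sup>2 * D x / h x) \<le> 4 * C * integral {a..m} (\<lambda>x. (\<Phi>' x)\<^sup>2 / h x)"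
  proof (cases "a < m")
    case True
    have co: "continuous_on UNIV (\<lambda>x. f (-x))" if "continuous_on UNIV f" for f :: "real \<Rightarrow> real"
      by (rule continuous_on_compose2[OF that]) (auto intro!: continuous_intros)
    have de: "((\<lambda>x. f (-x)) has_real_derivative - g (-x)) (at x)"
      if "\<And>x. (f has_real_derivative g x) (at x)" for f g :: "real \<Rightarrow> real" and x
      using DERIV_mirror[of f "g(-x)" x] that by simp
    have "integral {-m..-a} (\<lambda>x. (\<Phi> (-x))\<^sup>2 * D (-x) / h (-x))
        \<le> 4 * C * integral {-m..-a} (\<lambda>x. (- \<Phi>' (-x))\<^sup>2 / h (-x))"
    proof (rule hardy_decreasing_weight[where q = "-p" and h' = "\<lambda>x. - h' (-x)"])
      fix x assume x: "x \<in> {-m..-a}"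
      then have "-x \<in> {a..b}" "h' (-x) \<ge> 0" using left[of "-x"] True m by auto
      then show "D (-x) * (-p - x)\<^sup>2 \<le> C" using Dl[of "-x"] by (simp add: power2_commute[of "-p" x] power2_commute[of "-x" p] algebra_simps)
      show "- h' (-x) \<le> 0" "0 < h (-x)" using \<open>h' (-x) \<ge> 0\<close> hpos \<open>-x \<in> {a..b}\<close> by auto
    qed (use True pq m \<Phi> h D in \<open>auto intro!: de co continuous_intros\<close>)
    then show ?thesis
      using Henstock_Kurzweil_Integration.integral_reflect_real[of m a "\<lambda>x. (\<Phi> x)\<^sup>2 * D x / h x"]
        Henstock_Kurzweil_Integration.integral_reflect_real[of m a "\<lambda>x. (\<Phi>' x)\<^sup>2 / h x"]
      by simp
  qed (use m in auto)
  have nz: "\<forall>x\<in>{a..b}. h x \<noteq> 0" using hpos by force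
  have i1: "(\<lambda>x. (\<Phi> x)\<^sup>2 * D x / h x) integrable_on {a..b}"
    using nz by (intro integrable_continuous_real continuous_intros c\<Phi> ch cD) auto
  have i2: "(\<lambda>x. (\<Phi>' x)\<^sup>2 / h x) integrable_on {a..b}"
    using nz by (intro integrable_continuous_real continuous_intros c\<Phi>' ch) auto
  have "integral {a..b} (\<lambda>x. (\<Phi> x)\<^sup>2 * D x / h x)
      = integral {a..m} (\<lambda>x. (\<Phi> x)\<^sup>2 * D x / h x) + integral {m..b} (\<lambda>x. (\<Phi> x)\<^sup>2 * D x / h x)"
    using Henstock_Kurzweil_Integration.integral_combine[OF _ _ i1, of m] m by simp
  moreover have "integral {a..b} (\<lambda>x. (\<Phi>' x)\<^sup>2 / h x)
      = integral {a..m} (\<lambda>x. (\<Phi>' x)\<^sup>2 / h x) + integral {m..b} (\<lambda>x. (\<Phi>' x)\<^sup>2 / h x)"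
    using Henstock_Kurzweil_Integration.integral_combine[OF _ _ i2, of m] m by simp
  ultimately show ?thesis using R L by (simp add: algebra_simps)
qed

text \<open>The graphs of a concave \<open>T\<close> above a convex \<open>B\<close> have slopes that are controlled by the
  distance to the end of the interval lying downhill for \<open>T - B\<close>.\<close>

lemma hardy_slab:
  fixes \<Phi> \<Phi>' T T' B B' :: "real \<Rightarrow> real"
  assumes ab: "a \<le> b"
    and \<Phi>: "\<And>x. (\<Phi> has_real_derivative \<Phi>' x) (at x)" "continuous_on UNIV \<Phi>'"
    and supp: "\<And>x. x \<notin> {a..b} \<Longrightarrow> \<Phi> x = 0"
    and T: "\<And>x. (T has_real_derivative T' x) (at x)" "continuous_on UNIV T'"
      "\<And>x y. T y \<le> T x + T' x * (y - x)"
    and B: "\<And>x. (B has_real_derivative B' x) (at x)" "continuous_on UNIV B'"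
      "\<And>x y. B y \<ge> B x + B' x * (y - x)"
    and less: "\<And>x. x \<in> {a..b} \<Longrightarrow> B x < T x"
    and height: "\<And>x. B x < T x \<Longrightarrow> lo \<le> B x \<and> T x \<le> lo + H"
  shows "(\<integral>\<^sup>+x. ennreal ((\<Phi> x)\<^sup>2 * ((T' x)\<^sup>2 + (B' x)\<^sup>2) / (T x - B x)) \<partial>lborel)
      \<le> ennreal (8 * H\<^sup>2) * (\<integral>\<^sup>+x. ennreal ((\<Phi>' x)\<^sup>2 / (T x - B x)) \<partial>lborel)" (is "?A \<le> _ * ?B")
    and "(\<And>x y. B x < T x \<Longrightarrow> B y < T y \<Longrightarrow> \<bar>x - y\<bar> \<le> L) \<Longrightarrow>
      (\<integral>\<^sup>+x. ennreal ((\<Phi> x)\<^sup>2 / (T x - B x)) \<partial>lborel)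
      \<le> ennreal (4 * L\<^sup>2) * (\<integral>\<^sup>+x. ennreal ((\<Phi>' x)\<^sup>2 / (T x - B x)) \<partial>lborel)"
proof -
  have c\<Phi>: "continuous_on S \<Phi>" for S
    using \<Phi>(1) by (meson DERIV_continuous continuous_at_imp_continuous_on)
  have cT: "continuous_on S T" for S
    using T(1) by (meson DERIV_continuous continuous_at_imp_continuous_on)
  have cB: "continuous_on S B" for S
    using B(1) by (meson DERIV_continuous continuous_at_imp_continuous_on)
  have c': "continuous_on S \<Phi>'" "continuous_on S T'" "continuous_on S B'" for S
    using \<Phi>(2) T(2) B(2) continuous_on_subset by blast+
  have "open {x. B x < T x}"
    using cT cB by (intro open_Collect_less) auto
  then obtain e1 e2 where e: "e1 > 0" "cball a e1 \<subseteq> {x. B x < T x}" "e2 > 0" "cball b e2 \<subseteq> {x. B x < T x}"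
    using less[of a] less[of b] ab unfolding open_contains_cball by (metis atLeastAtMost_iff mem_Collect_eq order_refl)
  \<comment> \<open>Two margins around [a, b]: \<Phi> and its derivative vanish outside [a1, b1] and
    \<Phi> also at its ends, while the graphs stay apart up to \<open>p\<close> and
    \<open>q\<close>, the singular points of the Hardy weights.\<close>
  define p a1 b1 q where "p = a - e1" "a1 = a - e1/2" "b1 = b + e2/2" "q = b + e2"
  have ord: "p < a1" "a1 < a" "b < b1" "b1 < q" using e by (auto simp: p_a1_b1_q_def)
  have pos: "B x < T x" if "x \<in> {p..q}" for x
  proof -
    have "x \<in> cball a e1 \<or> x \<in> cball b e2 \<or> x \<in> {a..b}"
      using that by (auto simp: p_a1_b1_q_def dist_real_def)
    then show ?thesis using e less by auto
  qed
  have H0: "H \<ge> 0" using height[of a] less[of a] ab by auto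
  have z: "\<Phi> x = 0" "\<Phi>' x = 0" if "x \<notin> {a1..b1}" for x
  proof -
    show "\<Phi> x = 0" using supp[of x] that ord by auto
    have "\<forall>\<^sub>F y in nhds x. y \<in> - {a..b}"
      by (rule eventually_nhds_in_open) (use that ord in auto)
    then have "\<forall>\<^sub>F y in nhds x. \<Phi> y = 0" by eventually_elim (use supp in auto)
    then have "(\<Phi> has_real_derivative 0) (at x)"
      using DERIV_cong_ev[of x x \<Phi> "\<lambda>_. 0" 0 0] by auto
    then show "\<Phi>' x = 0" using \<Phi>(1) DERIV_unique by blast
  qed
  \<comment> \<open>The integral over the whole line only sees [a1, b1], where T - B is positive:
    elsewhere the numerator is 0.\<close>
  have nn: "(\<integral>\<^sup>+x. ennreal (f x / (T x - B x)) \<partial>lborel)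
      = ennreal (integral {a1..b1} (\<lambda>x. f x / (T x - B x)))"
    if "continuous_on UNIV f" "\<And>x. f x \<ge> 0" "\<And>x. x \<notin> {a1..b1} \<Longrightarrow> f x = 0" for f
  proof -
    have c: "continuous_on {a1..b1} (\<lambda>x. f x / (T x - B x))"
      using pos ord
      by (intro continuous_intros cT cB continuous_on_subset[OF that(1)]) (auto simp: less_imp_neq[THEN not_sym])
    have "(\<integral>\<^sup>+x. ennreal (f x / (T x - B x)) \<partial>lborel)
        = (\<integral>\<^sup>+x. ennreal (f x / (T x - B x)) * indicator {a1..b1} x \<partial>lborel)"
      by (rule nn_integral_cong) (auto simp: indicator_def that)
    also have "\<dots> = ennreal (integral {a1..b1} (\<lambda>x. f x / (T x - B x)))"
    proof (rule nn_integral_has_integral_lebesgue')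
      show "0 \<le> f x / (T x - B x)" if "x \<in> {a1..b1}" for x
        using pos[of x] ord that \<open>f x \<ge> 0\<close> by (intro divide_nonneg_nonneg) auto
      show "((\<lambda>x. f x / (T x - B x)) has_integral integral {a1..b1} (\<lambda>x. f x / (T x - B x))) {a1..b1}"
        using c by (simp add: integrable_integral integrable_continuous_real)
    qed
    finally show ?thesis .
  qed
  define h h' where "h x = T x - B x" "h' x = T' x - B' x" for x
  have h: "\<And>x. (h has_real_derivative h' x) (at x)" "continuous_on UNIV h'"
      "\<And>x y. h y \<le> h x + h' x * (y - x)"
    unfolding h_h'_def using T(3) B(3)
    by (auto intro!: derivative_intros continuous_intros T(1,2) B(1,2) simp: algebra_simps)
      (smt (verit) T(3) B(3) right_diff_distrib left_diff_distrib mult.commute)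
  have hp: "\<And>x. x \<in> {a1..b1} \<Longrightarrow> h x > 0" using pos ord by (auto simp: h_h'_def)
  have z1: "\<Phi> a1 = 0" "\<Phi> b1 = 0" using supp ord ab by auto
  have nB: "?B = ennreal (integral {a1..b1} (\<lambda>x. (\<Phi>' x)\<^sup>2 / h x))"
    unfolding h_h'_def using z by (intro nn) (auto intro!: continuous_intros c')
  have slope: "(T' x)\<^sup>2 + (B' x)\<^sup>2 \<le> 2 * H\<^sup>2 / d\<^sup>2"
    if "d > 0" "\<bar>T' x * d\<bar> \<le> H" "\<bar>B' x * d\<bar> \<le> H" for x d
  proof -
    have "(T' x * d)\<^sup>2 \<le> H\<^sup>2" "(B' x * d)\<^sup>2 \<le> H\<^sup>2"
      using that H0 abs_le_square_iff[of "T' x * d" H] abs_le_square_iff[of "B' x * d" H] by auto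
    then show ?thesis using that by (simp add: field_simps power_mult_distrib)
  qed
  have hgt: "lo \<le> B x" "T x \<le> lo + H" "B x < T x" if "x \<in> {p..q}" for x
    using height pos that by auto
  have "integral {a1..b1} (\<lambda>x. (\<Phi> x)\<^sup>2 * ((T' x)\<^sup>2 + (B' x)\<^sup>2) / h x)
      \<le> 4 * (2 * H\<^sup>2) * integral {a1..b1} (\<lambda>x. (\<Phi>' x)\<^sup>2 / h x)"
  proof (rule hardy_concave_weight[where p = p and q = q and h' = h'])
    fix x assume x: "x \<in> {a1..b1}"
    {
      assume "h' x \<le> 0"
      have d: "q - x > 0" and xq: "x \<in> {p..q}" "q \<in> {p..q}" using x ord ab by auto
      \<comment> \<open>Concavity of \<open>T\<close> bounds its slope from below, convexity of
        \<open>B\<close> bounds its slope from above. The sign of \<open>h'\<close> closes the chain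
        - H \<le> T' d \<le> B' d \<le> H with d = q - x; on the other side the same is done with
        \<open>p\<close>.\<close>
      have "- H \<le> T' x * (q - x)" using T(3)[of q x] hgt[OF xq(1)] hgt[OF xq(2)] by (smt (verit))
      moreover have "B' x * (q - x) \<le> H" using B(3)[of x q] hgt[OF xq(1)] hgt[OF xq(2)] by (smt (verit))
      moreover have "T' x * (q - x) \<le> B' x * (q - x)"
        using \<open>h' x \<le> 0\<close> d by (intro mult_right_mono) (auto simp: h_h'_def)
      ultimately have "\<bar>T' x * (q - x)\<bar> \<le> H" "\<bar>B' x * (q - x)\<bar> \<le> H" by linarith+
      then have "(T' x)\<^sup>2 + (B' x)\<^sup>2 \<le> 2 * H\<^sup>2 / (q - x)\<^sup>2" using d by (intro slope)
      then show "((T' x)\<^sup>2 + (B' x)\<^sup>2) * (q - x)\<^sup>2 \<le> 2 * H\<^sup>2" using d by (simp add: field_simps)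
    next
      assume "h' x \<ge> 0"
      have d: "x - p > 0" and xq: "x \<in> {p..q}" "p \<in> {p..q}" using x ord ab by auto
      have "T' x * (x - p) \<le> H" using T(3)[of p x] hgt[OF xq(1)] hgt[OF xq(2)]
        by (smt (verit) mult_minus_right minus_diff_eq)
      moreover have "- H \<le> B' x * (x - p)" using B(3)[of x p] hgt[OF xq(1)] hgt[OF xq(2)]
        by (smt (verit) mult_minus_right minus_diff_eq)
      moreover have "B' x * (x - p) \<le> T' x * (x - p)"
        using \<open>h' x \<ge> 0\<close> d by (intro mult_right_mono) (auto simp: h_h'_def)
      ultimately have "\<bar>T' x * (x - p)\<bar> \<le> H" "\<bar>B' x * (x - p)\<bar> \<le> H" by linarith+
      then have "(T' x)\<^sup>2 + (B' x)\<^sup>2 \<le> 2 * H\<^sup>2 / (x - p)\<^sup>2" using d by (intro slope)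
      then show "((T' x)\<^sup>2 + (B' x)\<^sup>2) * (x - p)\<^sup>2 \<le> 2 * H\<^sup>2" using d by (simp add: field_simps)
    }
  qed (use ord ab \<Phi> z1 h hp in \<open>auto intro!: continuous_intros c'\<close>)
  moreover have "?A = ennreal (integral {a1..b1} (\<lambda>x. (\<Phi> x)\<^sup>2 * ((T' x)\<^sup>2 + (B' x)\<^sup>2) / h x))"
    unfolding h_h'_def using z by (intro nn) (auto intro!: continuous_intros c' c\<Phi>)
  ultimately show "?A \<le> ennreal (8 * H\<^sup>2) * ?B"
    unfolding nB by (subst ennreal_mult'[symmetric]) (auto intro!: ennreal_leI)
  assume L: "\<And>x y. B x < T x \<Longrightarrow> B y < T y \<Longrightarrow> \<bar>x - y\<bar> \<le> L"
  have "integral {a1..b1} (\<lambda>x. (\<Phi> x)\<^sup>2 * 1 / h x)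
      \<le> 4 * L\<^sup>2 * integral {a1..b1} (\<lambda>x. (\<Phi>' x)\<^sup>2 / h x)"
  proof (rule hardy_concave_weight[where p = p and q = q and h' = h'])
    fix x assume x: "x \<in> {a1..b1}"
    have "\<bar>q - x\<bar> \<le> L" "\<bar>x - p\<bar> \<le> L"
      using L[OF pos[of q] pos[of x]] L[OF pos[of x] pos[of p]] x ord ab by auto
    then have "(q - x)\<^sup>2 \<le> L\<^sup>2" "(x - p)\<^sup>2 \<le> L\<^sup>2"
      using abs_le_square_iff[of "q - x" L] abs_le_square_iff[of "x - p" L] by auto
    then show "1 * (q - x)\<^sup>2 \<le> L\<^sup>2" "1 * (x - p)\<^sup>2 \<le> L\<^sup>2" by auto
  qed (use ord ab \<Phi> z1 h hp in \<open>auto intro!: continuous_intros c'\<close>)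
  moreover have "(\<integral>\<^sup>+x. ennreal ((\<Phi> x)\<^sup>2 / (T x - B x)) \<partial>lborel)
      = ennreal (integral {a1..b1} (\<lambda>x. (\<Phi> x)\<^sup>2 * 1 / h x))"
    unfolding h_h'_def using z by (subst nn) (auto intro!: continuous_intros c' c\<Phi>)
  ultimately show "(\<integral>\<^sup>+x. ennreal ((\<Phi> x)\<^sup>2 / (T x - B x)) \<partial>lborel) \<le> ennreal (4 * L\<^sup>2) * ?B"
    unfolding nB by (subst ennreal_mult'[symmetric]) (auto intro!: ennreal_leI)
qed

section \<open>Orthonormal frames\<close>

lemma emeasure_lborel_Times:
  fixes A :: "'a::euclidean_space set" and B :: "'b::euclidean_space set"
  assumes "A \<in> sets borel" "B \<in> sets borel"
  shows "emeasure lborel (A \<times> B) = emeasure lborel A * emeasure lborel B"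
  using assms by (simp add: lborel_prod[symmetric] lborel.emeasure_pair_measure_Times)

lemma nn_integral_lborel_Pair:
  fixes f :: "'a::euclidean_space \<times> 'b::euclidean_space \<Rightarrow> ennreal"
  assumes "f \<in> borel_measurable borel"
  shows "(\<integral>\<^sup>+x. f x \<partial>lborel) = (\<integral>\<^sup>+x. \<integral>\<^sup>+y. f (x, y) \<partial>lborel \<partial>lborel)"
  unfolding lborel_prod[symmetric] using assms
  by (subst lborel.nn_integral_fst) (auto simp: lborel_prod)

text \<open>Fubini is available for nested pairs, the fields live on \<open>real^3\<close>; this
  identifies the two Lebesgue measures.\<close>

lemma lborel_distr_vector3:
  "distr lborel borel (\<lambda>(a, b, c). a *\<^sub>R axis 1 1 + b *\<^sub>R axis 2 1 + c *\<^sub>R axis 3 1 :: real^3) = lborel"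
proof (rule lborel_eqI[symmetric])
  let ?f = "\<lambda>(a, b, c). a *\<^sub>R axis 1 1 + b *\<^sub>R axis 2 1 + c *\<^sub>R axis 3 1 :: real^3"
  have "continuous_on UNIV ?f"
    unfolding split_beta by (intro continuous_intros)
  then have [measurable]: "?f \<in> borel_measurable borel" by (rule borel_measurable_continuous_onI)
  fix l u :: "real^3"
  assume lu: "\<And>b. b \<in> Basis \<Longrightarrow> l \<bullet> b \<le> u \<bullet> b"
  have le: "l $ i \<le> u $ i" for i
    using lu[of "axis i 1"] by (simp add: inner_axis)
  have "?f -` box l u = {l$1<..<u$1} \<times> {l$2<..<u$2} \<times> {l$3<..<u$3}"
    by (auto simp: mem_box_cart forall_3 axis_def)
  then have "emeasure (distr lborel borel ?f) (box l u)
      = emeasure lborel ({l$1<..<u$1} \<times> {l$2<..<u$2} \<times> {l$3<..<u$3})"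
    by (subst emeasure_distr) auto
  also have "\<dots> = ennreal (u$1 - l$1) * (ennreal (u$2 - l$2) * ennreal (u$3 - l$3))"
    using le[of 1] le[of 2] le[of 3]
    by (auto simp: emeasure_lborel_Times borel_open open_Times)
  also have "\<dots> = (\<Prod>b\<in>Basis. (u - l) \<bullet> b)"
  proof -
    have "(\<Prod>b\<in>Basis. (u - l) \<bullet> b) = (\<Prod>i\<in>UNIV. u $ i - l $ i)"
      unfolding Basis_vec_def
      by (subst prod.UNION_disjoint) (auto simp: inner_axis axis_eq_axis)
    also have "\<dots> = (u$1 - l$1) * ((u$2 - l$2) * (u$3 - l$3))"
      unfolding UNIV_3 by simp
    finally show ?thesis
      using le[of 1] le[of 2] le[of 3] by (simp add: ennreal_mult'[symmetric])
  qed
  finally show "emeasure (distr lborel borel ?f) (box l u) = (\<Prod>b\<in>Basis. (u - l) \<bullet> b)" .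
qed simp

lemma lborel_distr_orthogonal:
  fixes f :: "real^'n::{finite,wellorder} \<Rightarrow> real^'n::_"
  assumes "orthogonal_transformation f"
  shows "distr lborel borel f = lborel"
proof (rule lborel_eqI[symmetric])
  have lin: "linear f" using assms by (rule orthogonal_transformation_linear)
  then have [measurable]: "f \<in> borel_measurable borel"
    by (intro borel_measurable_continuous_onI linear_continuous_on) (simp add: linear_conv_bounded_linear)
  fix l u :: "real^'n::_"
  assume lu: "\<And>b. b \<in> Basis \<Longrightarrow> l \<bullet> b \<le> u \<bullet> b"
  have inv: "orthogonal_transformation (inv f)" using assms by (rule orthogonal_transformation_inv)
  have vi: "f -` box l u = inv f ` box l u"
    using orthogonal_transformation_bij[OF assms] by (simp add: bij_vimage_eq_inv_image)
  have bl: "box l u \<in> lmeasurable" by simp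
  have "f -` box l u \<in> sets borel" using measurable_sets[of f borel borel "box l u"] by simp
  then have "emeasure (distr lborel borel f) (box l u) = emeasure lebesgue (f -` box l u)"
    by (subst emeasure_distr) auto
  also have "\<dots> = ennreal (measure lebesgue (inv f ` box l u))"
    unfolding vi by (rule emeasure_eq_measure2) (rule measurable_orthogonal_image[OF inv bl])
  also have "\<dots> = ennreal (measure lebesgue (box l u))"
    by (simp add: measure_orthogonal_image[OF inv bl])
  also have "\<dots> = (\<Prod>b\<in>Basis. (u - l) \<bullet> b)"
    using lu by (simp add: measure_lborel_box_eq inner_diff_left)
  finally show "emeasure (distr lborel borel f) (box l u) = (\<Prod>b\<in>Basis. (u - l) \<bullet> b)" .
qed simp

locale orthonormal_frame =
  fixes u1 u2 u3 :: "real^3"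
  assumes unit: "u1 \<bullet> u1 = 1" "u2 \<bullet> u2 = 1" "u3 \<bullet> u3 = 1"
    and orth: "u1 \<bullet> u2 = 0" "u1 \<bullet> u3 = 0" "u2 \<bullet> u3 = 0"
begin

lemma orth': "u2 \<bullet> u1 = 0" "u3 \<bullet> u1 = 0" "u3 \<bullet> u2 = 0"
  using orth by (simp_all add: inner_commute)

definition X :: "real \<Rightarrow> real \<Rightarrow> real \<Rightarrow> real^3" where
  "X a b c = a *\<^sub>R u1 + b *\<^sub>R u2 + c *\<^sub>R u3"

lemma X_inner [simp]: "X a b c \<bullet> u1 = a" "X a b c \<bullet> u2 = b" "X a b c \<bullet> u3 = c"
  by (simp_all add: X_def inner_add_left unit orth orth')

text \<open>A nonzero remainder would be a fourth vector orthogonal to the frame, hence four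
  independent vectors in dimension 3.\<close>

lemma frame_expand: "x = X (x \<bullet> u1) (x \<bullet> u2) (x \<bullet> u3)"
proof (rule ccontr)
  define y where "y = x - X (x \<bullet> u1) (x \<bullet> u2) (x \<bullet> u3)"
  assume "\<not> ?thesis"
  then have "y \<noteq> 0" by (simp add: y_def)
  have y: "y \<bullet> u1 = 0" "y \<bullet> u2 = 0" "y \<bullet> u3 = 0" by (simp_all add: y_def inner_diff_left)
  have nz: "u1 \<noteq> 0" "u2 \<noteq> 0" "u3 \<noteq> 0" using unit by auto
  have ne: "u1 \<noteq> u2" "u1 \<noteq> u3" "u2 \<noteq> u3" "y \<noteq> u1" "y \<noteq> u2" "y \<noteq> u3"
    using unit orth y by auto
  have "independent {y, u1, u2, u3}"
    using \<open>y \<noteq> 0\<close> nz y orth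
    by (intro pairwise_orthogonal_independent)
      (auto simp: pairwise_def orthogonal_def inner_commute)
  from independent_bound[OF this] show False using ne by auto
qed

lemma inner_frame: "x \<bullet> y = (x \<bullet> u1) * (y \<bullet> u1) + (x \<bullet> u2) * (y \<bullet> u2) + (x \<bullet> u3) * (y \<bullet> u3)"
proof -
  have "x \<bullet> y = x \<bullet> X (y \<bullet> u1) (y \<bullet> u2) (y \<bullet> u3)"
    by (rule arg_cong[OF frame_expand])
  then show ?thesis by (simp add: X_def inner_add_right mult.commute)
qed

lemma norm_frame: "(norm x)\<^sup>2 = (x \<bullet> u1)\<^sup>2 + (x \<bullet> u2)\<^sup>2 + (x \<bullet> u3)\<^sup>2"
  unfolding power2_norm_eq_inner inner_frame[of x x] by (simp add: power2_eq_square)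

lemma continuous_X: "continuous_on UNIV (\<lambda>(a, b, c). X a b c)"
  unfolding X_def split_beta by (intro continuous_intros)

lemma borel_X [measurable]: "(\<lambda>(a, b, c). X a b c) \<in> borel_measurable borel"
  by (rule borel_measurable_continuous_onI[OF continuous_X])

lemma lborel_distr_X: "distr lborel borel (\<lambda>(a, b, c). X a b c) = lborel"
proof -
  let ?f = "\<lambda>x::real^3. X (x$1) (x$2) (x$3)"
  have "linear ?f"
    by (intro linearI) (auto simp: X_def algebra_simps)
  moreover have "?f x \<bullet> ?f y = x \<bullet> y" for x y
    using inner_frame[of "?f x" "?f y"] by (simp only: X_inner) (simp add: inner_vec_def sum_3)
  ultimately have o: "orthogonal_transformation ?f"
    by (simp add: orthogonal_transformation_def)
  have fm: "?f \<in> borel_measurable borel"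
    by (intro borel_measurable_continuous_onI linear_continuous_on)
      (use \<open>linear ?f\<close> in \<open>simp add: linear_conv_bounded_linear\<close>)
  have vm: "(\<lambda>(a, b, c). a *\<^sub>R axis 1 1 + b *\<^sub>R axis 2 1 + c *\<^sub>R axis 3 1 :: real^3) \<in> borel_measurable borel"
    unfolding split_beta by (intro borel_measurable_continuous_onI continuous_intros)
  have "(\<lambda>(a, b, c). X a b c) = ?f \<circ> (\<lambda>(a, b, c). a *\<^sub>R axis 1 1 + b *\<^sub>R axis 2 1 + c *\<^sub>R axis 3 1)"
    by (auto simp: fun_eq_iff axis_def)
  then have "distr lborel borel (\<lambda>(a, b, c). X a b c)
      = distr (distr lborel borel (\<lambda>(a, b, c). a *\<^sub>R axis 1 1 + b *\<^sub>R axis 2 1 + c *\<^sub>R axis 3 1)) borel ?f"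
    using fm vm by (subst distr_distr) auto
  also have "\<dots> = lborel"
    unfolding lborel_distr_vector3 by (rule lborel_distr_orthogonal[OF o])
  finally show ?thesis .
qed

lemma nn_integral_frame:
  assumes [measurable]: "f \<in> borel_measurable borel"
  shows "(\<integral>\<^sup>+x. f x \<partial>lborel) = (\<integral>\<^sup>+a. \<integral>\<^sup>+b. \<integral>\<^sup>+c. f (X a b c) \<partial>lborel \<partial>lborel \<partial>lborel)"
proof -
  have m: "(\<lambda>(a, b, c). f (X a b c)) \<in> borel_measurable borel"
    using measurable_comp[OF borel_X assms] by (simp add: comp_def split_beta)
  have mp: "(\<lambda>(b, c). f (X a b c)) \<in> borel_measurable borel" for a
  proof -
    have "continuous_on UNIV (\<lambda>(b, c). X a b c)"
      unfolding X_def split_beta by (intro continuous_intros)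
    from measurable_comp[OF borel_measurable_continuous_onI[OF this] assms]
    show ?thesis by (simp add: comp_def split_beta)
  qed
  have "(\<integral>\<^sup>+x. f x \<partial>lborel) = (\<integral>\<^sup>+x. f x \<partial>distr lborel borel (\<lambda>(a, b, c). X a b c))"
    by (simp add: lborel_distr_X)
  also have "\<dots> = (\<integral>\<^sup>+(a, b, c). f (X a b c) \<partial>lborel)"
    using borel_X unfolding split_beta by (subst nn_integral_distr) auto
  also have "\<dots> = (\<integral>\<^sup>+a. \<integral>\<^sup>+(b, c). f (X a b c) \<partial>lborel \<partial>lborel)"
    by (subst nn_integral_lborel_Pair[OF m]) (simp only: prod.case)
  also have "\<dots> = (\<integral>\<^sup>+a. \<integral>\<^sup>+b. \<integral>\<^sup>+c. f (X a b c) \<partial>lborel \<partial>lborel \<partial>lborel)"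
    by (subst nn_integral_lborel_Pair[OF mp]) simp
  finally show ?thesis .
qed

end

section \<open>The potential of a field along columns\<close>

lemma GDERIV_continuous: "GDERIV f x :> D \<Longrightarrow> isCont f x"
  unfolding gderiv_def by (rule has_derivative_continuous)

lemma GDERIV_continuous_on: "(\<And>x. GDERIV f x :> g x) \<Longrightarrow> continuous_on A f"
  by (blast intro: continuous_at_imp_continuous_on GDERIV_continuous)

lemma GDERIV_line:
  assumes "GDERIV f (x + t *\<^sub>R v) :> D"
  shows "((\<lambda>t. f (x + t *\<^sub>R v)) has_real_derivative v \<bullet> D) (at t)"
proof -
  have "((\<lambda>t. x + t *\<^sub>R v) has_derivative (\<lambda>h. h *\<^sub>R v)) (at t)"
    by (auto intro!: derivative_eq_intros)
  from has_derivative_compose[OF this assms[unfolded gderiv_def]] show ?thesis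
    by (simp add: has_field_derivative_def mult.commute[of _ "v \<bullet> D"])
qed

lemma integral_Icc_support:
  fixes k :: "real \<Rightarrow> real"
  assumes "continuous_on UNIV k" "\<And>t. t \<notin> {l..u} \<Longrightarrow> k t = 0" "a \<le> l" "u \<le> b"
  shows "integral {a..b} k = integral {l..u} k"
proof -
  have "(k has_integral integral {l..u} k) {l..u}"
    using assms(1) by (intro integrable_integral integrable_continuous_real) (rule continuous_on_subset, auto)
  then have "(k has_integral integral {l..u} k) {a..b}"
    by (rule has_integral_on_superset) (use assms in auto)
  then show ?thesis by (rule integral_unique)
qed

text \<open>The integral of the square of \<open>f\<close> minus its mean is nonnegative.\<close>

lemma square_integral_le:
  fixes f :: "real \<Rightarrow> real"
  assumes f: "continuous_on {a..b} f" and "a \<le> b"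
  shows "(integral {a..b} f)\<^sup>2 \<le> (b - a) * integral {a..b} (\<lambda>t. (f t)\<^sup>2)"
proof (cases "a = b")
  case False
  define m where "m = integral {a..b} f / (b - a)"
  have i: "f integrable_on {a..b}" "(\<lambda>t. (f t)\<^sup>2) integrable_on {a..b}"
    by (intro integrable_continuous_real continuous_intros f)+
  have "((\<lambda>t. (f t)\<^sup>2 - 2 * m * f t + m\<^sup>2) has_integral
      (integral {a..b} (\<lambda>t. (f t)\<^sup>2) - 2 * m * integral {a..b} f + (b - a) *\<^sub>R m\<^sup>2)) {a..b}"
    using i has_integral_const_real[of "m\<^sup>2" a b] \<open>a \<le> b\<close>
    by (intro has_integral_add has_integral_diff has_integral_mult_right integrable_integral) auto
  moreover have "(f t)\<^sup>2 - 2 * m * f t + m\<^sup>2 \<ge> 0" for t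
    using zero_le_power2[of "f t - m"] by (simp add: power2_diff algebra_simps)
  ultimately have "integral {a..b} (\<lambda>t. (f t)\<^sup>2) - 2 * m * integral {a..b} f + (b - a) *\<^sub>R m\<^sup>2 \<ge> 0"
    by (rule has_integral_nonneg)
  then have "integral {a..b} (\<lambda>t. (f t)\<^sup>2) - 2 * m * integral {a..b} f + (b - a) * m\<^sup>2 \<ge> 0"
    by simp
  moreover have "(b - a) * m\<^sup>2 = m * integral {a..b} f"
    using False by (simp add: m_def power2_eq_square)
  moreover have "m * integral {a..b} f = (integral {a..b} f)\<^sup>2 / (b - a)"
    by (simp add: m_def power2_eq_square)
  ultimately have "(integral {a..b} f)\<^sup>2 / (b - a) \<le> integral {a..b} (\<lambda>t. (f t)\<^sup>2)" by linarith
  then show ?thesis using False \<open>a \<le> b\<close> by (simp add: field_simps)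
qed simp

section \<open>A compactly supported potential between two graphs\<close>

text \<open>\<open>f3\<close> stands for the component of the field along \<open>u3\<close>, with
  gradient \<open>g3\<close>. As \<open>DT\<close> and \<open>DB\<close> are orthogonal to
  \<open>u3\<close>, \<open>T\<close> and \<open>B\<close> are graphs over the columns parallel to
  \<open>u3\<close>; \<open>lo\<close> and \<open>H\<close> bound the heights in nonempty
  columns.\<close>

locale column_field =
  fixes u3 :: "'a::euclidean_space" and K :: "'a set" and f3 :: "'a \<Rightarrow> real" and g3 :: "'a \<Rightarrow> 'a"
    and T :: "'a \<Rightarrow> real" and DT :: "'a \<Rightarrow> 'a" and B :: "'a \<Rightarrow> real" and DB :: "'a \<Rightarrow> 'a"
    and lo H :: real
  assumes u3: "u3 \<bullet> u3 = 1" and K: "compact K" and H: "H \<ge> 0"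
    and f3: "\<And>x. GDERIV f3 x :> g3 x" "continuous_on UNIV g3" "\<And>x. x \<notin> K \<Longrightarrow> f3 x = 0"
    and T: "\<And>x. GDERIV T x :> DT x" "continuous_on UNIV DT"
      "\<And>x y. T y \<le> T x + DT x \<bullet> (y - x)" "\<And>x. DT x \<bullet> u3 = 0"
    and B: "\<And>x. GDERIV B x :> DB x" "continuous_on UNIV DB"
      "\<And>x y. B y \<ge> B x + DB x \<bullet> (y - x)" "\<And>x. DB x \<bullet> u3 = 0"
    and between: "\<And>x. x \<in> K \<Longrightarrow> B x < x \<bullet> u3 \<and> x \<bullet> u3 < T x"
    and slab: "\<And>x. B x < T x \<Longrightarrow> lo \<le> B x \<and> T x \<le> lo + H"
begin

text \<open>The supergradient inequality has no linear term along \<open>u3\<close>, and it is used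
  from both points.\<close>

lemma T_line [simp]: "T (x + c *\<^sub>R u3) = T x"
  using T(3)[of "x + c *\<^sub>R u3" x] T(3)[of x "x + c *\<^sub>R u3"] T(4) by simp

lemma B_line [simp]: "B (x + c *\<^sub>R u3) = B x"
  using B(3)[of "x + c *\<^sub>R u3" x] B(3)[of x "x + c *\<^sub>R u3"] B(4) by simp

lemma inner_line [simp]: "(x + c *\<^sub>R u3) \<bullet> u3 = x \<bullet> u3 + c"
  using u3 by (simp add: inner_add_left)

lemma g3_outside: "x \<notin> K \<Longrightarrow> g3 x = 0"
  using GDERIV_zero_outside[OF f3(1,3)] K compact_imp_closed by blast

lemma cont: "continuous_on A f3" "continuous_on A g3" "continuous_on A T" "continuous_on A DT"
  "continuous_on A B" "continuous_on A DB"
  by (rule GDERIV_continuous_on[OF f3(1)] continuous_on_subset[OF f3(2) subset_UNIV]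
      GDERIV_continuous_on[OF T(1)] continuous_on_subset[OF T(2) subset_UNIV]
      GDERIV_continuous_on[OF B(1)] continuous_on_subset[OF B(2) subset_UNIV])+

text \<open>Seen from a height between \<open>lo\<close> and \<open>lo + H\<close>, a window of
  half-length \<open>W\<close> overshoots the column by at least 1 at both ends. Its fixed limits
  keep boundary terms out of the derivatives of \<open>lower\<close> and
  \<open>total\<close>.\<close>

definition W :: real where "W = H + 1"

definition lower :: "'a \<Rightarrow> real" where "lower x = integral (cbox (-W) 0) (\<lambda>t. f3 (x + t *\<^sub>R u3))"
definition lower_grad :: "'a \<Rightarrow> 'a" where "lower_grad x = integral (cbox (-W) 0) (\<lambda>t. g3 (x + t *\<^sub>R u3))"
definition total :: "'a \<Rightarrow> real" where "total x = integral (cbox (-W) W) (\<lambda>t. f3 (x + t *\<^sub>R u3))"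
definition total_grad :: "'a \<Rightarrow> 'a" where "total_grad x = integral (cbox (-W) W) (\<lambda>t. g3 (x + t *\<^sub>R u3))"

lemma window_deriv:
  "GDERIV (\<lambda>x. integral (cbox a b) (\<lambda>t. f3 (x + t *\<^sub>R u3))) x :> integral (cbox a b) (\<lambda>t. g3 (x + t *\<^sub>R u3))"
  "continuous_on A (\<lambda>x. integral (cbox a b) (\<lambda>t. g3 (x + t *\<^sub>R u3)))"
proof -
  have c: "continuous_on UNIV (\<lambda>(x, t). g3 (x + t *\<^sub>R u3))"
    unfolding split_beta by (intro continuous_on_compose2[OF f3(2)] continuous_intros) auto
  have d: "GDERIV (\<lambda>x. f3 (x + t *\<^sub>R u3)) x :> g3 (x + t *\<^sub>R u3)" for x t
    by (rule GDERIV_shift[OF f3(1)])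
  have e: "continuous_on UNIV (\<lambda>t. f3 (x + t *\<^sub>R u3))" for x
    by (intro continuous_on_compose2[OF cont(1)[of UNIV]] continuous_intros) auto
  show "GDERIV (\<lambda>x. integral (cbox a b) (\<lambda>t. f3 (x + t *\<^sub>R u3))) x :> integral (cbox a b) (\<lambda>t. g3 (x + t *\<^sub>R u3))"
    by (rule GDERIV_integral(1)[OF d e c])
  show "continuous_on A (\<lambda>x. integral (cbox a b) (\<lambda>t. g3 (x + t *\<^sub>R u3)))"
    by (rule GDERIV_integral(2)[OF d e c])
qed

lemma lower: "GDERIV lower x :> lower_grad x" "continuous_on A lower_grad"
  unfolding lower_def[abs_def] lower_grad_def[abs_def] by (rule window_deriv)+

lemma total: "GDERIV total x :> total_grad x" "continuous_on A total_grad"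
  unfolding total_def[abs_def] total_grad_def[abs_def] by (rule window_deriv)+

text \<open>The relative height in the column, 0 on the lower graph and 1 on the upper one. The
  cutoff \<eta> is \<open>step (rel x)\<close>.\<close>

definition rel :: "'a \<Rightarrow> real" where "rel x = (x \<bullet> u3 - B x) / (T x - B x)"

definition rel_grad :: "'a \<Rightarrow> 'a" where
  "rel_grad x = (1 / (T x - B x)) *\<^sub>R (u3 - (1 - rel x) *\<^sub>R DB x - rel x *\<^sub>R DT x)"

lemma GDERIV_rel:
  assumes "B x < T x"
  shows "GDERIV rel x :> rel_grad x"
proof -
  have h: "T x - B x \<noteq> 0" using assms by simp
  have d: "((\<lambda>x. T x - B x) has_derivative (\<lambda>v. v \<bullet> DT x - v \<bullet> DB x)) (at x)"
    and n: "((\<lambda>x. x \<bullet> u3 - B x) has_derivative (\<lambda>v. v \<bullet> u3 - v \<bullet> DB x)) (at x)"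
    using T(1)[of x] B(1)[of x] unfolding gderiv_def by (auto intro!: derivative_eq_intros)
  have "(rel has_derivative (\<lambda>v. ((v \<bullet> u3 - v \<bullet> DB x) * (T x - B x) - (x \<bullet> u3 - B x) * (v \<bullet> DT x - v \<bullet> DB x))
      / ((T x - B x) * (T x - B x)))) (at x)"
    unfolding rel_def[abs_def] by (rule has_derivative_divide'[OF n d h])
  moreover have "((v \<bullet> u3 - v \<bullet> DB x) * (T x - B x) - (x \<bullet> u3 - B x) * (v \<bullet> DT x - v \<bullet> DB x))
      / ((T x - B x) * (T x - B x)) = v \<bullet> rel_grad x" for v
  proof -
    have alg: "(p * h - (r * h) * q) / (h * h) = (p - r * q) / h" if "h \<noteq> 0" for p h r q :: real
      using that by (simp add: field_simps)
    have "x \<bullet> u3 - B x = rel x * (T x - B x)" using h by (simp add: rel_def)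
    then have "((v \<bullet> u3 - v \<bullet> DB x) * (T x - B x) - (x \<bullet> u3 - B x) * (v \<bullet> DT x - v \<bullet> DB x))
        / ((T x - B x) * (T x - B x)) = (v \<bullet> u3 - v \<bullet> DB x - rel x * (v \<bullet> DT x - v \<bullet> DB x)) / (T x - B x)"
      by (simp only: alg[OF h])
    also have "\<dots> = v \<bullet> rel_grad x"
      by (simp add: rel_grad_def inner_diff_right diff_divide_distrib add_divide_distrib algebra_simps)
    finally show ?thesis .
  qed
  ultimately show ?thesis unfolding gderiv_def by simp
qed

text \<open>An open neighbourhood of \<open>S\<close> on which the denominator of \<open>rel\<close>
  is positive.\<close>

definition U :: "'a set" where "U = {x. B x < T x \<and> lo - 1 < x \<bullet> u3 \<and> x \<bullet> u3 < lo + H + 1}"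

text \<open>The parts between the graphs of all columns that meet \<open>K\<close>. Two heights in
  such a part differ by at most \<open>H\<close>, so shifts in \<open>{-H..H}\<close> reach all of
  it, and this form makes compactness evident.\<close>

definition S :: "'a set" where
  "S = {y + t *\<^sub>R u3 | y t. y \<in> K \<and> t \<in> {-H..H}} \<inter> {x. B x \<le> x \<bullet> u3 \<and> x \<bullet> u3 \<le> T x}"

definition pot :: "'a \<Rightarrow> real" where
  "pot x = (if x \<in> U then lower x - step (rel x) * total x else 0)"

definition pot_grad :: "'a \<Rightarrow> 'a" where
  "pot_grad x = (if x \<in> U then lower_grad x - step (rel x) *\<^sub>R total_grad x - (total x * step' (rel x)) *\<^sub>R rel_grad x else 0)"

lemma open_U: "open U"
  unfolding U_def using cont
  by (intro open_Collect_conj open_Collect_less continuous_intros) auto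

lemma compact_S: "compact S"
proof -
  have "{y + t *\<^sub>R u3 | y t. y \<in> K \<and> t \<in> {-H..H}} = (\<lambda>p. fst p + snd p *\<^sub>R u3) ` (K \<times> {-H..H})"
    by force
  moreover have "compact \<dots>"
    using K by (intro compact_continuous_image compact_Times continuous_intros) auto
  moreover have "closed {x. B x \<le> x \<bullet> u3 \<and> x \<bullet> u3 \<le> T x}"
    using cont by (intro closed_Collect_conj closed_Collect_le continuous_intros) auto
  ultimately show ?thesis unfolding S_def by (simp add: compact_Int_closed)
qed

lemma S_props: assumes "x \<in> S" shows "B x < T x" "B x \<le> x \<bullet> u3" "x \<bullet> u3 \<le> T x" "lo \<le> B x" "T x \<le> lo + H" "x \<in> U"
proof -
  show 1: "B x < T x" "B x \<le> x \<bullet> u3" "x \<bullet> u3 \<le> T x" using assms between by (force simp: S_def)+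
  show 2: "lo \<le> B x" "T x \<le> lo + H" using slab[OF 1(1)] by auto
  show "x \<in> U" using 1 2 by (auto simp: U_def)
qed

lemma K_in_column:
  assumes "x + t *\<^sub>R u3 \<in> K"
  shows "B x < x \<bullet> u3 + t" "x \<bullet> u3 + t < T x" "B x < T x" "lo \<le> B x" "T x \<le> lo + H"
  using between[OF assms] slab[of x] by auto

lemma in_S: "x + t *\<^sub>R u3 \<in> K \<Longrightarrow> B x \<le> x \<bullet> u3 \<Longrightarrow> x \<bullet> u3 \<le> T x \<Longrightarrow> x \<in> S"
proof -
  assume a: "x + t *\<^sub>R u3 \<in> K" "B x \<le> x \<bullet> u3" "x \<bullet> u3 \<le> T x"
  have "x = (x + t *\<^sub>R u3) + (- t) *\<^sub>R u3" by simp
  moreover have "- t \<in> {-H..H}" using K_in_column[OF a(1)] a(2,3) by auto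
  ultimately show "x \<in> S" unfolding S_def using a by blast
qed

lemma K_subset_S: "K \<subseteq> S"
  using in_S[of _ 0] between by force

text \<open>A column that misses \<open>K\<close> contributes nothing. Below \<open>B\<close> both
  \<open>step\<close> and \<open>lower\<close> vanish. Above \<open>T\<close> the value of
  \<open>step\<close> is 1, and what remains is minus the integral of \<open>f3\<close> over points
  above \<open>x\<close>, none of which is in \<open>K\<close>.\<close>

lemma pot_outside: assumes "x \<notin> S" shows "pot x = 0"
proof (cases "x \<in> U")
  case xU: True
  have i: "(\<lambda>t. f3 (x + t *\<^sub>R u3)) integrable_on {a..b}" for a b
    by (intro integrable_continuous_real continuous_on_compose2[OF cont(1)[of UNIV]] continuous_intros) auto
  have W: "W \<ge> 0" using H by (simp add: W_def)
  have split: "total x = lower x + integral {0..W} (\<lambda>t. f3 (x + t *\<^sub>R u3))"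
    unfolding total_def lower_def
    using Henstock_Kurzweil_Integration.integral_combine[of "-W" 0 W, OF _ _ i] W by simp
  have zero: "integral {a..b} (\<lambda>t. f3 (x + t *\<^sub>R u3)) = 0"
    if "\<And>t. t \<in> {a..b} \<Longrightarrow> x + t *\<^sub>R u3 \<notin> K" for a b
    using that f3(3) by (intro integral_unique has_integral_is_0) auto
  show ?thesis
  proof (cases "\<exists>t. x + t *\<^sub>R u3 \<in> K")
    case False
    then show ?thesis using zero[of "-W" 0] zero[of 0 W] split by (simp add: pot_def lower_def)
  next
    case True
    then obtain t where t: "x + t *\<^sub>R u3 \<in> K" by blast
    have lt: "B x < T x" using K_in_column[OF t] by simp
    consider "x \<bullet> u3 < B x" | "x \<bullet> u3 > T x" using in_S[OF t] assms by force
    then show ?thesis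
    proof cases
      case 1
      have "step (rel x) = 0" using 1 lt by (intro step_le_0) (simp add: rel_def divide_le_0_iff)
      moreover have "lower x = 0"
        unfolding lower_def using zero[of "-W" 0] 1 K_in_column(1) by force
      ultimately show ?thesis by (simp add: pot_def)
    next
      case 2
      have "step (rel x) = 1" using 2 lt by (intro step_ge_1) (simp add: rel_def)
      moreover have "integral {0..W} (\<lambda>t. f3 (x + t *\<^sub>R u3)) = 0"
        by (rule zero) (use 2 K_in_column(2) in force)
      ultimately show ?thesis using split by (simp add: pot_def)
    qed
  qed
qed (simp add: pot_def)

lemma GDERIV_pot_U: assumes "x \<in> U" shows "GDERIV pot x :> pot_grad x"
proof -
  have lt: "B x < T x" using assms by (simp add: U_def)
  have "GDERIV (\<lambda>x. step (rel x)) x :> step' (rel x) *\<^sub>R rel_grad x"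
    by (rule GDERIV_DERIV_compose[OF GDERIV_rel[OF lt] DERIV_step])
  from GDERIV_diff[OF lower(1) GDERIV_mult[OF this total(1)]]
  have "GDERIV (\<lambda>x. lower x - step (rel x) * total x) x :> pot_grad x"
    using assms by (simp add: pot_grad_def algebra_simps)
  then show ?thesis
    unfolding gderiv_def
    by (rule has_derivative_transform_within_open[OF _ open_U assms]) (simp add: pot_def)
qed

lemma GDERIV_pot_outside: assumes "x \<notin> S" shows "GDERIV pot x :> 0"
proof -
  have "(pot has_derivative (\<lambda>h. 0)) (at x)"
    by (rule has_derivative_transform_within_open[where f = "\<lambda>_. 0" and s = "- S"])
      (use assms pot_outside compact_S compact_imp_closed in auto)
  then show ?thesis by (simp add: gderiv_def)
qed

lemma pot_grad_outside: assumes "x \<notin> S" shows "pot_grad x = 0"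
proof (cases "x \<in> U")
  case True
  have "(\<lambda>h. h \<bullet> pot_grad x) = (\<lambda>h. h \<bullet> 0)"
    using GDERIV_pot_U[OF True] GDERIV_pot_outside[OF assms] has_derivative_unique
    unfolding gderiv_def by blast
  then show ?thesis by (metis inner_eq_zero_iff inner_zero_right)
qed (simp add: pot_grad_def)

lemma GDERIV_pot: "GDERIV pot x :> pot_grad x"
proof (cases "x \<in> U")
  case False
  then have "x \<notin> S" using S_props(6) by blast
  then show ?thesis using GDERIV_pot_outside pot_grad_outside by simp
qed (rule GDERIV_pot_U)

text \<open>Two open sets cover the space: on \<open>U\<close> the explicit formula holds, and off
  \<open>S\<close> the gradient is 0.\<close>

lemma continuous_pot_grad: "continuous_on UNIV pot_grad"
proof -
  have "continuous_on U rel"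
    unfolding rel_def[abs_def] by (intro continuous_intros cont) (auto simp: U_def)
  then have "continuous_on U (\<lambda>x. lower_grad x - step (rel x) *\<^sub>R total_grad x - (total x * step' (rel x)) *\<^sub>R rel_grad x)"
    unfolding rel_grad_def
    by (intro continuous_intros lower total cont continuous_on_compose2[OF continuous_step[of UNIV]]
        continuous_on_compose2[OF continuous_step'[of UNIV]] GDERIV_continuous_on[OF total(1)]) (auto simp: U_def)
  then have "continuous_on U pot_grad"
    by (rule continuous_on_eq) (simp add: pot_grad_def)
  moreover have "continuous_on (- S) pot_grad"
    by (rule continuous_on_eq[of _ "\<lambda>_. 0"]) (auto simp: pot_grad_outside)
  moreover have "open (- S)" using compact_imp_closed[OF compact_S] by (simp add: open_Compl)
  ultimately have "continuous_on (U \<union> - S) pot_grad"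
    using open_U by (intro continuous_on_open_Un)
  moreover have "U \<union> - S = UNIV" using S_props(6) by blast
  ultimately show ?thesis by simp
qed

end

lemma (in column_field) DT_line: "DT (x + c *\<^sub>R u3) = DT x" "DB (x + c *\<^sub>R u3) = DB x"
proof -
  have uniq: "D (x + c *\<^sub>R u3) = D x"
    if "\<And>x. GDERIV F x :> D x" "\<And>x. F (x + c *\<^sub>R u3) = F x" for F :: "'a \<Rightarrow> real" and D
  proof -
    have "(\<lambda>x. F (x + c *\<^sub>R u3)) = F" using that(2) by auto
    then have "GDERIV F x :> D (x + c *\<^sub>R u3)"
      using GDERIV_shift[OF that(1)[of "x + c *\<^sub>R u3"]] by simp
    from has_derivative_unique[OF this[unfolded gderiv_def] that(1)[of x, unfolded gderiv_def]]
    have "\<And>h. h \<bullet> D (x + c *\<^sub>R u3) = h \<bullet> D x" by meson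
    then show ?thesis by (metis vector_eq_ldot)
  qed
  show "DT (x + c *\<^sub>R u3) = DT x" by (rule uniq[OF T(1)]) simp
  show "DB (x + c *\<^sub>R u3) = DB x" by (rule uniq[OF B(1)]) simp
qed

section \<open>Errors of the potential, component by component\<close>

text \<open>\<open>f2\<close> stands for the component along \<open>u2\<close>, and
  \<open>u1\<close> indexes the parallel planes in which the estimates take place. With
  \<open>u1\<close> and \<open>u2\<close> exchanged the locale also covers the remaining
  component.\<close>

locale column_estimate = column_field u3 K f3 g3 T DT B DB lo H + orthonormal_frame u1 u2 u3
  for u1 u2 u3 :: "real^3" and K f3 g3 T DT B DB lo H +
  fixes f2 :: "real^3 \<Rightarrow> real" and g2 :: "real^3 \<Rightarrow> real^3"
  assumes f2: "\<And>x. GDERIV f2 x :> g2 x" "continuous_on UNIV g2" "\<And>x. x \<notin> K \<Longrightarrow> f2 x = 0"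
begin

text \<open>If \<open>f2\<close> and \<open>f3\<close> are components of a field along
  \<open>u2\<close> and \<open>u3\<close>, this is the component of its curl along
  \<open>cross3 u2 u3\<close>, as \<open>curl_cross\<close> shows.\<close>

definition rot :: "real^3 \<Rightarrow> real" where "rot x = g3 x \<bullet> u2 - g2 x \<bullet> u3"

lemma g2_outside: "x \<notin> K \<Longrightarrow> g2 x = 0"
  using GDERIV_zero_outside[OF f2(1,3)] K compact_imp_closed by blast

lemma rot_outside: "x \<notin> K \<Longrightarrow> rot x = 0"
  by (simp add: rot_def g3_outside g2_outside)

lemma cont2: "continuous_on A f2" "continuous_on A g2" "continuous_on A rot"
proof -
  show "continuous_on A f2" "continuous_on A g2"
    by (rule GDERIV_continuous_on[OF f2(1)] continuous_on_subset[OF f2(2) subset_UNIV])+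
  then show "continuous_on A rot" unfolding rot_def[abs_def] by (intro continuous_intros cont)
qed

lemma X_line: "X a b c + t *\<^sub>R u3 = X a b (c + t)"
  by (simp add: X_def algebra_simps)

lemma X_base: "X a b c = X a b lo + (c - lo) *\<^sub>R u3"
  by (simp add: X_line)

lemma column_const: "T (X a b c) = T (X a b lo)" "B (X a b c) = B (X a b lo)"
  "DT (X a b c) = DT (X a b lo)" "DB (X a b c) = DB (X a b lo)"
  by (subst X_base, simp add: DT_line)+

lemma cont_line: "continuous_on UNIV k \<Longrightarrow> continuous_on A (\<lambda>t. k (X a b t))"
  by (rule continuous_on_compose2[of UNIV k]) (auto simp: X_def intro!: continuous_intros)

lemma outside_column: "t \<notin> {B (X a b lo)..T (X a b lo)} \<Longrightarrow> X a b t \<notin> K"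
  using between[of "X a b t"] column_const[of a b t] by auto

lemma empty_column: "\<not> B (X a b lo) < T (X a b lo) \<Longrightarrow> X a b t \<notin> K"
  using between[of "X a b t"] column_const[of a b t] by auto

text \<open>Every admissible window captures the whole column, so the result does not depend on the
  height \<open>c\<close> from which it is taken.\<close>

lemma window:
  assumes k: "continuous_on UNIV k" "\<And>x. x \<notin> K \<Longrightarrow> k x = (0::real)"
    and c: "B (X a b lo) < T (X a b lo)" "c \<in> {lo..lo + H}"
  shows "integral {-W..W} (\<lambda>t. k (X a b (c + t))) = integral {B (X a b lo)..T (X a b lo)} (\<lambda>t. k (X a b t))"
proof -
  have "integral {-W..W} (\<lambda>t. k (X a b (c + t))) = integral {-W + c..W + c} (\<lambda>t. k (X a b t))"
    using integral_shift_Icc_real[of "-W" W "\<lambda>t. k (X a b t)" c] by (simp add: comp_def)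
  also have "\<dots> = integral {B (X a b lo)..T (X a b lo)} (\<lambda>t. k (X a b t))"
    using slab[OF c(1)] c(2) outside_column k(2)
    by (intro integral_Icc_support cont_line k(1)) (auto simp: W_def)
  finally show ?thesis .
qed

definition sq :: "real \<Rightarrow> real \<Rightarrow> real" where
  "sq a b = integral {B (X a b lo)..T (X a b lo)} (\<lambda>t. (rot (X a b t))\<^sup>2)"

lemma sq_nonneg: "sq a b \<ge> 0"
  unfolding sq_def by (intro integral_nonneg integrable_continuous_real continuous_intros cont_line cont2) auto

lemma nn_sq: "(\<integral>\<^sup>+c. ennreal ((rot (X a b c))\<^sup>2) \<partial>lborel) = ennreal (sq a b)"
proof -
  have "(\<integral>\<^sup>+c. ennreal ((rot (X a b c))\<^sup>2) \<partial>lborel)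
      = (\<integral>\<^sup>+c. ennreal ((rot (X a b c))\<^sup>2) * indicator {B (X a b lo)..T (X a b lo)} c \<partial>lborel)"
    using outside_column by (intro nn_integral_cong) (auto simp: indicator_def rot_outside)
  also have "\<dots> = ennreal (sq a b)"
    unfolding sq_def
    by (intro nn_integral_has_integral_lebesgue' integrable_integral integrable_continuous_real
        continuous_intros cont_line cont2) auto
  finally show ?thesis .
qed

lemma grad_along_line:
  fixes g :: "real^3 \<Rightarrow> real^3"
  assumes g: "continuous_on UNIV g"
  shows "integral {s..t} (\<lambda>\<tau>. g (x + \<tau> *\<^sub>R u3)) \<bullet> v = integral {s..t} (\<lambda>\<tau>. g (x + \<tau> *\<^sub>R u3) \<bullet> v)"
proof -
  have "(\<lambda>\<tau>. g (x + \<tau> *\<^sub>R u3)) integrable_on {s..t}"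
    by (intro integrable_continuous_real continuous_on_compose2[OF g] continuous_intros) auto
  from integral_linear[OF this bounded_linear_inner_left[of v]] show ?thesis by (simp add: comp_def)
qed

lemma line_FTC:
  assumes F: "\<And>x. GDERIV F x :> g x" "continuous_on UNIV g" and "s \<le> t"
  shows "integral {s..t} (\<lambda>\<tau>. g (x + \<tau> *\<^sub>R u3) \<bullet> u3) = F (x + t *\<^sub>R u3) - F (x + s *\<^sub>R u3)"
proof (rule integral_unique, rule fundamental_theorem_of_calculus[OF \<open>s \<le> t\<close>])
  fix \<tau>
  show "((\<lambda>\<tau>. F (x + \<tau> *\<^sub>R u3)) has_vector_derivative g (x + \<tau> *\<^sub>R u3) \<bullet> u3) (at \<tau> within {s..t})"
    using GDERIV_line[OF F(1), where x = x and t = \<tau> and v = u3]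
    by (simp add: has_real_derivative_iff_has_vector_derivative[symmetric] inner_commute has_field_derivative_at_within)
qed

lemma outside_window:
  assumes "x \<bullet> u3 \<in> {lo..lo + H}"
  shows "x + W *\<^sub>R u3 \<notin> K" "x + (- W) *\<^sub>R u3 \<notin> K"
  using K_in_column[of x W] K_in_column[of x "- W"] assms by (auto simp: W_def)

lemma rot_int:
  "(\<lambda>\<tau>. rot (x + \<tau> *\<^sub>R u3)) integrable_on {s..t}" "(\<lambda>\<tau>. g2 (x + \<tau> *\<^sub>R u3) \<bullet> u3) integrable_on {s..t}"
  by (intro integrable_continuous_real continuous_intros continuous_on_compose2[OF cont2(3)[of UNIV]]
      continuous_on_compose2[OF cont2(2)[of UNIV]]; simp)+

text \<open>Along a column, the derivative of \<open>f3\<close> in direction \<open>u2\<close> is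
  \<open>rot\<close> plus the vertical derivative of \<open>f2\<close>, and the latter integrates to
  end point values. This is where the curl enters.\<close>

lemma g3_u2_integral:
  assumes "s \<le> t"
  shows "integral {s..t} (\<lambda>\<tau>. g3 (x + \<tau> *\<^sub>R u3)) \<bullet> u2
    = integral {s..t} (\<lambda>\<tau>. rot (x + \<tau> *\<^sub>R u3)) + (f2 (x + t *\<^sub>R u3) - f2 (x + s *\<^sub>R u3))"
proof -
  have "integral {s..t} (\<lambda>\<tau>. g3 (x + \<tau> *\<^sub>R u3)) \<bullet> u2
      = integral {s..t} (\<lambda>\<tau>. rot (x + \<tau> *\<^sub>R u3) + g2 (x + \<tau> *\<^sub>R u3) \<bullet> u3)"
    unfolding grad_along_line[OF f3(2)] by (simp add: rot_def)
  also have "\<dots> = integral {s..t} (\<lambda>\<tau>. rot (x + \<tau> *\<^sub>R u3)) + integral {s..t} (\<lambda>\<tau>. g2 (x + \<tau> *\<^sub>R u3) \<bullet> u3)"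
    by (rule Henstock_Kurzweil_Integration.integral_add[OF rot_int])
  finally show ?thesis by (simp add: line_FTC[OF f2(1,2) assms])
qed

lemma total_grad_u2:
  assumes "x \<bullet> u3 \<in> {lo..lo + H}"
  shows "total_grad x \<bullet> u2 = integral {-W..W} (\<lambda>\<tau>. rot (x + \<tau> *\<^sub>R u3))"
  using g3_u2_integral[of "-W" W x] outside_window[OF assms] f2(3) H by (simp add: total_grad_def W_def)

lemma total_column:
  assumes "B (X a b lo) < T (X a b lo)" "c \<in> {lo..lo + H}"
  shows "total (X a b c) = total (X a b lo)"
  using window[OF cont(1) f3(3) assms] window[OF cont(1) f3(3) assms(1), of lo] H
  by (simp add: total_def X_line)

lemma total_empty_column:
  assumes "\<not> B (X a b lo) < T (X a b lo)"
  shows "total (X a b lo) = 0" "total_grad (X a b lo) = 0"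
  using empty_column[OF assms] by (simp_all add: total_def total_grad_def X_line f3(3) g3_outside)

abbreviation thickness :: "real \<Rightarrow> real \<Rightarrow> real" where
  "thickness a b \<equiv> T (X a b lo) - B (X a b lo)"

abbreviation slope :: "real \<Rightarrow> real \<Rightarrow> real" where
  "slope a b \<equiv> (total (X a b lo))\<^sup>2 * ((DT (X a b lo) \<bullet> u2)\<^sup>2 + (DB (X a b lo) \<bullet> u2)\<^sup>2)"

text \<open>Cauchy-Schwarz on a column of length \<open>thickness a b\<close>. Where this number is
  not positive, \<open>total_grad\<close> is 0, and so is the left side.\<close>

lemma total_grad_sq_le:
  "ennreal ((total_grad (X a b lo) \<bullet> u2)\<^sup>2 / thickness a b) \<le> ennreal (sq a b)"
proof (cases "B (X a b lo) < T (X a b lo)")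
  case True
  have "total_grad (X a b lo) \<bullet> u2 = integral {B (X a b lo)..T (X a b lo)} (\<lambda>t. rot (X a b t))"
    using total_grad_u2[of "X a b lo"] window[OF cont2(3) rot_outside True, of lo] H by (simp add: X_line)
  then have "(total_grad (X a b lo) \<bullet> u2)\<^sup>2 \<le> thickness a b * sq a b"
    using square_integral_le[of "B (X a b lo)" "T (X a b lo)" "\<lambda>t. rot (X a b t)"] True
    by (simp add: sq_def cont_line[OF cont2(3)])
  then show ?thesis using True by (intro ennreal_leI) (simp add: field_simps)
next
  case False
  then show ?thesis by (simp add: total_empty_column)
qed

lemma pot_grad_S:
  assumes "x \<in> S"
  shows "pot_grad x = lower_grad x - step (rel x) *\<^sub>R total_grad x - (total x * step' (rel x)) *\<^sub>R rel_grad x"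
  using S_props(6)[OF assms] by (simp add: pot_grad_def)

text \<open>The vertical derivative of \<open>lower\<close> is exactly \<open>f3\<close>, and
  \<open>total\<close> does not vary along the column; only the derivative of the cutoff is
  left.\<close>

lemma residual3:
  assumes "x \<in> S"
  shows "f3 x - pot_grad x \<bullet> u3 = total x * step' (rel x) / (T x - B x)"
proof -
  have c: "x \<bullet> u3 \<in> {lo..lo + H}" using S_props[OF assms] by auto
  have "lower_grad x \<bullet> u3 = f3 x"
    using line_FTC[OF f3(1,2), of "-W" 0 x] outside_window(2)[OF c] f3(3) H
    by (simp add: lower_grad_def grad_along_line[OF f3(2)] W_def)
  moreover have "total_grad x \<bullet> u3 = 0"
    using line_FTC[OF f3(1,2), of "-W" W x] outside_window[OF c] f3(3) H
    by (simp add: total_grad_def grad_along_line[OF f3(2)] W_def)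
  moreover have "rel_grad x \<bullet> u3 = 1 / (T x - B x)"
    by (simp add: rel_grad_def inner_diff_left u3 T(4) B(4))
  ultimately show ?thesis by (simp add: pot_grad_S[OF assms] inner_diff_left)
qed

text \<open>The error is P - Q. \<open>P\<close> is a weighted combination of the integrals of
  \<open>rot\<close> below and above the point, and \<open>Q\<close> comes from the derivative of
  \<open>rel\<close>, which sees the slopes of the graphs. The factor 8 is 2 from splitting the
  square times 4 from the bound on \<open>step'\<close>.\<close>

lemma residual2:
  assumes S: "X a b c \<in> S"
  shows "(f2 (X a b c) - pot_grad (X a b c) \<bullet> u2)\<^sup>2
    \<le> 2 * thickness a b * sq a b
      + 8 * (slope a b / (thickness a b)\<^sup>2)"
proof -
  define x where "x = X a b c"
  define h where "h = T (X a b lo) - B (X a b lo)"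
  have lt: "B (X a b lo) < T (X a b lo)" and c: "c \<in> {lo..lo + H}" "x \<bullet> u3 \<in> {lo..lo + H}"
    using S_props[OF S] column_const[of a b c] by (auto simp: x_def)
  have h: "h > 0" using lt by (simp add: h_def)
  have hx: "T x - B x = h" unfolding h_def x_def column_const[of a b c] ..
  define s where "s = rel x"
  have s: "0 \<le> s" "s \<le> 1"
    using S_props[OF S] by (auto simp: s_def rel_def x_def)
  define A1 A2 where "A1 = integral {-W..0} (\<lambda>\<tau>. rot (x + \<tau> *\<^sub>R u3))"
    and "A2 = integral {0..W} (\<lambda>\<tau>. rot (x + \<tau> *\<^sub>R u3))"
  have W: "W > 0" using H by (simp add: W_def)
  have low: "lower_grad x \<bullet> u2 = A1 + f2 x"
    using g3_u2_integral[of "-W" 0 x] outside_window(2)[OF c(2)] f2(3) W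
    by (simp add: lower_grad_def A1_def)
  have tot: "total_grad x \<bullet> u2 = A1 + A2"
    using total_grad_u2[OF c(2)] Henstock_Kurzweil_Integration.integral_combine[of "-W" 0 W, OF _ _ rot_int(1)] W
    by (simp add: A1_def A2_def)
  define r where "r = (1 - s) * (DB x \<bullet> u2) + s * (DT x \<bullet> u2)"
  have rg: "rel_grad x \<bullet> u2 = - r / h"
    unfolding rel_grad_def hx s_def[symmetric] r_def by (simp add: inner_diff_left orth' diff_divide_distrib)
  define P Q where "P = - (1 - step s) * A1 + step s * A2" and "Q = total x * step' s * r / h"
  have res: "f2 x - pot_grad x \<bullet> u2 = P - Q"
    using S unfolding x_def[symmetric]
    by (simp add: pot_grad_S inner_diff_left low tot rg s_def[symmetric] P_def Q_def algebra_simps)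
  have "(P - Q)\<^sup>2 \<le> 2 * P\<^sup>2 + 2 * Q\<^sup>2"
    using zero_le_power2[of "P + Q"] by (simp add: power2_eq_square algebra_simps)
  \<comment> \<open>The weights lie in [0, 1], so \<open>P\<close> is at most the integral of the
    absolute value of \<open>rot\<close> over the column; Cauchy-Schwarz supplies the factor
    \<open>h\<close>.\<close>
  moreover have "P\<^sup>2 \<le> h * sq a b"
  proof -
    define J where "J = integral {-W..W} (\<lambda>\<tau>. \<bar>rot (x + \<tau> *\<^sub>R u3)\<bar>)"
    have ai: "(\<lambda>\<tau>. \<bar>rot (x + \<tau> *\<^sub>R u3)\<bar>) integrable_on {s..t}" for s t
      by (intro integrable_continuous_real continuous_intros continuous_on_compose2[OF cont2(3)[of UNIV]]) auto
    have "\<bar>integral {s..t} (\<lambda>\<tau>. rot (x + \<tau> *\<^sub>R u3))\<bar> \<le> integral {s..t} (\<lambda>\<tau>. \<bar>rot (x + \<tau> *\<^sub>R u3)\<bar>)" for s t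
      using Henstock_Kurzweil_Integration.integral_norm_bound_integral[OF rot_int(1)[of x s t] ai[of s t]]
      by simp
    then have "\<bar>A1\<bar> \<le> integral {-W..0} (\<lambda>\<tau>. \<bar>rot (x + \<tau> *\<^sub>R u3)\<bar>)"
      and "\<bar>A2\<bar> \<le> integral {0..W} (\<lambda>\<tau>. \<bar>rot (x + \<tau> *\<^sub>R u3)\<bar>)"
      unfolding A1_def A2_def by blast+
    then have "\<bar>A1\<bar> + \<bar>A2\<bar> \<le> J"
      using Henstock_Kurzweil_Integration.integral_combine[of "-W" 0 W, OF _ _ ai] W
      by (simp add: J_def)
    moreover have "\<bar>P\<bar> \<le> \<bar>A1\<bar> + \<bar>A2\<bar>"
    proof -
      have "\<bar>P\<bar> \<le> (1 - step s) * \<bar>A1\<bar> + step s * \<bar>A2\<bar>"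
        using step_bounds[of s] unfolding P_def
        by (intro order_trans[OF abs_triangle_ineq]) (simp add: abs_mult)
      also have "\<dots> \<le> 1 * \<bar>A1\<bar> + 1 * \<bar>A2\<bar>"
        using step_bounds[of s] by (intro add_mono mult_right_mono) auto
      finally show ?thesis by simp
    qed
    ultimately have "P\<^sup>2 \<le> J\<^sup>2" by (simp add: abs_le_square_iff[symmetric])
    also have "J = integral {B (X a b lo)..T (X a b lo)} (\<lambda>t. \<bar>rot (X a b t)\<bar>)"
      using window[of "\<lambda>x. \<bar>rot x\<bar>" a b c] lt c
      by (simp add: J_def x_def X_line rot_outside continuous_intros cont2)
    also have "\<dots>\<^sup>2 \<le> h * sq a b"
      using square_integral_le[of "B (X a b lo)" "T (X a b lo)" "\<lambda>t. \<bar>rot (X a b t)\<bar>"] lt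
      by (simp add: sq_def h_def cont_line[OF cont2(3)] continuous_intros)
    finally show ?thesis .
  qed
  moreover have "Q\<^sup>2 \<le> 4 * ((total x)\<^sup>2 * ((DT x \<bullet> u2)\<^sup>2 + (DB x \<bullet> u2)\<^sup>2) / h\<^sup>2)"
  proof -
    \<comment> \<open>Convexity of the square: \<open>r\<close> is a convex combination of the
      slopes of the two graphs.\<close>
    have cv: "((1 - s) * p + s * q)\<^sup>2 \<le> p\<^sup>2 + q\<^sup>2" for p q
    proof -
      have "(1 - s) * p\<^sup>2 + s * q\<^sup>2 - ((1 - s) * p + s * q)\<^sup>2 = s * (1 - s) * (p - q)\<^sup>2"
        by (simp add: power2_eq_square algebra_simps)
      moreover have "\<dots> \<ge> 0" using s by simp
      moreover have "(1 - s) * p\<^sup>2 + s * q\<^sup>2 \<le> 1 * p\<^sup>2 + 1 * q\<^sup>2"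
        using s by (intro add_mono mult_right_mono) auto
      ultimately show ?thesis by linarith
    qed
    have "r\<^sup>2 \<le> (DT x \<bullet> u2)\<^sup>2 + (DB x \<bullet> u2)\<^sup>2" unfolding r_def using cv[of "DB x \<bullet> u2" "DT x \<bullet> u2"] by simp
    moreover have "(step' s)\<^sup>2 \<le> 4" using step'_bounds[of s] power_mono[of "step' s" 2 2] by simp
    ultimately have "(step' s)\<^sup>2 * r\<^sup>2 \<le> 4 * ((DT x \<bullet> u2)\<^sup>2 + (DB x \<bullet> u2)\<^sup>2)"
      by (intro mult_mono) auto
    then have "(total x)\<^sup>2 / h\<^sup>2 * ((step' s)\<^sup>2 * r\<^sup>2) \<le> (total x)\<^sup>2 / h\<^sup>2 * (4 * ((DT x \<bullet> u2)\<^sup>2 + (DB x \<bullet> u2)\<^sup>2))"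
      by (intro mult_left_mono) auto
    moreover have "(total x)\<^sup>2 / h\<^sup>2 * ((step' s)\<^sup>2 * r\<^sup>2) = Q\<^sup>2"
      by (simp add: Q_def power_divide power_mult_distrib)
    ultimately show ?thesis by argo
  qed
  ultimately have "(f2 x - pot_grad x \<bullet> u2)\<^sup>2 \<le> 2 * h * sq a b
      + 8 * ((total x)\<^sup>2 * ((DT x \<bullet> u2)\<^sup>2 + (DB x \<bullet> u2)\<^sup>2) / h\<^sup>2)"
    unfolding res by linarith
  then show ?thesis
    unfolding x_def h_def total_column[OF lt c(1)] column_const[of a b c] .
qed

lemma residual_outside: "x \<notin> S \<Longrightarrow> f2 x - pot_grad x \<bullet> u2 = 0" "x \<notin> S \<Longrightarrow> f3 x - pot_grad x \<bullet> u3 = 0"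
  using K_subset_S f2(3) f3(3) pot_grad_outside by auto

text \<open>The bound on the integrand contains the reciprocal of the column length, which
  integration along the column cancels.\<close>

lemma nn_column_le:
  assumes R: "\<And>x. x \<notin> S \<Longrightarrow> R x = 0"
    and M: "\<And>c. X a b c \<in> S \<Longrightarrow> R (X a b c) \<le> M / thickness a b" and "M \<ge> 0"
  shows "(\<integral>\<^sup>+c. ennreal (R (X a b c)) \<partial>lborel) \<le> ennreal M"
proof (cases "B (X a b lo) < T (X a b lo)")
  case True
  define h where "h = T (X a b lo) - B (X a b lo)"
  have h: "h > 0" using True by (simp add: h_def)
  have "(\<integral>\<^sup>+c. ennreal (R (X a b c)) \<partial>lborel)
      \<le> (\<integral>\<^sup>+c. ennreal (M / h) * indicator {B (X a b lo)..T (X a b lo)} c \<partial>lborel)"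
  proof (rule nn_integral_mono)
    fix c
    show "ennreal (R (X a b c)) \<le> ennreal (M / h) * indicator {B (X a b lo)..T (X a b lo)} c"
    proof (cases "X a b c \<in> S")
      case True
      then show ?thesis
        using S_props[OF True] column_const[of a b c] M[OF True] by (auto simp: h_def intro!: ennreal_leI)
    qed (simp add: R)
  qed
  also have "\<dots> = ennreal (M / h) * ennreal h"
    using True by (simp add: nn_integral_cmult_indicator h_def)
  also have "\<dots> = ennreal M"
    using h \<open>M \<ge> 0\<close> by (simp add: ennreal_mult'[symmetric])
  finally show ?thesis .
next
  case False
  then have "X a b c \<notin> S" for c using S_props(1) column_const[of a b c] by metis
  then show ?thesis by (simp add: R)
qed

lemma column2:
  "(\<integral>\<^sup>+c. ennreal ((f2 (X a b c) - pot_grad (X a b c) \<bullet> u2)\<^sup>2) \<partial>lborel)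
    \<le> ennreal (2 * H\<^sup>2) * ennreal (sq a b) + 8 * ennreal (slope a b / thickness a b)"
proof (cases "B (X a b lo) < T (X a b lo)")
  case True
  define h where "h = T (X a b lo) - B (X a b lo)"
  define E where "E = slope a b"
  have h: "h > 0" "h \<le> H" and E: "E \<ge> 0" using True slab[OF True] by (auto simp: h_def E_def)
  have "(\<integral>\<^sup>+c. ennreal ((f2 (X a b c) - pot_grad (X a b c) \<bullet> u2)\<^sup>2) \<partial>lborel) \<le> ennreal (2 * h\<^sup>2 * sq a b + 8 * (E / h))"
  proof (rule nn_column_le)
    fix c assume S: "X a b c \<in> S"
    have "2 * h * sq a b + 8 * (E / h\<^sup>2) = (2 * h\<^sup>2 * sq a b + 8 * (E / h)) / h"
      using h by (simp add: field_simps power2_eq_square)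
    then show "(f2 (X a b c) - pot_grad (X a b c) \<bullet> u2)\<^sup>2
        \<le> (2 * h\<^sup>2 * sq a b + 8 * (E / h)) / thickness a b"
      using residual2[OF S] unfolding h_def[symmetric] E_def[symmetric] by simp
  qed (use h E sq_nonneg residual_outside in auto)
  also have "\<dots> \<le> ennreal (2 * H\<^sup>2 * sq a b + 8 * (E / h))"
    using h sq_nonneg[of a b] by (intro ennreal_leI add_right_mono mult_right_mono mult_left_mono power_mono) auto
  also have "\<dots> = ennreal (2 * H\<^sup>2) * ennreal (sq a b) + 8 * ennreal (E / h)"
  proof -
    have "ennreal (8 * (E / h)) = 8 * ennreal (E / h)" by (subst ennreal_mult') auto
    moreover have "ennreal (2 * H\<^sup>2 * sq a b + 8 * (E / h)) = ennreal (2 * H\<^sup>2 * sq a b) + ennreal (8 * (E / h))"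
      using h E sq_nonneg[of a b] by (intro ennreal_plus) auto
    moreover have "ennreal (2 * H\<^sup>2 * sq a b) = ennreal (2 * H\<^sup>2) * ennreal (sq a b)"
      by (rule ennreal_mult') simp
    ultimately show ?thesis by simp
  qed
  finally show ?thesis by (simp add: h_def E_def)
next
  case False
  then have "X a b c \<notin> S" for c using S_props(1) column_const[of a b c] by metis
  then show ?thesis by (simp add: residual_outside)
qed

lemma column3:
  "(\<integral>\<^sup>+c. ennreal ((f3 (X a b c) - pot_grad (X a b c) \<bullet> u3)\<^sup>2) \<partial>lborel)
    \<le> 4 * ennreal ((total (X a b lo))\<^sup>2 / thickness a b)"
proof (cases "B (X a b lo) < T (X a b lo)")
  case True
  define h where "h = T (X a b lo) - B (X a b lo)"
  have h: "h > 0" using True by (auto simp: h_def)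
  have "(\<integral>\<^sup>+c. ennreal ((f3 (X a b c) - pot_grad (X a b c) \<bullet> u3)\<^sup>2) \<partial>lborel) \<le> ennreal (4 * ((total (X a b lo))\<^sup>2 / h))"
  proof (rule nn_column_le)
    fix c assume S: "X a b c \<in> S"
    have c: "c \<in> {lo..lo + H}" using S_props[OF S] by auto
    have "(step' (rel (X a b c)))\<^sup>2 \<le> 4"
      using step'_bounds[of "rel (X a b c)"] power_mono[of "step' (rel (X a b c))" 2 2] by simp
    then have "(total (X a b lo))\<^sup>2 * (step' (rel (X a b c)))\<^sup>2 / h\<^sup>2 \<le> (total (X a b lo))\<^sup>2 * 4 / h\<^sup>2"
      by (intro divide_right_mono mult_left_mono) auto
    moreover have "(total (X a b lo))\<^sup>2 * 4 / h\<^sup>2 = 4 * ((total (X a b lo))\<^sup>2 / h) / h"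
      using h by (simp add: power2_eq_square)
    ultimately show "(f3 (X a b c) - pot_grad (X a b c) \<bullet> u3)\<^sup>2
        \<le> 4 * ((total (X a b lo))\<^sup>2 / h) / thickness a b"
      unfolding residual3[OF S] total_column[OF True c] column_const[of a b c] h_def[symmetric]
      by (simp add: power_divide power_mult_distrib)
  qed (use h residual_outside in auto)
  also have "\<dots> = 4 * ennreal ((total (X a b lo))\<^sup>2 / h)" by (subst ennreal_mult') auto
  finally show ?thesis by (simp add: h_def)
next
  case False
  then have "X a b c \<notin> S" for c using S_props(1) column_const[of a b c] by metis
  then show ?thesis by (simp add: residual_outside)
qed

text \<open>\<open>hardy_slab\<close> is applied along a line in direction \<open>u2\<close>
  crossing the columns. Its interval is the hull of the shadow of \<open>K\<close> on that line,
  outside of which \<open>total\<close> vanishes.\<close>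

lemma line_hardy:
  shows "(\<integral>\<^sup>+b. ennreal (slope a b / thickness a b) \<partial>lborel)
    \<le> ennreal (8 * H\<^sup>2) * (\<integral>\<^sup>+b. ennreal (sq a b) \<partial>lborel)"
  and "(\<And>x y. B x < T x \<Longrightarrow> B y < T y \<Longrightarrow> \<bar>x \<bullet> u2 - y \<bullet> u2\<bar> \<le> L) \<Longrightarrow>
    (\<integral>\<^sup>+b. ennreal ((total (X a b lo))\<^sup>2 / thickness a b) \<partial>lborel)
    \<le> ennreal (4 * L\<^sup>2) * (\<integral>\<^sup>+b. ennreal (sq a b) \<partial>lborel)"
proof -
  let ?A = "\<integral>\<^sup>+b. ennreal (slope a b / thickness a b) \<partial>lborel"
  let ?A' = "\<integral>\<^sup>+b. ennreal ((total (X a b lo))\<^sup>2 / thickness a b) \<partial>lborel"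
  let ?C = "\<integral>\<^sup>+b. ennreal (sq a b) \<partial>lborel"
  have Xb: "X a b lo = X a 0 lo + b *\<^sub>R u2" for b by (simp add: X_def)
  have der: "((\<lambda>b. F (X a b lo)) has_real_derivative g (X a b lo) \<bullet> u2) (at b)"
    if "\<And>x. GDERIV F x :> g x" for F g b
    using GDERIV_line[OF that, where x = "X a 0 lo" and t = b and v = u2] by (simp add: Xb[symmetric] inner_commute)
  have cl: "continuous_on UNIV (\<lambda>b. g (X a b lo) \<bullet> u2)" if "continuous_on UNIV g" for g :: "real^3 \<Rightarrow> real^3"
    by (intro continuous_intros continuous_on_compose2[OF that]) (auto simp: X_def intro!: continuous_intros)
  have diff: "X a b' lo - X a b lo = (b' - b) *\<^sub>R u2" for b b' by (simp add: X_def algebra_simps)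
  have T3: "T (X a b' lo) \<le> T (X a b lo) + (DT (X a b lo) \<bullet> u2) * (b' - b)" for b b'
    using T(3)[of "X a b' lo" "X a b lo"] by (simp add: diff mult.commute)
  have B3: "B (X a b' lo) \<ge> B (X a b lo) + (DB (X a b lo) \<bullet> u2) * (b' - b)" for b b'
    using B(3)[of "X a b lo" "X a b' lo"] by (simp add: diff mult.commute)
  define Z where "Z = (\<lambda>x. x \<bullet> u2) ` (K \<inter> {x. x \<bullet> u1 = a})"
  have Zc: "compact Z"
    unfolding Z_def by (intro compact_continuous_image continuous_intros compact_Int_closed K closed_Collect_eq)
  have inZ: "b \<in> Z" if "X a b c \<in> K" for b c
    using that unfolding Z_def by (intro image_eqI[of _ _ "X a b c"]) auto
  have Zlt: "B (X a b lo) < T (X a b lo)" if bZ: "b \<in> Z" for b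
  proof -
    obtain x where x: "x \<in> K" "x \<bullet> u1 = a" "x \<bullet> u2 = b" using bZ by (auto simp: Z_def)
    then have "X a b (x \<bullet> u3) \<in> K" using frame_expand[of x] by simp
    then show ?thesis using empty_column by blast
  qed
  have z: "total (X a b lo) = 0" if "b \<notin> Z" for b
    using that inZ f3(3) by (auto simp: total_def X_line intro!: integral_unique has_integral_is_0)
  have E: "(\<integral>\<^sup>+b. ennreal ((total_grad (X a b lo) \<bullet> u2)\<^sup>2 / thickness a b) \<partial>lborel) \<le> ?C"
    by (intro nn_integral_mono total_grad_sq_le)
  have "?A \<le> ennreal (8 * H\<^sup>2) * ?C \<and> ((\<forall>x y. B x < T x \<longrightarrow> B y < T y \<longrightarrow> \<bar>x \<bullet> u2 - y \<bullet> u2\<bar> \<le> L)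
      \<longrightarrow> ?A' \<le> ennreal (4 * L\<^sup>2) * ?C)"
  proof (cases "Z = {}")
    case True
    then have "?A = 0" "?A' = 0" using z by simp_all
    then show ?thesis by simp
  next
    case False
    obtain p q where p: "p \<in> Z" "\<And>b. b \<in> Z \<Longrightarrow> p \<le> b" and q: "q \<in> Z" "\<And>b. b \<in> Z \<Longrightarrow> b \<le> q"
      using compact_attains_inf[OF Zc False] compact_attains_sup[OF Zc False] by blast
    have lt: "B (X a b lo) < T (X a b lo)" if "b \<in> {p..q}" for b
    proof (rule ccontr)
      assume n: "\<not> ?thesis"
      \<comment> \<open>\<open>d\<close> is the slope of the concave thickness at \<open>b\<close>.
        If the thickness were not positive there but positive at \<open>p\<close> and
        \<open>q\<close>, then \<open>d\<close> would have to be negative on account of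
        \<open>p\<close> and positive on account of \<open>q\<close>.\<close>
      define d where "d = DT (X a b lo) \<bullet> u2 - DB (X a b lo) \<bullet> u2"
      have "d * (p - b) > 0" "d * (q - b) > 0"
        using T3[of p b] B3[of b p] Zlt[OF p(1)] T3[of q b] B3[of b q] Zlt[OF q(1)] n
        by (auto simp: d_def algebra_simps)
      then show False using that by (auto simp: zero_less_mult_iff)
    qed
    note hs = hardy_slab[where a = p and b = q and \<Phi> = "\<lambda>b. total (X a b lo)" and \<Phi>' = "\<lambda>b. total_grad (X a b lo) \<bullet> u2"
        and T = "\<lambda>b. T (X a b lo)" and T' = "\<lambda>b. DT (X a b lo) \<bullet> u2"
        and B = "\<lambda>b. B (X a b lo)" and B' = "\<lambda>b. DB (X a b lo) \<bullet> u2" and lo = lo and H = H,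
        OF _ der[OF total(1)] cl[OF total(2)] _ der[OF T(1)] cl[OF T(2)] T3 der[OF B(1)] cl[OF B(2)] B3 lt slab]
    have pq: "p \<le> q" using p q by blast
    have zz: "total (X a b lo) = 0" if "b \<notin> {p..q}" for b using that z p q by fastforce
    have "?A \<le> ennreal (8 * H\<^sup>2) * ?C"
      using hs(1)[OF pq zz] E by (meson mult_left_mono order_trans zero_le)
    moreover have "?A' \<le> ennreal (4 * L\<^sup>2) * ?C" if L: "\<And>x y. B x < T x \<Longrightarrow> B y < T y \<Longrightarrow> \<bar>x \<bullet> u2 - y \<bullet> u2\<bar> \<le> L"
    proof -
      have "\<bar>b - b'\<bar> \<le> L" if "B (X a b lo) < T (X a b lo)" "B (X a b' lo) < T (X a b' lo)" for b b'
        using L[OF that] by simp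
      from hs(2)[OF pq zz _ _ this] show ?thesis using E by (meson mult_left_mono order_trans zero_le)
    qed
    ultimately show ?thesis by blast
  qed
  then show "?A \<le> ennreal (8 * H\<^sup>2) * ?C"
    and "(\<And>x y. B x < T x \<Longrightarrow> B y < T y \<Longrightarrow> \<bar>x \<bullet> u2 - y \<bullet> u2\<bar> \<le> L) \<Longrightarrow> ?A' \<le> ennreal (4 * L\<^sup>2) * ?C"
    by blast+
qed

lemma measurable_frame:
  fixes f :: "real^3 \<Rightarrow> ennreal"
  assumes "f \<in> borel_measurable borel"
  shows "(\<lambda>b. \<integral>\<^sup>+c. f (X a b c) \<partial>lborel) \<in> borel_measurable borel"
proof -
  have "continuous_on UNIV (\<lambda>(b, c). X a b c)" unfolding X_def split_beta by (intro continuous_intros)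
  from measurable_comp[OF borel_measurable_continuous_onI[OF this] assms]
  have "(\<lambda>(b, c). f (X a b c)) \<in> borel_measurable (lborel \<Otimes>\<^sub>M lborel)"
    by (simp add: comp_def split_beta lborel_prod)
  then show ?thesis
    using lborel.borel_measurable_nn_integral[of "\<lambda>b c. f (X a b c)" lborel] by simp
qed

lemma measurable_rot: "(\<lambda>x. ennreal ((rot x)\<^sup>2)) \<in> borel_measurable borel"
  by (intro measurable_compose[OF _ measurable_ennreal] borel_measurable_continuous_onI continuous_intros cont2)

lemma measurable_sq: "(\<lambda>b. ennreal (sq a b)) \<in> borel_measurable borel"
  using measurable_frame[OF measurable_rot] by (simp add: nn_sq)

lemma measurable_total:
  "(\<lambda>b. ennreal (slope a b
     / thickness a b)) \<in> borel_measurable borel"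
  "(\<lambda>b. ennreal ((total (X a b lo))\<^sup>2 / thickness a b)) \<in> borel_measurable borel"
proof -
  have l: "(\<lambda>b. k (X a b lo)) \<in> borel_measurable borel" if "continuous_on UNIV k" for k :: "real^3 \<Rightarrow> real"
    by (intro borel_measurable_continuous_onI continuous_on_compose2[OF that])
      (auto simp: X_def intro!: continuous_intros)
  have [measurable]: "(\<lambda>b. total (X a b lo)) \<in> borel_measurable borel" "(\<lambda>b. T (X a b lo)) \<in> borel_measurable borel"
    "(\<lambda>b. B (X a b lo)) \<in> borel_measurable borel" "(\<lambda>b. DT (X a b lo) \<bullet> u2) \<in> borel_measurable borel"
    "(\<lambda>b. DB (X a b lo) \<bullet> u2) \<in> borel_measurable borel"
    by (intro l[of total] l[of T] l[of B] l[of "\<lambda>x. DT x \<bullet> u2"] l[of "\<lambda>x. DB x \<bullet> u2"]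
        continuous_intros cont GDERIV_continuous_on[OF total(1)])+
  show "(\<lambda>b. ennreal (slope a b
     / thickness a b)) \<in> borel_measurable borel"
    by measurable
  show "(\<lambda>b. ennreal ((total (X a b lo))\<^sup>2 / thickness a b)) \<in> borel_measurable borel"
    by measurable
qed

lemma nn_sq_frame:
  "(\<integral>\<^sup>+a. ennreal C * (\<integral>\<^sup>+b. ennreal (sq a b) \<partial>lborel) \<partial>lborel)
    = ennreal C * (\<integral>\<^sup>+x. ennreal ((rot x)\<^sup>2) \<partial>lborel)"
proof -
  have "continuous_on UNIV (\<lambda>(p, c). X (fst p) (snd p) c)"
    unfolding X_def split_beta by (intro continuous_intros)
  from measurable_comp[OF borel_measurable_continuous_onI[OF this] measurable_rot]
  have "(\<lambda>(p, c). ennreal ((rot (X (fst p) (snd p) c))\<^sup>2)) \<in> borel_measurable (lborel \<Otimes>\<^sub>M lborel)"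
    by (simp add: comp_def split_beta lborel_prod)
  from lborel.borel_measurable_nn_integral[OF this]
  have "(\<lambda>(a, b). ennreal (sq a b)) \<in> borel_measurable (lborel \<Otimes>\<^sub>M lborel)"
    by (simp add: nn_sq split_beta lborel_prod)
  from lborel.borel_measurable_nn_integral[OF this]
  have "(\<lambda>a. \<integral>\<^sup>+b. ennreal (sq a b) \<partial>lborel) \<in> borel_measurable lborel" by simp
  then show ?thesis
    unfolding nn_integral_frame[OF measurable_rot] nn_sq by (rule nn_integral_cmult)
qed

text \<open>The constant is 2 for the integrals of \<open>rot\<close> plus 8 times the Hardy
  constant 8. Only the height \<open>H\<close> occurs, no width.\<close>

lemma nn_residual2:
  "(\<integral>\<^sup>+x. ennreal ((f2 x - pot_grad x \<bullet> u2)\<^sup>2) \<partial>lborel) \<le> ennreal (66 * H\<^sup>2) * (\<integral>\<^sup>+x. ennreal ((rot x)\<^sup>2) \<partial>lborel)"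
proof -
  have m: "(\<lambda>x. ennreal ((f2 x - pot_grad x \<bullet> u2)\<^sup>2)) \<in> borel_measurable borel"
    by (intro measurable_compose[OF _ measurable_ennreal] borel_measurable_continuous_onI continuous_intros
        cont2 continuous_pot_grad)
  have line: "(\<integral>\<^sup>+b. \<integral>\<^sup>+c. ennreal ((f2 (X a b c) - pot_grad (X a b c) \<bullet> u2)\<^sup>2) \<partial>lborel \<partial>lborel)
      \<le> ennreal (66 * H\<^sup>2) * (\<integral>\<^sup>+b. ennreal (sq a b) \<partial>lborel)" for a
  proof -
    let ?I = "\<integral>\<^sup>+b. ennreal (sq a b) \<partial>lborel"
    let ?E = "\<lambda>b. ennreal (slope a b / thickness a b)"
    have "(\<integral>\<^sup>+b. \<integral>\<^sup>+c. ennreal ((f2 (X a b c) - pot_grad (X a b c) \<bullet> u2)\<^sup>2) \<partial>lborel \<partial>lborel)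
      \<le> (\<integral>\<^sup>+b. ennreal (2 * H\<^sup>2) * ennreal (sq a b) + 8 * ?E b \<partial>lborel)"
      by (intro nn_integral_mono column2)
    also have "\<dots> = ennreal (2 * H\<^sup>2) * ?I + 8 * (\<integral>\<^sup>+b. ?E b \<partial>lborel)"
      using measurable_sq measurable_total(1)
      by (subst nn_integral_add; (subst nn_integral_cmult)?; (subst nn_integral_cmult)?) auto
    also have "\<dots> \<le> ennreal (2 * H\<^sup>2) * ?I + 8 * (ennreal (8 * H\<^sup>2) * ?I)"
      by (intro add_left_mono mult_left_mono line_hardy(1)) auto
    also have "\<dots> = (ennreal (2 * H\<^sup>2) + 8 * ennreal (8 * H\<^sup>2)) * ?I"
      by (simp add: distrib_right mult.assoc)
    also have "ennreal (2 * H\<^sup>2) + 8 * ennreal (8 * H\<^sup>2) = ennreal (66 * H\<^sup>2)"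
    proof -
      have "8 * ennreal (8 * H\<^sup>2) = ennreal (8 * (8 * H\<^sup>2))" by (subst ennreal_mult') auto
      then show ?thesis by (simp add: ennreal_plus[symmetric] del: ennreal_plus)
    qed
    finally show ?thesis .
  qed
  show ?thesis
    unfolding nn_integral_frame[OF m] nn_sq_frame[symmetric] by (intro nn_integral_mono line)
qed

text \<open>The constant is 4 from the squared slope of \<open>step\<close> times the Hardy constant
  4; this is the only place where the width along \<open>u2\<close> enters.\<close>

lemma nn_residual3:
  assumes L: "\<And>x y. B x < T x \<Longrightarrow> B y < T y \<Longrightarrow> \<bar>x \<bullet> u2 - y \<bullet> u2\<bar> \<le> L"
  shows "(\<integral>\<^sup>+x. ennreal ((f3 x - pot_grad x \<bullet> u3)\<^sup>2) \<partial>lborel) \<le> ennreal (16 * L\<^sup>2) * (\<integral>\<^sup>+x. ennreal ((rot x)\<^sup>2) \<partial>lborel)"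
proof -
  have m: "(\<lambda>x. ennreal ((f3 x - pot_grad x \<bullet> u3)\<^sup>2)) \<in> borel_measurable borel"
    by (intro measurable_compose[OF _ measurable_ennreal] borel_measurable_continuous_onI continuous_intros
        cont continuous_pot_grad)
  have line: "(\<integral>\<^sup>+b. \<integral>\<^sup>+c. ennreal ((f3 (X a b c) - pot_grad (X a b c) \<bullet> u3)\<^sup>2) \<partial>lborel \<partial>lborel)
      \<le> ennreal (16 * L\<^sup>2) * (\<integral>\<^sup>+b. ennreal (sq a b) \<partial>lborel)" for a
  proof -
    let ?I = "\<integral>\<^sup>+b. ennreal (sq a b) \<partial>lborel"
    let ?E = "\<lambda>b. ennreal ((total (X a b lo))\<^sup>2 / thickness a b)"
    have "(\<integral>\<^sup>+b. \<integral>\<^sup>+c. ennreal ((f3 (X a b c) - pot_grad (X a b c) \<bullet> u3)\<^sup>2) \<partial>lborel \<partial>lborel)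
      \<le> (\<integral>\<^sup>+b. 4 * ?E b \<partial>lborel)"
      by (intro nn_integral_mono column3)
    also have "\<dots> = 4 * (\<integral>\<^sup>+b. ?E b \<partial>lborel)"
      using measurable_total(2) by (intro nn_integral_cmult) auto
    also have "\<dots> \<le> 4 * (ennreal (4 * L\<^sup>2) * ?I)"
      by (intro mult_left_mono line_hardy(2) L) auto
    also have "\<dots> = ennreal (16 * L\<^sup>2) * ?I"
    proof -
      have "4 * ennreal (4 * L\<^sup>2) = ennreal (4 * (4 * L\<^sup>2))" by (subst ennreal_mult') auto
      then show ?thesis by (simp add: mult.assoc[symmetric])
    qed
    finally show ?thesis .
  qed
  show ?thesis
    unfolding nn_integral_frame[OF m] nn_sq_frame[symmetric] by (intro nn_integral_mono line)
qed

end

section \<open>The eigenvalue\<close>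

lemma curl_cross:
  "curl \<phi> x \<bullet> cross3 u v
    = (\<Sum>k\<in>UNIV. u $ k * (pd k \<phi> x \<bullet> v)) - (\<Sum>k\<in>UNIV. v $ k * (pd k \<phi> x \<bullet> u))"
  by (simp add: curl_def cross3_simps)

text \<open>The cross product of two orthonormal vectors is a unit vector.\<close>

lemma curl_cross_sq_le:
  assumes "u \<bullet> u = 1" "v \<bullet> v = 1" "u \<bullet> v = 0"
  shows "((\<Sum>k\<in>UNIV. u $ k * (pd k \<phi> x \<bullet> v)) - (\<Sum>k\<in>UNIV. v $ k * (pd k \<phi> x \<bullet> u)))\<^sup>2 \<le> (norm (curl \<phi> x))\<^sup>2"
proof -
  have "norm u = 1" "norm v = 1" using assms by (simp_all add: norm_eq_sqrt_inner)
  then have "cross3 u v \<bullet> cross3 u v = 1"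
    using assms norm_cross[of u v] by (simp add: power2_norm_eq_inner)
  then show ?thesis
    using Cauchy_Schwarz_ineq[of "curl \<phi> x" "cross3 u v"]
    by (simp add: curl_cross power2_norm_eq_inner)
qed

lemma test_functions_D:
  assumes "\<phi> \<in> test_functions \<Omega>"
  shows "Ck k \<phi>" "compact (closure {x. \<phi> x \<noteq> 0})" "closure {x. \<phi> x \<noteq> 0} \<subseteq> \<Omega>"
  using assms by (auto simp: test_functions_def compact_support_in_def)

lemma pd_continuous: "Ck (Suc k) f \<Longrightarrow> continuous_on A (pd i f)"
  using Ck_continuous by force

lemma GDERIV_component:
  fixes \<phi> :: "real^'n \<Rightarrow> 'b::real_inner"
  assumes "Ck (Suc k) \<phi>"
  shows "GDERIV (\<lambda>x. \<phi> x \<bullet> u) x :> (\<chi> i. pd i \<phi> x \<bullet> u)"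
proof -
  have "((\<lambda>x. \<phi> x \<bullet> u) has_derivative (\<lambda>h. (\<Sum>i\<in>UNIV. h $ i *\<^sub>R pd i \<phi> x) \<bullet> u)) (at x)"
    by (rule has_derivative_inner_left[OF has_derivative_pd[OF Ck_differentiable[OF assms]]])
  then show ?thesis
    by (simp add: gderiv_def inner_vec_def inner_sum_left)
qed

lemma curl_continuous: "Ck (Suc k) \<phi> \<Longrightarrow> continuous_on A (curl \<phi>)"
proof -
  assume \<phi>: "Ck (Suc k) \<phi>"
  have "continuous_on A (\<lambda>x. \<chi> i. curl \<phi> x $ i)"
  proof (rule continuous_on_vec_lambda)
    have "continuous_on A (\<lambda>x. curl \<phi> x $ i)" if "i = 1 \<or> i = 2 \<or> i = 3" for i
      using that
      by (elim disjE; simp add: curl_def; intro continuous_intros pd_continuous[OF \<phi>])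
    then show "continuous_on A (\<lambda>x. curl \<phi> x $ i)" for i using exhaust_3 by blast
  qed
  then show ?thesis by simp
qed

lemma curl_outside:
  assumes "Ck (Suc k) \<phi>" "x \<notin> closure {x. \<phi> x \<noteq> 0}"
  shows "curl \<phi> x = 0"
proof -
  have "(\<phi> has_derivative (\<lambda>h. 0)) (at x)"
    by (rule has_derivative_transform_within_open[where f = "\<lambda>_. 0" and s = "- closure {x. \<phi> x \<noteq> 0}"])
      (use assms(2) closure_subset[of "{x. \<phi> x \<noteq> 0}"] in auto)
  then have "pd i \<phi> x = 0" for i by (rule pd_eq)
  then show ?thesis by (simp add: curl_def vec_eq_iff forall_3)
qed

lemma (in orthonormal_frame) gradient_approximation:
  assumes \<Omega>: "open \<Omega>" "convex \<Omega>" "bounded \<Omega>"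
    and \<phi>: "\<phi> \<in> test_functions \<Omega>"
    and w2: "\<And>x y. x \<in> \<Omega> \<Longrightarrow> y \<in> \<Omega> \<Longrightarrow> x \<bullet> u2 - y \<bullet> u2 \<le> \<delta>"
    and w3: "\<And>x y. x \<in> \<Omega> \<Longrightarrow> y \<in> \<Omega> \<Longrightarrow> x \<bullet> u3 - y \<bullet> u3 \<le> \<delta>"
  obtains \<psi> G S where "\<And>x. GDERIV \<psi> x :> G x" "continuous_on UNIV G" "compact S" "S \<subseteq> \<Omega>"
    "\<And>x. x \<notin> S \<Longrightarrow> \<psi> x = 0"
    "(\<integral>\<^sup>+x. ennreal ((norm (\<phi> x - G x))\<^sup>2) \<partial>lborel)
      \<le> ennreal (148 * \<delta>\<^sup>2) * (\<integral>\<^sup>+x. ennreal ((norm (curl \<phi> x))\<^sup>2) \<partial>lborel)"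
proof (cases "\<forall>x. \<phi> x = 0")
  case True
  show ?thesis
    by (rule that[of "\<lambda>x. 0" "\<lambda>x. 0" "{}"]) (use True in \<open>auto simp: GDERIV_const\<close>)
next
  case False
  note Ck = test_functions_D(1)[OF \<phi>]
  \<comment> \<open>Separation by hyperplanes needs a convex set; the hull of the support is still
    compact and, by convexity of \<Omega>, still inside it.\<close>
  define K where "K = convex hull (closure {x. \<phi> x \<noteq> 0})"
  have K: "compact K" "convex K" "K \<noteq> {}" "K \<subseteq> \<Omega>"
    using test_functions_D(2,3)[OF \<phi>] \<Omega>(2) False
    by (auto simp: K_def compact_convex_hull hull_minimal)
  have outside: "\<phi> x = 0" if "x \<notin> K" for x
    using that closure_subset[of "{x. \<phi> x \<noteq> 0}"] hull_subset[of "closure {x. \<phi> x \<noteq> 0}" convex]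
    by (auto simp: K_def)
  obtain T DT B DB where T: "\<And>x. GDERIV T x :> DT x" "\<And>A. continuous_on A DT"
    "\<And>x y. T y \<le> T x + DT x \<bullet> (y - x)" "\<And>x. DT x \<bullet> u3 = 0"
    and B: "\<And>x. GDERIV B x :> DB x" "\<And>A. continuous_on A DB"
    "\<And>x y. B y \<ge> B x + DB x \<bullet> (y - x)" "\<And>x. DB x \<bullet> u3 = 0"
    and between: "\<And>x. x \<in> K \<Longrightarrow> B x < x \<bullet> u3 \<and> x \<bullet> u3 < T x"
    and slab: "\<And>x. B x \<le> x \<bullet> u3 \<Longrightarrow> x \<bullet> u3 \<le> T x \<Longrightarrow> x \<in> \<Omega>"
    using smooth_slab_between[OF K \<Omega>(1,3) unit(3)] by metis
  have line: "T (x + c *\<^sub>R u3) = T x" "B (x + c *\<^sub>R u3) = B x" for x c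
    using T(3)[of "x + c *\<^sub>R u3" x] T(3)[of x "x + c *\<^sub>R u3"] T(4)
      B(3)[of "x + c *\<^sub>R u3" x] B(3)[of x "x + c *\<^sub>R u3"] B(4) by simp_all
  define lo where "lo = (INF x\<in>\<Omega>. x \<bullet> u3)"
  obtain k0 where k0: "k0 \<in> \<Omega>" using K by auto
  then have \<delta>: "\<delta> \<ge> 0" using w3[of k0 k0] by simp
  have bdd: "bdd_below ((\<lambda>x. x \<bullet> u3) ` \<Omega>)"
    using w3[OF k0] by (intro bdd_belowI2[of _ "k0 \<bullet> u3 - \<delta>"]) (simp add: algebra_simps)
  \<comment> \<open>Over a nonempty column both graph points lie in \<Omega>, so the extents of
    \<Omega> along \<open>u3\<close> and \<open>u2\<close> control the heights and the shadow of the
    slab.\<close>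
  have graph: "x + (T x - x \<bullet> u3) *\<^sub>R u3 \<in> \<Omega>" "x + (B x - x \<bullet> u3) *\<^sub>R u3 \<in> \<Omega>" if "B x < T x" for x
    using that by (auto intro!: slab simp: line inner_add_left unit)
  have height: "lo \<le> B x \<and> T x \<le> lo + \<delta>" if "B x < T x" for x
  proof
    have "lo \<le> (x + (B x - x \<bullet> u3) *\<^sub>R u3) \<bullet> u3"
      unfolding lo_def by (rule cINF_lower[OF bdd graph(2)[OF that]])
    then show "lo \<le> B x" by (simp add: inner_add_left unit)
    have "T x - \<delta> \<le> lo"
      unfolding lo_def
    proof (rule cINF_greatest)
      show "T x - \<delta> \<le> y \<bullet> u3" if "y \<in> \<Omega>" for y
        using w3[OF graph(1)[OF \<open>B x < T x\<close>] that] by (simp add: inner_add_left unit)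
    qed (use k0 in auto)
    then show "T x \<le> lo + \<delta>" by simp
  qed
  have width: "\<bar>x \<bullet> u2 - y \<bullet> u2\<bar> \<le> \<delta>" if "B x < T x" "B y < T y" for x y
    using w2[OF graph(1)[OF that(1)] graph(1)[OF that(2)]] w2[OF graph(1)[OF that(2)] graph(1)[OF that(1)]]
    by (simp add: inner_add_left orth' abs_le_iff)
  let ?f = "\<lambda>u x. \<phi> x \<bullet> u" and ?g = "\<lambda>u x. \<chi> i. pd i \<phi> x \<bullet> u"
  have f: "GDERIV (?f u) x :> ?g u x" for u x by (rule GDERIV_component[OF Ck[of "Suc 0"]])
  have g: "continuous_on A (?g u)" for u A
    by (intro continuous_on_vec_lambda continuous_intros pd_continuous[OF Ck[of "Suc 0"]])
  interpret E2: column_estimate u1 u2 u3 K "?f u3" "?g u3" T DT B DB lo \<delta> "?f u2" "?g u2"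
    by unfold_locales (use f g outside K(1) T B between height \<delta> unit orth in \<open>auto simp: inner_commute\<close>)
  \<comment> \<open>The potential depends on \<open>u3\<close>, the graphs and \<open>f3\<close>,
    but not on the horizontal direction. Both interpretations therefore share one
    \<open>pot_grad\<close>, and this one controls its component along \<open>u1\<close>.\<close>
  interpret E1: column_estimate u2 u1 u3 K "?f u3" "?g u3" T DT B DB lo \<delta> "?f u1" "?g u1"
    by unfold_locales (use f g outside orth' unit orth in auto)
  have S: "E2.S \<subseteq> \<Omega>" using E2.S_props slab by blast
  have gi: "?g v x \<bullet> u = (\<Sum>k\<in>UNIV. u $ k * (pd k \<phi> x \<bullet> v))" for v u x
    by (simp add: inner_vec_def[of "?g v x" u] mult.commute)
  have rot1: "(E1.rot x)\<^sup>2 \<le> (norm (curl \<phi> x))\<^sup>2" for x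
    unfolding E1.rot_def gi by (rule curl_cross_sq_le) (use unit orth in auto)
  have rot2: "(E2.rot x)\<^sup>2 \<le> (norm (curl \<phi> x))\<^sup>2" for x
    unfolding E2.rot_def gi by (rule curl_cross_sq_le) (use unit orth in auto)
  let ?C = "\<integral>\<^sup>+x. ennreal ((norm (curl \<phi> x))\<^sup>2) \<partial>lborel"
  have C1: "(\<integral>\<^sup>+x. ennreal ((E1.rot x)\<^sup>2) \<partial>lborel) \<le> ?C" and C2: "(\<integral>\<^sup>+x. ennreal ((E2.rot x)\<^sup>2) \<partial>lborel) \<le> ?C"
    by (intro nn_integral_mono ennreal_leI rot1 rot2)+
  let ?r = "\<lambda>u x. ennreal ((\<phi> x \<bullet> u - E2.pot_grad x \<bullet> u)\<^sup>2)"
  have m: "?r u \<in> borel_measurable borel" for u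
    by (intro measurable_compose[OF _ measurable_ennreal] borel_measurable_continuous_onI continuous_intros
        Ck_continuous[OF Ck] E2.continuous_pot_grad)
  have eq: "ennreal ((norm (\<phi> x - E2.pot_grad x))\<^sup>2) = ?r u1 x + (?r u2 x + ?r u3 x)" for x
    unfolding norm_frame by (simp add: inner_diff_left add.assoc)
  have "(\<integral>\<^sup>+x. ennreal ((norm (\<phi> x - E2.pot_grad x))\<^sup>2) \<partial>lborel)
      = (\<integral>\<^sup>+x. ?r u1 x \<partial>lborel) + ((\<integral>\<^sup>+x. ?r u2 x \<partial>lborel) + (\<integral>\<^sup>+x. ?r u3 x \<partial>lborel))"
    unfolding eq using m by (subst nn_integral_add; (subst nn_integral_add)?) auto
  \<comment> \<open>For the component along \<open>u3\<close> the interpretation \<open>E2\<close>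
    is chosen, because \<delta> bounds the width along \<open>u2\<close> and nothing is assumed
    about the one along \<open>u1\<close>.\<close>
  also have "\<dots> \<le> ennreal (66 * \<delta>\<^sup>2) * ?C + (ennreal (66 * \<delta>\<^sup>2) * ?C + ennreal (16 * \<delta>\<^sup>2) * ?C)"
    by (intro add_mono order_trans[OF E1.nn_residual2] order_trans[OF E2.nn_residual2]
        order_trans[OF E2.nn_residual3[OF width]] mult_left_mono C1 C2) auto
  also have "\<dots> = ennreal (148 * \<delta>\<^sup>2) * ?C"
    by (simp add: distrib_right[symmetric] ennreal_plus[symmetric] del: ennreal_plus)
  finally show ?thesis
    using that[OF E2.GDERIV_pot E2.continuous_pot_grad E2.compact_S S E2.pot_outside] by blast
qed

section \<open>Square integrable fields and orthogonality to gradients\<close>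

lemma measurable_lebesgue_on_continuous:
  "continuous_on UNIV f \<Longrightarrow> f \<in> borel_measurable (lebesgue_on \<Omega>)"
  for f :: "'a::euclidean_space \<Rightarrow> 'b::topological_space"
  by (intro measurable_restrict_space1 measurable_completion) (simp add: borel_measurable_continuous_onI)

lemma integrable_lebesgue_on_continuous:
  fixes f :: "'a::euclidean_space \<Rightarrow> 'b::euclidean_space"
  assumes f: "continuous_on UNIV f" and \<Omega>: "open \<Omega>" "bounded \<Omega>"
  shows "integrable (lebesgue_on \<Omega>) f"
proof -
  interpret finite_measure "lebesgue_on \<Omega>"
    by (rule finite_measure_lebesgue_on[OF lmeasurable_open[OF \<Omega>(2,1)]])
  have "bounded (f ` closure \<Omega>)"
    using \<Omega> by (intro compact_imp_bounded compact_continuous_image continuous_on_subset[OF f]) auto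
  then obtain M where M: "\<And>x. x \<in> closure \<Omega> \<Longrightarrow> norm (f x) \<le> M" by (auto simp: bounded_iff)
  show ?thesis
  proof (rule integrable_const_bound)
    show "AE x in lebesgue_on \<Omega>. norm (f x) \<le> M"
      using M closure_subset[of \<Omega>] by (intro AE_I2) auto
  qed (rule measurable_lebesgue_on_continuous[OF f])
qed

lemma L2_fields_continuous:
  assumes "continuous_on UNIV f" "open \<Omega>" "bounded \<Omega>"
  shows "f \<in> L2_fields \<Omega>"
  unfolding L2_fields_def
  by (auto intro!: measurable_lebesgue_on_continuous integrable_lebesgue_on_continuous continuous_intros assms)

lemma L2_fields_diff:
  assumes "u \<in> L2_fields \<Omega>" "v \<in> L2_fields \<Omega>"
  shows "(\<lambda>x. u x - v x) \<in> L2_fields \<Omega>"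
    "(LINT x|lebesgue_on \<Omega>. (norm (u x - v x))\<^sup>2)
      \<le> 2 * (LINT x|lebesgue_on \<Omega>. (norm (u x))\<^sup>2) + 2 * (LINT x|lebesgue_on \<Omega>. (norm (v x))\<^sup>2)"
proof -
  have [measurable]: "u \<in> borel_measurable (lebesgue_on \<Omega>)" "v \<in> borel_measurable (lebesgue_on \<Omega>)"
    and i: "integrable (lebesgue_on \<Omega>) (\<lambda>x. (norm (u x))\<^sup>2)" "integrable (lebesgue_on \<Omega>) (\<lambda>x. (norm (v x))\<^sup>2)"
    using assms by (auto simp: L2_fields_def)
  have le: "(norm (u x - v x))\<^sup>2 \<le> 2 * (norm (u x))\<^sup>2 + 2 * (norm (v x))\<^sup>2" for x
  proof -
    have "(norm (u x - v x))\<^sup>2 + (norm (u x + v x))\<^sup>2 = 2 * (norm (u x))\<^sup>2 + 2 * (norm (v x))\<^sup>2"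
      by (simp add: power2_norm_eq_inner algebra_simps inner_diff_left inner_diff_right inner_add_left inner_add_right inner_commute)
    then show ?thesis by (smt (verit) zero_le_power2)
  qed
  have ii: "integrable (lebesgue_on \<Omega>) (\<lambda>x. 2 * (norm (u x))\<^sup>2 + 2 * (norm (v x))\<^sup>2)"
    using i by auto
  have id: "integrable (lebesgue_on \<Omega>) (\<lambda>x. (norm (u x - v x))\<^sup>2)"
    by (rule Bochner_Integration.integrable_bound[OF ii]) (use le in auto)
  then show "(\<lambda>x. u x - v x) \<in> L2_fields \<Omega>" by (simp add: L2_fields_def)
  have "(LINT x|lebesgue_on \<Omega>. (norm (u x - v x))\<^sup>2)
      \<le> (LINT x|lebesgue_on \<Omega>. 2 * (norm (u x))\<^sup>2 + 2 * (norm (v x))\<^sup>2)"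
    by (rule integral_mono[OF id ii le])
  then show "(LINT x|lebesgue_on \<Omega>. (norm (u x - v x))\<^sup>2)
      \<le> 2 * (LINT x|lebesgue_on \<Omega>. (norm (u x))\<^sup>2) + 2 * (LINT x|lebesgue_on \<Omega>. (norm (v x))\<^sup>2)"
    using i by simp
qed

lemma inner_le_half_squares: "\<bar>x \<bullet> y\<bar> \<le> (norm x)\<^sup>2 / 2 + (norm y)\<^sup>2 / 2"
proof -
  have "0 \<le> (norm x - norm y)\<^sup>2" by simp
  then have "norm x * norm y \<le> (norm x)\<^sup>2 / 2 + (norm y)\<^sup>2 / 2" by (simp add: power2_eq_square algebra_simps)
  then show ?thesis using Cauchy_Schwarz_ineq2[of x y] by linarith
qed

lemma L2_fields_inner:
  assumes "u \<in> L2_fields \<Omega>" "v \<in> L2_fields \<Omega>"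
  shows "integrable (lebesgue_on \<Omega>) (\<lambda>x. u x \<bullet> v x)"
proof (rule Bochner_Integration.integrable_bound)
  show "integrable (lebesgue_on \<Omega>) (\<lambda>x. (norm (u x))\<^sup>2 / 2 + (norm (v x))\<^sup>2 / 2)"
    using assms by (auto simp: L2_fields_def)
  show "(\<lambda>x. u x \<bullet> v x) \<in> borel_measurable (lebesgue_on \<Omega>)"
    using assms by (auto simp: L2_fields_def)
  show "AE x in lebesgue_on \<Omega>. norm (u x \<bullet> v x) \<le> norm ((norm (u x))\<^sup>2 / 2 + (norm (v x))\<^sup>2 / 2)"
    using inner_le_half_squares by (intro AE_I2) auto
qed

text \<open>The divergence condition tests smooth functions only. Replacing \<psi> by a test
  function with gradient uniformly \<eta>-close to \<open>G\<close> changes the integral by at most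
  \<eta> times the L1 norm of \<open>E\<close>, which is finite on a bounded domain.\<close>

lemma weakly_div_free_C1:
  assumes E: "E \<in> L2_fields \<Omega>" "weakly_div_free \<Omega> E" and \<Omega>: "open \<Omega>" "bounded \<Omega>"
    and \<psi>: "\<And>x. GDERIV \<psi> x :> G x" "continuous_on UNIV G" "compact S" "S \<subseteq> \<Omega>" "\<And>x. x \<notin> S \<Longrightarrow> \<psi> x = 0"
  shows "(LINT x|lebesgue_on \<Omega>. E x \<bullet> G x) = 0"
proof -
  let ?M = "lebesgue_on \<Omega>"
  have [simp]: "integrable ?M (\<lambda>x. (norm (E x))\<^sup>2)" using E by (simp add: L2_fields_def)
  have [simp]: "integrable ?M (\<lambda>x. c :: real)" for c
    by (rule integrable_lebesgue_on_continuous) (use \<Omega> in auto)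
  \<comment> \<open>An upper bound for the L1 norm of \<open>E\<close>, since norm (E x) is at most
    half of 1 plus its square.\<close>
  define I where "I = (LINT x|?M. (norm (E x))\<^sup>2 / 2 + 1 / 2)"
  have "I \<ge> 0" unfolding I_def by (intro integral_nonneg_AE AE_I2) simp
  have bound: "\<bar>LINT x|?M. E x \<bullet> G x\<bar> \<le> \<eta> * I" if \<eta>: "\<eta> > 0" for \<eta>
  proof -
    obtain \<psi>' where \<psi>': "\<psi>' \<in> test_functions \<Omega>" "\<And>x. norm (grad \<psi>' x - G x) \<le> \<eta>" "continuous_on UNIV (grad \<psi>')"
      using C1_approx_by_test_function[OF \<psi>(1,2,3,4) \<Omega>(1) \<psi>(5) \<eta>] by metis
    have G: "G \<in> L2_fields \<Omega>" and g: "grad \<psi>' \<in> L2_fields \<Omega>"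
      using L2_fields_continuous \<psi>(2) \<psi>'(3) \<Omega> by auto
    note i = L2_fields_inner[OF E(1) G] L2_fields_inner[OF E(1) g]
    have "(LINT x|?M. E x \<bullet> grad \<psi>' x) = 0"
      using E(2) \<psi>'(1) by (simp add: weakly_div_free_def)
    then have "(LINT x|?M. E x \<bullet> G x) = (LINT x|?M. E x \<bullet> G x - E x \<bullet> grad \<psi>' x)"
      using i by (simp add: Bochner_Integration.integral_diff)
    also have "\<bar>\<dots>\<bar> \<le> (LINT x|?M. \<eta> * ((norm (E x))\<^sup>2 / 2 + 1 / 2))"
    proof (rule integral_abs_bound_integral)
      fix x
      have "\<bar>E x \<bullet> G x - E x \<bullet> grad \<psi>' x\<bar> \<le> norm (E x) * norm (G x - grad \<psi>' x)"
        unfolding inner_diff_right[symmetric] by (rule Cauchy_Schwarz_ineq2)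
      also have "\<dots> \<le> norm (E x) * \<eta>"
        using \<psi>'(2)[of x] by (intro mult_left_mono) (auto simp: norm_minus_commute)
      also have "norm (E x) \<le> (norm (E x))\<^sup>2 / 2 + 1 / 2"
        using zero_le_power2[of "norm (E x) - 1"] by (simp add: power2_eq_square algebra_simps)
      finally show "\<bar>E x \<bullet> G x - E x \<bullet> grad \<psi>' x\<bar> \<le> \<eta> * ((norm (E x))\<^sup>2 / 2 + 1 / 2)"
        using \<eta> by (simp add: mult.commute mult_left_mono)
    qed (use i in auto)
    also have "\<dots> = \<eta> * I" by (simp add: I_def)
    finally show ?thesis .
  qed
  show ?thesis
  proof (rule ccontr)
    assume "\<not> ?thesis"
    then have p: "\<bar>LINT x|?M. E x \<bullet> G x\<bar> > 0" by simp
    define \<eta> where "\<eta> = \<bar>LINT x|?M. E x \<bullet> G x\<bar> / (2 * (I + 1))"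
    have "\<eta> > 0" using p \<open>I \<ge> 0\<close> by (simp add: \<eta>_def)
    from bound[OF this] have "\<bar>LINT x|?M. E x \<bullet> G x\<bar> * (2 * (I + 1)) \<le> \<bar>LINT x|?M. E x \<bullet> G x\<bar> * I"
      using \<open>I \<ge> 0\<close> by (simp add: \<eta>_def divide_simps)
    then show False using p \<open>I \<ge> 0\<close> by (simp add: mult_le_cancel_left)
  qed
qed

lemma nn_integral_lebesgue_on_le:
  assumes "f \<in> borel_measurable borel" "open \<Omega>"
  shows "(\<integral>\<^sup>+x. f x \<partial>lebesgue_on \<Omega>) \<le> (\<integral>\<^sup>+x. f x \<partial>lborel)"
    "(\<And>x. x \<notin> \<Omega> \<Longrightarrow> f x = 0) \<Longrightarrow> (\<integral>\<^sup>+x. f x \<partial>lebesgue_on \<Omega>) = (\<integral>\<^sup>+x. f x \<partial>lborel)"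
proof -
  have "\<Omega> \<in> sets lebesgue" using assms(2) by auto
  then have e: "(\<integral>\<^sup>+x. f x \<partial>lebesgue_on \<Omega>) = (\<integral>\<^sup>+x. f x * indicator \<Omega> x \<partial>lborel)"
    by (simp add: nn_integral_restrict_space nn_integral_completion)
  show "(\<integral>\<^sup>+x. f x \<partial>lebesgue_on \<Omega>) \<le> (\<integral>\<^sup>+x. f x \<partial>lborel)"
    unfolding e by (intro nn_integral_mono) (auto simp: indicator_def)
  show "(\<integral>\<^sup>+x. f x \<partial>lebesgue_on \<Omega>) = (\<integral>\<^sup>+x. f x \<partial>lborel)" if "\<And>x. x \<notin> \<Omega> \<Longrightarrow> f x = 0"
    unfolding e by (intro nn_integral_cong) (auto simp: indicator_def that)
qed

text \<open>\<open>E\<close> is orthogonal to the gradient \<open>G\<close>, so its squared norm is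
  its product with E - G, and the norm of \<open>E\<close> is at most that of E - G. This difference
  is split at \<phi>, and the curl of \<phi> is compared with the weak curl of \<open>E\<close>;
  both splittings double, so 592 = 2 * 2 * 148. The approximation errors disappear as \<epsilon>
  tends to 0.\<close>

lemma (in orthonormal_frame) maxwell_space_estimate:
  assumes \<Omega>: "open \<Omega>" "convex \<Omega>" "bounded \<Omega>"
    and w2: "\<And>x y. x \<in> \<Omega> \<Longrightarrow> y \<in> \<Omega> \<Longrightarrow> x \<bullet> u2 - y \<bullet> u2 \<le> \<delta>"
    and w3: "\<And>x y. x \<in> \<Omega> \<Longrightarrow> y \<in> \<Omega> \<Longrightarrow> x \<bullet> u3 - y \<bullet> u3 \<le> \<delta>"
    and E: "E \<in> maxwell_space \<Omega>"
  shows "(LINT x|lebesgue_on \<Omega>. (norm (E x))\<^sup>2)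
    \<le> 592 * \<delta>\<^sup>2 * (LINT x|lebesgue_on \<Omega>. (norm (weak_curl \<Omega> E x))\<^sup>2)"
proof -
  let ?M = "lebesgue_on \<Omega>"
  let ?N = "\<lambda>u :: real^3 \<Rightarrow> real^3. LINT x|?M. (norm (u x))\<^sup>2"
  define w where "w = weak_curl \<Omega> E"
  have E0: "E \<in> H0_curl \<Omega>" and div: "weakly_div_free \<Omega> E" using E by (auto simp: maxwell_space_def)
  then have EL: "E \<in> L2_fields \<Omega>" and "\<exists>w. w \<in> L2_fields \<Omega> \<and> is_weak_curl \<Omega> E w"
    by (auto simp: H0_curl_def H_curl_def)
  from someI_ex[OF this(2)] have wL: "w \<in> L2_fields \<Omega>" by (simp add: w_def weak_curl_def)
  have nonneg: "?N u \<ge> 0" for u by (intro integral_nonneg_AE AE_I2) simp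
  have main: "?N E \<le> 592 * \<delta>\<^sup>2 * ?N w + (2 + 592 * \<delta>\<^sup>2) * \<epsilon>" if \<epsilon>: "\<epsilon> > 0" for \<epsilon>
  proof -
    obtain \<phi> where \<phi>: "\<phi> \<in> test_functions \<Omega>"
      and close: "?N (\<lambda>x. E x - \<phi> x) + ?N (\<lambda>x. w x - curl \<phi> x) < \<epsilon>"
      using E0 \<epsilon> unfolding H0_curl_def w_def by blast
    then have c1: "?N (\<lambda>x. E x - \<phi> x) \<le> \<epsilon>" and c2: "?N (\<lambda>x. w x - curl \<phi> x) \<le> \<epsilon>"
      using nonneg[of "\<lambda>x. E x - \<phi> x"] nonneg[of "\<lambda>x. w x - curl \<phi> x"] by linarith+
    note Ck = test_functions_D(1)[OF \<phi>]
    have \<phi>c: "continuous_on UNIV \<phi>" by (rule Ck_continuous[OF Ck])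
    have cc: "continuous_on UNIV (curl \<phi>)" by (rule curl_continuous[OF Ck[of "Suc 0"]])
    obtain \<psi> G S where G: "\<And>x. GDERIV \<psi> x :> G x" "continuous_on UNIV G" "compact S" "S \<subseteq> \<Omega>"
      "\<And>x. x \<notin> S \<Longrightarrow> \<psi> x = 0"
      and est: "(\<integral>\<^sup>+x. ennreal ((norm (\<phi> x - G x))\<^sup>2) \<partial>lborel)
        \<le> ennreal (148 * \<delta>\<^sup>2) * (\<integral>\<^sup>+x. ennreal ((norm (curl \<phi> x))\<^sup>2) \<partial>lborel)"
      by (rule gradient_approximation[OF \<Omega> \<phi> w2 w3]) blast+
    have L: "\<phi> \<in> L2_fields \<Omega>" "curl \<phi> \<in> L2_fields \<Omega>" "G \<in> L2_fields \<Omega>"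
      using L2_fields_continuous \<phi>c cc G(2) \<Omega> by auto
    have RL: "(\<lambda>x. \<phi> x - G x) \<in> L2_fields \<Omega>" by (rule L2_fields_diff(1)[OF L(1,3)])
    have R: "?N (\<lambda>x. \<phi> x - G x) \<le> 148 * \<delta>\<^sup>2 * ?N (curl \<phi>)"
    proof -
      have mR: "(\<lambda>x. ennreal ((norm (\<phi> x - G x))\<^sup>2)) \<in> borel_measurable borel"
        and mC: "(\<lambda>x. ennreal ((norm (curl \<phi> x))\<^sup>2)) \<in> borel_measurable borel"
        by (intro measurable_compose[OF _ measurable_ennreal] borel_measurable_continuous_onI continuous_intros
            \<phi>c G(2) cc)+
      have "ennreal (?N (\<lambda>x. \<phi> x - G x)) = (\<integral>\<^sup>+x. ennreal ((norm (\<phi> x - G x))\<^sup>2) \<partial>?M)"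
        using RL by (intro nn_integral_eq_integral[symmetric]) (auto simp: L2_fields_def)
      also have "\<dots> \<le> ennreal (148 * \<delta>\<^sup>2) * (\<integral>\<^sup>+x. ennreal ((norm (curl \<phi> x))\<^sup>2) \<partial>lborel)"
        using nn_integral_lebesgue_on_le(1)[OF mR \<Omega>(1)] est by (rule order_trans)
      also have "(\<integral>\<^sup>+x. ennreal ((norm (curl \<phi> x))\<^sup>2) \<partial>lborel) = (\<integral>\<^sup>+x. ennreal ((norm (curl \<phi> x))\<^sup>2) \<partial>?M)"
        using curl_outside[OF Ck[of "Suc 0"]] test_functions_D(3)[OF \<phi>]
        by (intro nn_integral_lebesgue_on_le(2)[OF mC \<Omega>(1), symmetric]) auto
      also have "\<dots> = ennreal (?N (curl \<phi>))"
        using L(2) by (intro nn_integral_eq_integral) (auto simp: L2_fields_def)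
      also have "ennreal (148 * \<delta>\<^sup>2) * ennreal (?N (curl \<phi>)) = ennreal (148 * \<delta>\<^sup>2 * ?N (curl \<phi>))"
        by (rule ennreal_mult'[symmetric]) simp
      finally show ?thesis by (subst (asm) ennreal_le_iff) (auto intro!: mult_nonneg_nonneg nonneg)
    qed
    \<comment> \<open>The curl of \<phi> is written as w - (w - curl \<phi>).\<close>
    have curl: "?N (curl \<phi>) \<le> 2 * ?N w + 2 * \<epsilon>"
      using L2_fields_diff(2)[OF wL L2_fields_diff(1)[OF wL L(2)]] c2 by simp
    have EG: "(\<lambda>x. E x - G x) \<in> L2_fields \<Omega>" by (rule L2_fields_diff(1)[OF EL L(3)])
    have zero: "(LINT x|?M. E x \<bullet> G x) = 0"
      by (rule weakly_div_free_C1[OF EL div \<Omega>(1,3) G])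
    have "?N E = (LINT x|?M. E x \<bullet> (E x - G x))"
      using zero L2_fields_inner[OF EL EL] L2_fields_inner[OF EL L(3)]
      by (simp add: inner_diff_right power2_norm_eq_inner)
    also have "\<dots> \<le> (LINT x|?M. (norm (E x))\<^sup>2 / 2 + (norm (E x - G x))\<^sup>2 / 2)"
    proof (rule integral_mono)
      show "E x \<bullet> (E x - G x) \<le> (norm (E x))\<^sup>2 / 2 + (norm (E x - G x))\<^sup>2 / 2" for x
        using inner_le_half_squares[of "E x" "E x - G x"] by linarith
    qed (use EL EG L2_fields_inner[OF EL EG] in \<open>auto simp: L2_fields_def\<close>)
    also have "\<dots> = ?N E / 2 + ?N (\<lambda>x. E x - G x) / 2"
      using EL EG by (simp add: L2_fields_def)
    finally have "?N E \<le> ?N (\<lambda>x. E x - G x)" by simp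
    also have "\<dots> \<le> 2 * ?N (\<lambda>x. E x - \<phi> x) + 2 * ?N (\<lambda>x. \<phi> x - G x)"
    proof -
      have n: "(norm (G x - \<phi> x))\<^sup>2 = (norm (\<phi> x - G x))\<^sup>2" for x by (simp add: norm_minus_commute)
      show ?thesis
        using L2_fields_diff(2)[OF L2_fields_diff(1)[OF EL L(1)] L2_fields_diff(1)[OF L(3,1)]]
        by (simp add: n)
    qed
    also have "\<dots> \<le> 2 * \<epsilon> + 2 * (148 * \<delta>\<^sup>2 * (2 * ?N w + 2 * \<epsilon>))"
      using c1 R mult_left_mono[OF curl, of "148 * \<delta>\<^sup>2"] by simp
    finally show ?thesis by (simp add: algebra_simps)
  qed
  have "?N E \<le> 592 * \<delta>\<^sup>2 * ?N w"
  proof (rule field_le_epsilon)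
    fix e :: real assume "e > 0"
    have p: "2 + 592 * \<delta>\<^sup>2 > 0" by (simp add: add_pos_nonneg)
    then have "e / (2 + 592 * \<delta>\<^sup>2) > 0" using \<open>e > 0\<close> by simp
    from main[OF this] show "?N E \<le> 592 * \<delta>\<^sup>2 * ?N w + e" using p by simp
  qed
  then show ?thesis by (simp add: w_def)
qed

lemma (in orthonormal_frame) lambda1_Max_ge:
  assumes \<Omega>: "open \<Omega>" "convex \<Omega>" "bounded \<Omega>" and "\<delta> > 0"
    and w2: "\<And>x y. x \<in> \<Omega> \<Longrightarrow> y \<in> \<Omega> \<Longrightarrow> x \<bullet> u2 - y \<bullet> u2 \<le> \<delta>"
    and w3: "\<And>x y. x \<in> \<Omega> \<Longrightarrow> y \<in> \<Omega> \<Longrightarrow> x \<bullet> u3 - y \<bullet> u3 \<le> \<delta>"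
  shows "ereal (1 / (592 * \<delta>\<^sup>2)) \<le> lambda1_Max \<Omega>"
  unfolding lambda1_Max_def
proof (rule INF_greatest, clarsimp)
  fix E assume E: "E \<in> maxwell_space \<Omega>" "\<not> (AE x in lebesgue_on \<Omega>. E x = 0)"
  let ?I = "LINT x|lebesgue_on \<Omega>. (norm (E x))\<^sup>2"
  have EL: "E \<in> L2_fields \<Omega>" using E by (simp add: maxwell_space_def H0_curl_def H_curl_def)
  have "?I \<ge> 0" by (intro integral_nonneg_AE AE_I2) simp
  moreover have "?I \<noteq> 0"
    using integral_nonneg_eq_0_iff_AE[of "lebesgue_on \<Omega>" "\<lambda>x. (norm (E x))\<^sup>2"] EL E(2)
    by (auto simp: L2_fields_def)
  ultimately have "?I > 0" by (simp add: less_le)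
  then show "1 / (592 * \<delta>\<^sup>2) \<le> (LINT x|lebesgue_on \<Omega>. (norm (weak_curl \<Omega> E x))\<^sup>2) / ?I"
    using maxwell_space_estimate[OF \<Omega> w2 w3 E(1)] \<open>\<delta> > 0\<close> by (simp add: field_simps)
qed

section \<open>The perimeter\<close>

lemma (in orthonormal_frame) swap: "orthonormal_frame u2 u1 u3"
  using unit orth orth' by unfold_locales

lemma nn_integral_indicator_Icc:
  fixes a b :: real
  assumes "a \<le> b"
  shows "(\<integral>\<^sup>+x. c * indicator {a..b} x \<partial>lborel) = c * ennreal (b - a)"
  using assms by (simp add: nn_integral_cmult_indicator)

text \<open>The competitor is \<open>u3\<close> times a smooth substitute for the sign of the height
  above the section. In \<Omega> its divergence is positive, and within distance \<open>e\<close>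
  above and below the parallelogram it is at least 1 / (pi e). That prism has volume 2 e l w, so
  \<open>e\<close> cancels.\<close>

lemma (in orthonormal_frame) Per_ge_section:
  assumes \<Omega>: "open \<Omega>" "bounded \<Omega>" and "l > 0" "w > 0"
    and inside: "\<And>s t. s \<in> {0..l} \<Longrightarrow> t \<in> {0..w} \<Longrightarrow> X (a0 + s + t * r) (b0 + t) c0 \<in> \<Omega>"
  shows "ereal (2 / pi * (l * w)) \<le> Per \<Omega>"
proof -
  define Pg where "Pg = (\<lambda>(s, t). X (a0 + s + t * r) (b0 + t) c0) ` ({0..l} \<times> {0..w})"
  have "compact Pg"
    unfolding Pg_def X_def split_beta by (intro compact_continuous_image continuous_intros compact_Times compact_Icc)
  moreover have "Pg \<subseteq> \<Omega>" using inside by (auto simp: Pg_def)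
  ultimately obtain e where e: "e > 0" "(\<Union>x\<in>Pg. cball x e) \<subseteq> \<Omega>"
    using compact_subset_open_imp_cball_epsilon_subset[OF _ \<Omega>(1)] by blast
  obtain R where R: "\<Omega> \<subseteq> ball 0 R" "R > 0"
    using bounded_subset_ballD[OF \<Omega>(2), of 0] by blast
  \<comment> \<open>A cutoff that is 1 in the ball of radius \<open>R\<close>, hence on \<Omega>,
    and 0 outside the ball of radius R + 1.\<close>
  define k where "k x = step (R\<^sup>2 + 1 - x \<bullet> x)" for x :: "real^3"
  define k' where "k' x = step' (R\<^sup>2 + 1 - x \<bullet> x) *\<^sub>R (- 2 *\<^sub>R x)" for x :: "real^3"
  define A where "A x = 2 / pi * arctan ((x \<bullet> u3 - c0) / e)" for x
  define A' where "A' x = (2 / pi / e / (1 + ((x \<bullet> u3 - c0) / e)\<^sup>2)) *\<^sub>R u3" for x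
  have dk: "GDERIV k x :> k' x" for x
  proof -
    have "GDERIV (\<lambda>x::real^3. R\<^sup>2 + 1 - x \<bullet> x) x :> - 2 *\<^sub>R x"
      unfolding gderiv_def by (auto intro!: derivative_eq_intros simp: inner_commute)
    from GDERIV_DERIV_compose[OF this DERIV_step] show ?thesis
      unfolding k_def[abs_def] k'_def .
  qed
  have dA: "GDERIV A x :> A' x" for x
  proof -
    have "GDERIV (\<lambda>x. x \<bullet> u3) x :> u3"
      unfolding gderiv_def by (auto intro!: derivative_eq_intros)
    moreover have "((\<lambda>y. 2 / pi * arctan ((y - c0) / e)) has_real_derivative
        2 / pi / e / (1 + ((x \<bullet> u3 - c0) / e)\<^sup>2)) (at (x \<bullet> u3))"
      using e(1) by (auto intro!: derivative_eq_intros simp: divide_inverse)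
    ultimately show ?thesis unfolding A_def[abs_def] A'_def by (rule GDERIV_DERIV_compose)
  qed
  define F' where "F' x = k x *\<^sub>R A' x + A x *\<^sub>R k' x" for x
  have dF: "GDERIV (\<lambda>x. k x * A x) x :> F' x" for x
    unfolding F'_def by (rule GDERIV_mult[OF dk dA])
  have pos: "1 + y\<^sup>2 \<noteq> 0" for y :: real using zero_le_power2[of y] by linarith
  have F'c: "continuous_on UNIV F'"
    unfolding F'_def k'_def A'_def using e(1) pos
    by (intro continuous_intros continuous_on_compose2[OF continuous_step'[of UNIV]]
        GDERIV_continuous_on[OF dk] GDERIV_continuous_on[OF dA]) auto
  define \<phi> where "\<phi> x = (k x * A x) *\<^sub>R u3" for x
  have d\<phi>: "(\<phi> has_derivative (\<lambda>h. (h \<bullet> F' x) *\<^sub>R u3)) (at x)" for x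
    unfolding \<phi>_def[abs_def] by (rule has_derivative_scaleR_left[OF dF[unfolded gderiv_def]])
  have "Ck 1 \<phi>"
    unfolding One_nat_def
    by (rule Ck_SucI[OF d\<phi>]) (auto intro!: continuous_intros F'c)
  moreover have "compact_support_in UNIV \<phi>"
  proof -
    have "\<phi> x = 0" if "x \<notin> cball 0 (R + 1)" for x
    proof -
      have "(R + 1)\<^sup>2 \<le> (norm x)\<^sup>2" using that R by (intro power_mono) auto
      then have "R\<^sup>2 + 1 - x \<bullet> x \<le> 0" using R(2) by (simp add: power2_norm_eq_inner power2_sum)
      then show ?thesis by (simp add: \<phi>_def k_def step_le_0)
    qed
    then have "{x. \<phi> x \<noteq> 0} \<subseteq> cball 0 (R + 1)" by blast
    then have "bounded {x. \<phi> x \<noteq> 0}" by (rule bounded_subset[OF bounded_cball])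
    then show ?thesis by (simp add: compact_support_in_def)
  qed
  moreover have "norm (\<phi> x) \<le> 1" for x
  proof -
    have "\<bar>A x\<bar> \<le> 2 / pi * (pi / 2)"
      unfolding A_def abs_mult using arctan_bounded[of "(x \<bullet> u3 - c0) / e"]
      by (intro mult_mono) auto
    then have "\<bar>A x\<bar> \<le> 1" by simp
    moreover have "\<bar>k x\<bar> \<le> 1" using step_bounds by (simp add: k_def)
    ultimately have "\<bar>k x\<bar> * \<bar>A x\<bar> \<le> 1 * 1" by (intro mult_mono) auto
    then show ?thesis by (simp add: \<phi>_def abs_mult norm_eq_sqrt_inner unit)
  qed
  ultimately have sup: "ereal (LINT x|lebesgue_on \<Omega>. divergence \<phi> x) \<le> Per \<Omega>"
    unfolding Per_def by (intro SUP_upper) auto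
  have div: "divergence \<phi> x = F' x \<bullet> u3" for x
    unfolding divergence_def pd_eq[OF d\<phi>] by (simp add: inner_axis' inner_vec_def[of "F' x"])
  have divc: "continuous_on UNIV (divergence \<phi>)"
    unfolding div[abs_def] by (intro continuous_intros F'c)
  have div\<Omega>: "divergence \<phi> x = 2 / pi / e / (1 + ((x \<bullet> u3 - c0) / e)\<^sup>2)" if "x \<in> \<Omega>" for x
  proof -
    have "norm x < R" using that R by auto
    then have "(norm x)\<^sup>2 \<le> R\<^sup>2" by (intro power_mono) auto
    then have "R\<^sup>2 + 1 - x \<bullet> x \<ge> 1" by (simp add: power2_norm_eq_inner)
    then have "k x = 1" "k' x = 0" by (simp_all add: k_def k'_def step_ge_1 step'_outside)
    then show ?thesis by (simp add: div F'_def A'_def unit)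
  qed
  define Pr where "Pr = {x. x \<bullet> u2 \<in> {b0..b0 + w} \<and>
      x \<bullet> u1 \<in> {a0 + r * (x \<bullet> u2 - b0)..a0 + r * (x \<bullet> u2 - b0) + l} \<and> x \<bullet> u3 \<in> {c0 - e..c0 + e}}"
  have Pr: "x \<in> \<Omega>" if "x \<in> Pr" for x
  proof -
    define t s where "t = x \<bullet> u2 - b0" and "s = x \<bullet> u1 - a0 - r * t"
    have ts: "s \<in> {0..l}" "t \<in> {0..w}" using that by (auto simp: Pr_def t_def s_def)
    define y where "y = X (a0 + s + t * r) (b0 + t) c0"
    have "y \<in> Pg" unfolding Pg_def y_def using ts by (intro image_eqI[of _ _ "(s, t)"]) auto
    moreover have "x - y = (x \<bullet> u3 - c0) *\<^sub>R u3"
    proof -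
      have "x = X (x \<bullet> u1) (x \<bullet> u2) (x \<bullet> u3)" by (rule frame_expand)
      also have "\<dots> = y + (x \<bullet> u3 - c0) *\<^sub>R u3"
        by (simp add: y_def X_def s_def t_def algebra_simps)
      finally show ?thesis by (metis add_diff_cancel_left')
    qed
    then have "dist y x \<le> e"
      using that by (simp add: dist_norm norm_minus_commute[of y] norm_eq_sqrt_inner[of u3] unit Pr_def abs_le_iff)
    ultimately have "x \<in> (\<Union>x\<in>Pg. cball x e)" by (intro UN_I[of y]) simp_all
    then show ?thesis using e(2) by blast
  qed
  have Prm: "Pr \<in> sets borel"
    unfolding Pr_def
    by (intro borel_closed) (auto intro!: closed_Collect_conj closed_Collect_le continuous_intros)
  \<comment> \<open>With \<open>u2\<close> as outermost coordinate, each slice of the sheared prism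
    is an interval of length \<open>l\<close> along \<open>u1\<close>, so the shear \<open>r\<close>
    does not affect the volume.\<close>
  interpret sw: orthonormal_frame u2 u1 u3 by (rule swap)
  have ind: "indicator Pr (sw.X b a c) = (indicator {b0..b0 + w} b *
      (indicator {a0 + r * (b - b0)..a0 + r * (b - b0) + l} a * indicator {c0 - e..c0 + e} c) :: ennreal)" for a b c
    by (auto simp: Pr_def indicator_def)
  have vol: "emeasure lborel Pr = ennreal (2 * e * (l * w))"
  proof -
    have "emeasure lborel Pr = (\<integral>\<^sup>+x. indicator Pr x \<partial>lborel)" using Prm by simp
    also have "\<dots> = (\<integral>\<^sup>+b. \<integral>\<^sup>+a. \<integral>\<^sup>+c. indicator {b0..b0 + w} b *
      (indicator {a0 + r * (b - b0)..a0 + r * (b - b0) + l} a * indicator {c0 - e..c0 + e} c) \<partial>lborel \<partial>lborel \<partial>lborel)"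
      using Prm by (subst sw.nn_integral_frame) (auto simp: ind)
    also have "\<dots> = ennreal (2 * e) * ennreal l * ennreal w"
    proof -
      have c: "(\<integral>\<^sup>+c. indicator {b0..b0 + w} b * (indicator {a0 + r * (b - b0)..a0 + r * (b - b0) + l} a
          * indicator {c0 - e..c0 + e} c) \<partial>lborel)
          = (ennreal (2 * e) * indicator {b0..b0 + w} b) * indicator {a0 + r * (b - b0)..a0 + r * (b - b0) + l} a" for a b
        using e(1) nn_integral_indicator_Icc[of "c0 - e" "c0 + e"
            "indicator {b0..b0 + w} b * indicator {a0 + r * (b - b0)..a0 + r * (b - b0) + l} a"]
        by (simp add: mult_ac)
      have a: "(\<integral>\<^sup>+a. (ennreal (2 * e) * indicator {b0..b0 + w} b) * indicator {a0 + r * (b - b0)..a0 + r * (b - b0) + l} a \<partial>lborel)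
          = (ennreal (2 * e) * ennreal l) * indicator {b0..b0 + w} b" for b
        using \<open>l > 0\<close> by (subst nn_integral_indicator_Icc) (auto simp: mult_ac)
      show ?thesis
        unfolding c a using \<open>w > 0\<close> by (subst nn_integral_indicator_Icc) auto
    qed
    also have "\<dots> = ennreal (2 * e * (l * w))"
      using e(1) \<open>l > 0\<close> \<open>w > 0\<close> by (simp add: ennreal_mult'[symmetric] mult_ac)
    finally show ?thesis .
  qed
  have di: "integrable (lebesgue_on \<Omega>) (divergence \<phi>)"
    by (rule integrable_lebesgue_on_continuous[OF divc \<Omega>])
  have ip: "indicator Pr x * (1 / (pi * e)) \<le> divergence \<phi> x" if "x \<in> \<Omega>" for x
  proof (cases "x \<in> Pr")
    case True
    then have "\<bar>(x \<bullet> u3 - c0) / e\<bar> \<le> 1" using e(1) by (simp add: Pr_def abs_le_iff field_simps)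
    then have "((x \<bullet> u3 - c0) / e)\<^sup>2 \<le> 1" by (simp add: abs_square_le_1)
    \<comment> \<open>On the prism the argument of the arctangent is at most 1 in absolute value, so
      the denominator of its derivative is at most 2.\<close>
    then have "2 / pi / e / 2 \<le> 2 / pi / e / (1 + ((x \<bullet> u3 - c0) / e)\<^sup>2)"
      using e(1) by (intro divide_left_mono) (auto intro!: mult_pos_pos add_pos_nonneg)
    then show ?thesis using True div\<Omega>[OF that] by (simp add: mult.commute)
  next
    case False
    then show ?thesis using div\<Omega>[OF that] e(1) by (auto intro!: divide_nonneg_nonneg add_nonneg_nonneg)
  qed
  have "ennreal (2 / pi * (l * w)) = ennreal (1 / (pi * e)) * emeasure lborel Pr"
    using e(1) \<open>l > 0\<close> \<open>w > 0\<close> unfolding vol by (simp add: ennreal_mult'[symmetric] field_simps)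
  also have "\<dots> = (\<integral>\<^sup>+x. ennreal (1 / (pi * e)) * indicator Pr x \<partial>lborel)"
    using Prm by (simp add: nn_integral_cmult_indicator)
  also have "\<dots> = (\<integral>\<^sup>+x. ennreal (1 / (pi * e)) * indicator Pr x \<partial>lebesgue_on \<Omega>)"
    using Prm Pr by (intro nn_integral_lebesgue_on_le(2)[OF _ \<Omega>(1), symmetric]) (auto simp: indicator_def)
  also have "\<dots> \<le> (\<integral>\<^sup>+x. ennreal (divergence \<phi> x) \<partial>lebesgue_on \<Omega>)"
  proof (rule nn_integral_mono)
    fix x assume "x \<in> space (lebesgue_on \<Omega>)"
    then have "x \<in> \<Omega>" by simp
    from ip[OF this] show "ennreal (1 / (pi * e)) * indicator Pr x \<le> ennreal (divergence \<phi> x)"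
      by (auto simp: indicator_def ennreal_leI split: if_splits)
  qed
  also have "\<dots> = ennreal (LINT x|lebesgue_on \<Omega>. divergence \<phi> x)"
  proof (rule nn_integral_eq_integral[OF di], rule AE_I2)
    fix x assume "x \<in> space (lebesgue_on \<Omega>)"
    then show "0 \<le> divergence \<phi> x"
      using ip[of x] e(1) by (auto simp: indicator_def split: if_splits intro: order_trans[rotated])
  qed
  finally have le: "ennreal (2 / pi * (l * w)) \<le> ennreal (LINT x|lebesgue_on \<Omega>. divergence \<phi> x)" .
  have "0 < 2 / pi * (l * w)" using \<open>l > 0\<close> \<open>w > 0\<close> by simp
  then have "2 / pi * (l * w) \<le> (LINT x|lebesgue_on \<Omega>. divergence \<phi> x)"
    using le by (simp add: ennreal_le_iff2)
  then show ?thesis using sup by (meson ereal_less_eq(3) order_trans)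
qed

section \<open>Choice of the frame and the final constant\<close>

text \<open>\<open>P\<close> and \<open>Q\<close> realize the diameter, and \<open>R\<close> is a
  point of the closure farthest from the line through them, at distance \<beta>. Since
  \<open>q\<close> projects orthogonally to \<open>u1\<close>, every direction orthogonal to
  \<open>u1\<close> inherits the bound \<beta>.\<close>

lemma adapted_frame:
  fixes \<Omega> :: "(real^3) set"
  assumes \<Omega>: "\<Omega> \<noteq> {}" "bounded \<Omega>" "open \<Omega>" and diam: "diameter \<Omega> = 1"
  obtains u1 u2 u3 P Q R \<beta> where "orthonormal_frame u1 u2 u3" "0 < \<beta>" "\<beta> \<le> 1"
    "P \<in> closure \<Omega>" "Q \<in> closure \<Omega>" "R \<in> closure \<Omega>"
    "Q - P = u1" "R - P = ((R - P) \<bullet> u1) *\<^sub>R u1 + \<beta> *\<^sub>R u2"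
    "\<And>x. x \<in> \<Omega> \<Longrightarrow> \<bar>(x - P) \<bullet> u2\<bar> \<le> \<beta>" "\<And>x. x \<in> \<Omega> \<Longrightarrow> \<bar>(x - P) \<bullet> u3\<bar> \<le> \<beta>"
proof -
  have cc: "compact (closure \<Omega>)" "closure \<Omega> \<noteq> {}" using \<Omega> by auto
  obtain P Q where PQ: "P \<in> closure \<Omega>" "Q \<in> closure \<Omega>" "dist P Q = 1"
    using diameter_compact_attained[OF cc] diam diameter_closure[OF \<Omega>(2)] by auto
  define u1 where "u1 = Q - P"
  have u1: "u1 \<bullet> u1 = 1"
    using PQ(3) by (simp add: u1_def dist_norm norm_minus_commute norm_eq_1[symmetric])
  define q where "q x = (x - P) - ((x - P) \<bullet> u1) *\<^sub>R u1" for x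
  have qu1: "q x \<bullet> u1 = 0" for x by (simp add: q_def inner_diff_left u1)
  have "continuous_on (closure \<Omega>) (\<lambda>x. norm (q x))" unfolding q_def by (intro continuous_intros)
  from continuous_attains_sup[OF cc this]
  obtain R where R: "R \<in> closure \<Omega>" "\<And>x. x \<in> closure \<Omega> \<Longrightarrow> norm (q x) \<le> norm (q R)" by auto
  define \<beta> where "\<beta> = norm (q R)"
  have q\<beta>: "norm (q x) \<le> \<beta>" if "x \<in> closure \<Omega>" for x using R(2)[OF that] by (simp add: \<beta>_def)
  have "\<beta> > 0"
  proof (rule ccontr)
    assume "\<not> \<beta> > 0"
    then have z: "q x = 0" if "x \<in> \<Omega>" for x
    proof -
      have "norm (q x) \<le> \<beta>" using q\<beta> that closure_subset by blast
      then show ?thesis using \<open>\<not> \<beta> > 0\<close> by (metis norm_le_zero_iff not_less order_trans)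
    qed
    obtain v :: "real^3" where v: "v \<noteq> 0" "u1 \<bullet> v = 0"
      using orthogonal_to_vector_exists[of u1] by (auto simp: orthogonal_def)
    obtain o' where o: "o' \<in> \<Omega>" using \<Omega> by auto
    obtain e where e: "e > 0" "ball o' e \<subseteq> \<Omega>" using \<Omega>(3) o by (auto simp: open_contains_ball)
    \<comment> \<open>If \<Omega> lay on the line, a point moved orthogonally to \<open>u1\<close>
      inside a small ball would contradict this.\<close>
    define y where "y = o' + (e / 2 / norm v) *\<^sub>R v"
    have "y \<in> ball o' e" using e v by (simp add: y_def dist_norm)
    then have "q y = 0" using z e by auto
    moreover have "q y = q o' + (e / 2 / norm v) *\<^sub>R v"
      using v(2) by (simp add: q_def y_def inner_add_left inner_diff_left inner_commute algebra_simps)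
    ultimately show False using z[OF o] e v by simp
  qed
  define u2 where "u2 = (1 / \<beta>) *\<^sub>R q R"
  have u2: "u2 \<bullet> u2 = 1" "u1 \<bullet> u2 = 0"
    using \<open>\<beta> > 0\<close> qu1[of R] dot_square_norm[of "q R"]
    by (simp_all add: u2_def \<beta>_def inner_commute power2_eq_square)
  define u3 where "u3 = cross3 u1 u2"
  have "norm u1 = 1" "norm u2 = 1" using u1 u2 by (simp_all add: norm_eq_sqrt_inner)
  then have u3: "u3 \<bullet> u3 = 1" "u1 \<bullet> u3 = 0" "u2 \<bullet> u3 = 0"
    using norm_cross[of u1 u2] u2(2) by (simp_all add: u3_def dot_cross_self power2_norm_eq_inner)
  have bound: "\<bar>(x - P) \<bullet> u\<bar> \<le> \<beta>" if "x \<in> \<Omega>" "u \<bullet> u = 1" "u1 \<bullet> u = 0" for x u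
  proof -
    have "(x - P) \<bullet> u = q x \<bullet> u" using that(3) by (simp add: q_def inner_diff_left)
    also have "\<bar>\<dots>\<bar> \<le> norm (q x) * norm u" by (rule Cauchy_Schwarz_ineq2)
    also have "\<dots> \<le> \<beta>" using q\<beta>[of x] that closure_subset[of \<Omega>] by (auto simp: norm_eq_sqrt_inner[of u])
    finally show ?thesis .
  qed
  have "\<beta> \<le> 1"
  proof -
    \<comment> \<open>Pythagoras, with R - P of length at most the diameter 1.\<close>
    have "(norm (R - P))\<^sup>2 = ((R - P) \<bullet> u1)\<^sup>2 + \<beta>\<^sup>2"
      unfolding \<beta>_def power2_norm_eq_inner q_def
      by (simp add: inner_diff_left inner_diff_right u1 inner_commute power2_eq_square algebra_simps)
    moreover have "norm (R - P) \<le> 1"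
      using diameter_bounded_bound[OF bounded_closure[OF \<Omega>(2)] R(1) PQ(1)] diam diameter_closure[OF \<Omega>(2)]
      by (simp add: dist_norm)
    then have "(norm (R - P))\<^sup>2 \<le> 1" by (simp add: power_le_one)
    ultimately have "\<beta>\<^sup>2 \<le> 1\<^sup>2" using zero_le_power2[of "(R - P) \<bullet> u1"] unfolding one_power2 by linarith
    then show ?thesis by (rule power2_le_imp_le) simp
  qed
  show ?thesis
  proof (rule that[OF _ \<open>\<beta> > 0\<close> \<open>\<beta> \<le> 1\<close> PQ(1,2) R(1)])
    show "orthonormal_frame u1 u2 u3" using u1 u2 u3 by unfold_locales
    show "R - P = ((R - P) \<bullet> u1) *\<^sub>R u1 + \<beta> *\<^sub>R u2"
      using \<open>\<beta> > 0\<close> by (simp add: u2_def q_def)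
  qed (use bound u2 u3 in \<open>auto simp: u1_def\<close>)
qed

text \<open>The triangle \<open>P\<close>, \<open>Q\<close>, \<open>R\<close> lies in the closure of
  \<Omega>. Contracted by 1/2 towards a point of \<Omega> it lies in \<Omega> itself, and it then
  contains a parallelogram with base 1/4 and height \<beta> / 4.\<close>

lemma J_Per_ge:
  fixes \<Omega> :: "(real^3) set"
  assumes \<Omega>: "\<Omega> \<noteq> {}" "bounded \<Omega>" "open \<Omega>" "convex \<Omega>" and diam: "diameter \<Omega> = 1"
  shows "ereal (1 / 75776) \<le> J_Per \<Omega>"
proof -
  obtain u1 u2 u3 P Q R \<beta> where frame: "orthonormal_frame u1 u2 u3" and \<beta>: "0 < \<beta>" "\<beta> \<le> 1"
    and PQR: "P \<in> closure \<Omega>" "Q \<in> closure \<Omega>" "R \<in> closure \<Omega>"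
    and Q: "Q - P = u1" and R: "R - P = ((R - P) \<bullet> u1) *\<^sub>R u1 + \<beta> *\<^sub>R u2"
    and w: "\<And>x. x \<in> \<Omega> \<Longrightarrow> \<bar>(x - P) \<bullet> u2\<bar> \<le> \<beta>" "\<And>x. x \<in> \<Omega> \<Longrightarrow> \<bar>(x - P) \<bullet> u3\<bar> \<le> \<beta>"
    using adapted_frame[OF \<Omega>(1,2,3) diam] by metis
  interpret orthonormal_frame u1 u2 u3 by (rule frame)
  have diff: "x \<bullet> u - y \<bullet> u = (x - P) \<bullet> u - (y - P) \<bullet> u" for x y u by (simp add: inner_diff_left)
  have lam: "ereal (1 / (592 * (2 * \<beta>)\<^sup>2)) \<le> lambda1_Max \<Omega>"
  proof (rule lambda1_Max_ge[OF \<Omega>(3,4,2)])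
    fix x y assume xy: "x \<in> \<Omega>" "y \<in> \<Omega>"
    show "x \<bullet> u2 - y \<bullet> u2 \<le> 2 * \<beta>" using w(1)[OF xy(1)] w(1)[OF xy(2)] unfolding diff[of x] by linarith
    show "x \<bullet> u3 - y \<bullet> u3 \<le> 2 * \<beta>" using w(2)[OF xy(1)] w(2)[OF xy(2)] unfolding diff[of x] by linarith
  qed (use \<beta> in simp)
  have per: "ereal (2 / pi * (1 / 4 * (\<beta> / 4))) \<le> Per \<Omega>"
  proof -
    obtain p where p: "p \<in> \<Omega>" using \<Omega> by auto
    \<comment> \<open>The image of \<open>P\<close> under the contraction towards \<open>p\<close>,
      which is the corner of the parallelogram.\<close>
    define z where "z = (1/2) *\<^sub>R (p + P)"
    define \<rho> where "\<rho> = (R - P) \<bullet> u1"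
    show ?thesis
    proof (rule Per_ge_section[OF \<Omega>(3,2), where ?a0.0 = "z \<bullet> u1" and ?b0.0 = "z \<bullet> u2" and ?c0.0 = "z \<bullet> u3" and r = "\<rho> / \<beta>"])
      fix s t :: real assume s: "s \<in> {0..1/4}" and t: "t \<in> {0..\<beta> / 4}"
      \<comment> \<open>The weights of \<open>Q\<close> and \<open>R\<close> in the uncontracted
        point; the factor 2 undoes the contraction. Sides of 1/4 and \<beta> / 4 make each weight at
        most 1/2.\<close>
      define a b where "a = 2 * s" and "b = 2 * t / \<beta>"
      have ab: "a \<ge> 0" "b \<ge> 0" "1 - a - b \<ge> 0"
      proof -
        have "b \<le> 1 / 2" using t \<beta> by (simp add: b_def field_simps)
        moreover have "a \<le> 1 / 2" using s by (simp add: a_def)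
        ultimately show "1 - a - b \<ge> 0" by simp
      qed (use s t \<beta> in \<open>auto simp: a_def b_def\<close>)
      define y where "y = (1 - a - b) *\<^sub>R P + a *\<^sub>R Q + b *\<^sub>R R"
      have "y \<in> closure \<Omega>"
      proof -
        have "y \<in> convex hull {P, Q, R}"
          unfolding convex_hull_3 y_def using ab by (intro CollectI exI[of _ "1 - a - b"] exI[of _ a] exI[of _ b]) auto
        also have "\<dots> \<subseteq> closure \<Omega>"
          using PQR convex_closure[OF \<Omega>(4)] by (intro hull_minimal) auto
        finally show ?thesis .
      qed
      then have "y - (1/2) *\<^sub>R (y - p) \<in> interior \<Omega>"
        using p \<Omega>(3) by (intro mem_interior_closure_convex_shrink[OF \<Omega>(4)]) (auto simp: interior_open)
      moreover have "y - (1/2) *\<^sub>R (y - p) = X (z \<bullet> u1 + s + t * (\<rho> / \<beta>)) (z \<bullet> u2 + t) (z \<bullet> u3)"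
      proof -
        have "y = P + a *\<^sub>R (Q - P) + b *\<^sub>R (R - P)" by (simp add: y_def algebra_simps)
        also have "\<dots> = P + a *\<^sub>R u1 + b *\<^sub>R (\<rho> *\<^sub>R u1 + \<beta> *\<^sub>R u2)" using Q R by (simp add: \<rho>_def)
        finally have y: "y = P + (a + b * \<rho>) *\<^sub>R u1 + (b * \<beta>) *\<^sub>R u2" by (simp add: algebra_simps)
        have "b * \<beta> = 2 * t" "b * \<rho> = 2 * (t * (\<rho> / \<beta>))" using \<beta> by (simp_all add: b_def)
        then have "y - (1/2) *\<^sub>R (y - p) = z + (s + t * (\<rho> / \<beta>)) *\<^sub>R u1 + t *\<^sub>R u2"
          unfolding y z_def a_def by (simp add: vec_eq_iff algebra_simps)
        also have "\<dots> = X (z \<bullet> u1) (z \<bullet> u2) (z \<bullet> u3) + (s + t * (\<rho> / \<beta>)) *\<^sub>R u1 + t *\<^sub>R u2"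
          using frame_expand[of z] by simp
        finally show ?thesis by (simp add: X_def algebra_simps)
      qed
      ultimately show "X (z \<bullet> u1 + s + t * (\<rho> / \<beta>)) (z \<bullet> u2 + t) (z \<bullet> u3) \<in> \<Omega>"
        using interior_subset by force
    qed (use \<beta> in auto)
  qed
  \<comment> \<open>The right side is \<beta> / (8 pi), and pi is less than 4.\<close>
  have "\<beta> / 32 \<le> 2 / pi * (1 / 4 * (\<beta> / 4))"
    using \<beta> pi_less_4 by (simp add: field_simps)
  then have per': "ereal (\<beta> / 32) \<le> Per \<Omega>"
    by (intro order_trans[OF _ per]) simp
  have "0 \<le> Per \<Omega>"
    by (rule order_trans[OF _ per']) (use \<beta> in simp)
  then have "ereal (\<beta> / 32) * ereal (1 / (592 * (2 * \<beta>)\<^sup>2)) \<le> Per \<Omega> * lambda1_Max \<Omega>"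
    by (intro ereal_mult_mono per' lam) simp_all
  \<comment> \<open>The right side equals 1 / (75776 \<beta>), where 75776 = 32 * 592 * 4, and
    \<beta> is at most 1.\<close>
  moreover have "1 / 75776 \<le> \<beta> / 32 * (1 / (592 * (2 * \<beta>)\<^sup>2))"
    using \<beta> by (simp add: field_simps power2_eq_square)
  ultimately show ?thesis unfolding J_Per_def by (simp add: order_trans[rotated])
qed

theorem theorem1p5:
  shows "\<exists>c::real. c > 0 \<and>
    (\<forall>(\<Omega> :: nat \<Rightarrow> (real^3) set) (T :: nat \<Rightarrow> real^3 \<Rightarrow> real^3) (\<omega> :: (real^2) set).
       (\<forall>k. \<Omega> k \<noteq> {} \<and> bounded (\<Omega> k) \<and> open (\<Omega> k) \<and> convex (\<Omega> k) \<and> diameter (\<Omega> k) = 1) \<longrightarrow>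
       (\<forall>k. rigid_motion (T k)) \<longrightarrow>
       bounded \<omega> \<and> convex \<omega> \<and> interior \<omega> \<noteq> {} \<longrightarrow>
       (\<lambda>k. hausdorff_dist (closure (T k ` \<Omega> k)) (flat \<omega>)) \<longlonglongrightarrow> 0 \<longrightarrow>
       ereal c \<le> liminf (\<lambda>k. J_Per (\<Omega> k)))"
proof (intro exI[of _ "1 / 75776"] conjI allI impI)
  fix \<Omega> :: "nat \<Rightarrow> (real^3) set"
  assume "\<forall>k. \<Omega> k \<noteq> {} \<and> bounded (\<Omega> k) \<and> open (\<Omega> k) \<and> convex (\<Omega> k) \<and> diameter (\<Omega> k) = 1"
  then show "ereal (1 / 75776) \<le> liminf (\<lambda>k. J_Per (\<Omega> k))"
    by (intro Liminf_bounded always_eventually allI J_Per_ge) auto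
qed simp

end
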